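(* Let $A$ be a $\Delta$-separable Frobenius algebra in an additive symmetric strict monoidal category such that its Nakayama automorphism $N$ satisfies $N\circ N=\mathrm{id}_A$ and $N*\mathrm{id}_A=0$. Let $\underline\Lambda$ be a marked triangulated surface with $B$ parametrised boundary components, together with some choice of edge signs $s:\mathcal C_1\to\{\pm1\}$, and let $\delta_1,\dots,\delta_B\in\{NS,R\}$. If the edge signs $s$ are not admissible, then $$T'_A(\underline\Lambda;s)\circ\bigotimes_{i=1}^B\big(\iota^{13}\circ P^{\delta_i}\big)=0 .$$
   Context: **Algebra.** The category has tensor unit $\mathbf 1$ and symmetric braiding $\sigma_{U,V}$, and $\otimes$ is biadditive. A Frobenius algebra is an object $A$ with a unital associative algebra structure $(\mu,\eta)$ and a counital coassociative coalgebra structure $(\Delta,\varepsilon)$ such that $(\mathrm{id}\otimes\mu)(\Delta\otimes\mathrm{id})=\Delta\mu=(\mu\otimes\mathrm{id})(\mathrm{id}\otimes\Delta)$. Put $b=\varepsilon\circ\mu$; $N=(b\otimes\mathrm{id}_A)\circ(\mathrm{id}_A\otimes\sigma_{A,A})\circ(\mathrm{id}_A\otimes(\Delta\circ\eta))$; $A$ is $\Delta$-separable if $\mu\circ\Delta\circ\eta=\eta$ (equivalently $\mu\circ\Delta=\mathrm{id}_A$). For $f,g\in\mathrm{End}(A)$, $f*g=\mu\circ(f\otimes g)\circ\Delta$. $P^{NS}=\mu\circ\sigma_{A,A}\circ(N\otimes\mathrm{id}_A)\circ\Delta$, $P^R=\mu\circ\sigma_{A,A}\circ\Delta$. $\iota^{13}:A\to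 A^{\otimes3}$ is $(\mathrm{id}_A\otimes\Delta)\circ\Delta$ followed by the permutation reversing the order of the three tensor factors. **Marked triangulated surfaces.** Let $\zeta=e^{2\pi i/3}$. The standard triangle $\underline\Delta\subset\mathbb C$ is the convex hull of $1,\zeta,\zeta^2$; its edges $0,1,2$ are $\{1,\zeta\},\{\zeta,\zeta^2\},\{\zeta^2,1\}$. A surface with parametrised boundary is a compact oriented smooth surface $\Sigma$ with orientation preserving embeddings $\varphi_i:\{1\le|z|<R_i\}\to\Sigma$ ($i=1,\dots,B$) with disjoint images such that the $\varphi_i(S^1)$ are the boundary components. A triangulated surface consists of such a $(\Sigma,\varphi_i)$; a finite oriented simplicial complex $\mathcal C$ with $|\mathcal C|$ a 2-manifold (vertices $\mathcal C_0$, edges $\mathcal C_1$, triangles $\mathcal C_2$); simplicial embeddings $f_i:\partial\underline\Delta\to\partial\mathcal C$ with $\partial\mathcal C=\bigsqcup_if_i(\partial\underline\Delta)$, sending the counterclockwise orientation of $\partial\underline\Delta$ to the opposite of the boundary orientation induced by the adjacent triangles; and an orientation preserving homeomorphism $\varphi:|\mathcal C|\to\Sigma$, a smooth embedding on each simplex, with $\varphi\circ f_i=\varphi_i\circ(z\mapsto z/|z|)$. A marking is a choice, for each edge $e$, of an orientation, and, for each triangle $\sigma$, of a preferred edge $d^2_0(\sigma)$; $d^2_1(\sigma),d^2_2(\sigma)$ are the following edges in counterclockwise order; boundary edges must be oriented so that the adjacent triangle is to their right. $\chi_\sigma:\underline\Delta\to\Sigma$ is $\varphi$ composed with the orientation preserving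 affine isomorphism $\underline\Delta\to\sigma$ sending edge $0$ to $d^2_0(\sigma)$. **Admissible signs.** $s:\mathcal C_1\to\{\pm1\}$ is admissible if (1) for every inner vertex $v$, $\prod_{e\ni v}s(e)=(-1)^{D+K+1}$, where $D$ is the number of triangles $\sigma$ with $\chi_\sigma(1)=v$ and $K$ the number of edges at $v$ pointing away from $v$; (2) for each boundary component $i$ there is a type, NS or R, such that at each of its three vertices $v$, $\prod_{e\ni v}s(e)=(-1)^{D'+K+1}$, with $K$ as before (boundary edges counted), where $D'=D$ for type R, while for type NS $D'=D+1$ if $\varphi_i(1)=v$ and $D'=D$ otherwise. **The morphism $T'_A(\underline\Lambda;s)$.** Set $t=\varepsilon\circ\mu\circ(\mu\otimes\mathrm{id}_A)$, $c_{-1}=\Delta\circ\eta$, $c_1=\sigma_{A,A}\circ\Delta\circ\eta$. Assign $c_{s(e)}:\mathbf 1\to A\otimes A$ to each edge $e$ and $t:A^{\otimes3}\to\mathbf 1$ to each triangle. Connect (using the symmetric braiding) the first output of $c_{s(e)}$ to the triangle on the left of $e$ and the second output to the triangle on the right of $e$, where input number $k+1$ of $t$ for $\sigma$ corresponds to the edge $d^2_k(\sigma)$, $k=0,1,2$. For a boundary edge the first output is not connected and becomes an output of the resulting morphism $\mathbf 1\to(A^{\otimes3})^{\otimes B}$; outputs are ordered by boundary component $i$ and then as $f_i(\text{edge }0),f_i(\text{edge }1),f_i(\text{edge }2)$. $T'_A(\underline\Lambda;s):(A^{\otimes3})^{\otimes B}\to\mathbf 1$ is obtained by pairing via $b$ the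 $l$-th input (first argument) with the $l$-th output (second argument), $l=1,\dots,3B$. *)

theory Defs
  imports "HOL-Analysis.Analysis"
begin

section \<open>Additive symmetric strict monoidal categories\<close>

record ('o, 'm) monoidal_data =
  Obj :: "'o set"
  Hom :: "'o \<Rightarrow> 'o \<Rightarrow> 'm set"
  ident :: "'o \<Rightarrow> 'm"  ("\<i>\<d>\<index>")
  cmp :: "'m \<Rightarrow> 'm \<Rightarrow> 'm"  (infixr "\<cdot>\<index>" 60)
  tobj :: "'o \<Rightarrow> 'o \<Rightarrow> 'o"  (infixr "\<odot>\<index>" 70)
  tmor :: "'m \<Rightarrow> 'm \<Rightarrow> 'm"  (infixr "\<otimes>\<index>" 70)
  uobj :: "'o"  ("\<I>\<index>")
  braid :: "'o \<Rightarrow> 'o \<Rightarrow> 'm"  ("\<sigma>\<index>")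
  hadd :: "'m \<Rightarrow> 'm \<Rightarrow> 'm"  (infixl "\<oplus>\<index>" 65)
  hzero :: "'o \<Rightarrow> 'o \<Rightarrow> 'm"  ("\<zero>\<index>")

locale category =
  fixes C :: "('o, 'm, 'x) monoidal_data_scheme" (structure)
  assumes hom_disjoint:
      "\<lbrakk>f \<in> Hom C X Y; f \<in> Hom C X' Y'; X \<in> Obj C; Y \<in> Obj C; X' \<in> Obj C; Y' \<in> Obj C\<rbrakk>
       \<Longrightarrow> X = X' \<and> Y = Y'"
    and ident_hom: "X \<in> Obj C \<Longrightarrow> \<i>\<d> X \<in> Hom C X X"
    and cmp_hom:
      "\<lbrakk>X \<in> Obj C; Y \<in> Obj C; Z \<in> Obj C; g \<in> Hom C Y Z; f \<in> Hom C X Y\<rbrakk>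
       \<Longrightarrow> g \<cdot> f \<in> Hom C X Z"
    and cmp_assoc:
      "\<lbrakk>W \<in> Obj C; X \<in> Obj C; Y \<in> Obj C; Z \<in> Obj C;
        h \<in> Hom C Y Z; g \<in> Hom C X Y; f \<in> Hom C W X\<rbrakk>
       \<Longrightarrow> (h \<cdot> g) \<cdot> f = h \<cdot> (g \<cdot> f)"
    and ident_left: "\<lbrakk>X \<in> Obj C; Y \<in> Obj C; f \<in> Hom C X Y\<rbrakk> \<Longrightarrow> \<i>\<d> Y \<cdot> f = f"
    and ident_right: "\<lbrakk>X \<in> Obj C; Y \<in> Obj C; f \<in> Hom C X Y\<rbrakk> \<Longrightarrow> f \<cdot> \<i>\<d> X = f"

locale strict_monoidal_category = category +
  assumes uobj_obj: "\<I> \<in> Obj C"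
    and tobj_obj: "\<lbrakk>X \<in> Obj C; Y \<in> Obj C\<rbrakk> \<Longrightarrow> X \<odot> Y \<in> Obj C"
    and tobj_assoc:
      "\<lbrakk>X \<in> Obj C; Y \<in> Obj C; Z \<in> Obj C\<rbrakk> \<Longrightarrow> (X \<odot> Y) \<odot> Z = X \<odot> (Y \<odot> Z)"
    and tobj_unit_left: "X \<in> Obj C \<Longrightarrow> \<I> \<odot> X = X"
    and tobj_unit_right: "X \<in> Obj C \<Longrightarrow> X \<odot> \<I> = X"
    and tmor_hom:
      "\<lbrakk>X \<in> Obj C; Y \<in> Obj C; X' \<in> Obj C; Y' \<in> Obj C; f \<in> Hom C X Y; g \<in> Hom C X' Y'\<rbrakk>
       \<Longrightarrow> f \<otimes> g \<in> Hom C (X \<odot> X') (Y \<odot> Y')"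
    and tmor_ident: "\<lbrakk>X \<in> Obj C; Y \<in> Obj C\<rbrakk> \<Longrightarrow> \<i>\<d> X \<otimes> \<i>\<d> Y = \<i>\<d> (X \<odot> Y)"
    and interchange:
      "\<lbrakk>X \<in> Obj C; Y \<in> Obj C; Z \<in> Obj C; X' \<in> Obj C; Y' \<in> Obj C; Z' \<in> Obj C;
        g \<in> Hom C Y Z; f \<in> Hom C X Y; g' \<in> Hom C Y' Z'; f' \<in> Hom C X' Y'\<rbrakk>
       \<Longrightarrow> (g \<cdot> f) \<otimes> (g' \<cdot> f') = (g \<otimes> g') \<cdot> (f \<otimes> f')"
    and tmor_assoc:
      "\<lbrakk>X \<in> Obj C; Y \<in> Obj C; X' \<in> Obj C; Y' \<in> Obj C; X'' \<in> Obj C; Y'' \<in> Obj C;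
        f \<in> Hom C X Y; g \<in> Hom C X' Y'; h \<in> Hom C X'' Y''\<rbrakk>
       \<Longrightarrow> (f \<otimes> g) \<otimes> h = f \<otimes> (g \<otimes> h)"
    and tmor_unit_left: "\<lbrakk>X \<in> Obj C; Y \<in> Obj C; f \<in> Hom C X Y\<rbrakk> \<Longrightarrow> \<i>\<d> \<I> \<otimes> f = f"
    and tmor_unit_right: "\<lbrakk>X \<in> Obj C; Y \<in> Obj C; f \<in> Hom C X Y\<rbrakk> \<Longrightarrow> f \<otimes> \<i>\<d> \<I> = f"

locale symmetric_strict_monoidal_category = strict_monoidal_category +
  assumes braid_hom:
      "\<lbrakk>X \<in> Obj C; Y \<in> Obj C\<rbrakk> \<Longrightarrow> \<sigma> X Y \<in> Hom C (X \<odot> Y) (Y \<odot> X)"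
    and braid_natural:
      "\<lbrakk>X \<in> Obj C; Y \<in> Obj C; X' \<in> Obj C; Y' \<in> Obj C; f \<in> Hom C X Y; g \<in> Hom C X' Y'\<rbrakk>
       \<Longrightarrow> \<sigma> Y Y' \<cdot> (f \<otimes> g) = (g \<otimes> f) \<cdot> \<sigma> X X'"
    and braid_symmetric:
      "\<lbrakk>X \<in> Obj C; Y \<in> Obj C\<rbrakk> \<Longrightarrow> \<sigma> Y X \<cdot> \<sigma> X Y = \<i>\<d> (X \<odot> Y)"
    and braid_hexagon:
      "\<lbrakk>X \<in> Obj C; Y \<in> Obj C; Z \<in> Obj C\<rbrakk>
       \<Longrightarrow> \<sigma> (X \<odot> Y) Z = (\<sigma> X Z \<otimes> \<i>\<d> Y) \<cdot> (\<i>\<d> X \<otimes> \<sigma> Y Z)"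

locale additive_category = category +
  assumes hadd_hom:
      "\<lbrakk>X \<in> Obj C; Y \<in> Obj C; f \<in> Hom C X Y; g \<in> Hom C X Y\<rbrakk> \<Longrightarrow> f \<oplus> g \<in> Hom C X Y"
    and hzero_hom: "\<lbrakk>X \<in> Obj C; Y \<in> Obj C\<rbrakk> \<Longrightarrow> \<zero> X Y \<in> Hom C X Y"
    and hadd_assoc:
      "\<lbrakk>X \<in> Obj C; Y \<in> Obj C; f \<in> Hom C X Y; g \<in> Hom C X Y; h \<in> Hom C X Y\<rbrakk>
       \<Longrightarrow> (f \<oplus> g) \<oplus> h = f \<oplus> (g \<oplus> h)"
    and hadd_commute:
      "\<lbrakk>X \<in> Obj C; Y \<in> Obj C; f \<in> Hom C X Y; g \<in> Hom C X Y\<rbrakk> \<Longrightarrow> f \<oplus> g = g \<oplus> f"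
    and hadd_zero: "\<lbrakk>X \<in> Obj C; Y \<in> Obj C; f \<in> Hom C X Y\<rbrakk> \<Longrightarrow> f \<oplus> \<zero> X Y = f"
    and hadd_inverse:
      "\<lbrakk>X \<in> Obj C; Y \<in> Obj C; f \<in> Hom C X Y\<rbrakk> \<Longrightarrow> \<exists>g \<in> Hom C X Y. f \<oplus> g = \<zero> X Y"
    and cmp_hadd_right:
      "\<lbrakk>X \<in> Obj C; Y \<in> Obj C; Z \<in> Obj C; h \<in> Hom C Y Z; f \<in> Hom C X Y; g \<in> Hom C X Y\<rbrakk>
       \<Longrightarrow> h \<cdot> (f \<oplus> g) = (h \<cdot> f) \<oplus> (h \<cdot> g)"
    and cmp_hadd_left:
      "\<lbrakk>X \<in> Obj C; Y \<in> Obj C; Z \<in> Obj C; f \<in> Hom C Y Z; g \<in> Hom C Y Z; h \<in> Hom C X Y\<rbrakk>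
       \<Longrightarrow> (f \<oplus> g) \<cdot> h = (f \<cdot> h) \<oplus> (g \<cdot> h)"
    and zero_object:
      "\<exists>Z \<in> Obj C. \<forall>X \<in> Obj C. (\<exists>!f. f \<in> Hom C X Z) \<and> (\<exists>!f. f \<in> Hom C Z X)"
    and biproducts:
      "\<lbrakk>X \<in> Obj C; Y \<in> Obj C\<rbrakk> \<Longrightarrow>
       \<exists>P \<in> Obj C. \<exists>i \<in> Hom C X P. \<exists>j \<in> Hom C Y P. \<exists>p \<in> Hom C P X. \<exists>q \<in> Hom C P Y.
         p \<cdot> i = \<i>\<d> X \<and> q \<cdot> j = \<i>\<d> Y \<and> q \<cdot> i = \<zero> X Y \<and> p \<cdot> j = \<zero> Y X \<and>
         (i \<cdot> p) \<oplus> (j \<cdot> q) = \<i>\<d> P"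

locale additive_symmetric_strict_monoidal_category =
  symmetric_strict_monoidal_category + additive_category +
  assumes tmor_hadd_right:
      "\<lbrakk>X \<in> Obj C; Y \<in> Obj C; X' \<in> Obj C; Y' \<in> Obj C;
        h \<in> Hom C X Y; f \<in> Hom C X' Y'; g \<in> Hom C X' Y'\<rbrakk>
       \<Longrightarrow> h \<otimes> (f \<oplus> g) = (h \<otimes> f) \<oplus> (h \<otimes> g)"
    and tmor_hadd_left:
      "\<lbrakk>X \<in> Obj C; Y \<in> Obj C; X' \<in> Obj C; Y' \<in> Obj C;
        f \<in> Hom C X Y; g \<in> Hom C X Y; h \<in> Hom C X' Y'\<rbrakk>
       \<Longrightarrow> (f \<oplus> g) \<otimes> h = (f \<otimes> h) \<oplus> (g \<otimes> h)"

primrec tpow :: "('o, 'm, 'x) monoidal_data_scheme \<Rightarrow> 'o \<Rightarrow> nat \<Rightarrow> 'o" where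
  "tpow C X 0 = uobj C"
| "tpow C X (Suc n) = X \<odot>\<^bsub>C\<^esub> tpow C X n"

primrec tensor_list :: "('o, 'm, 'x) monoidal_data_scheme \<Rightarrow> 'm list \<Rightarrow> 'm" where
  "tensor_list C [] = ident C (uobj C)"
| "tensor_list C (f # fs) = f \<otimes>\<^bsub>C\<^esub> tensor_list C fs"

text \<open>
  The permutation morphism \<^term>\<open>tpow C X (length ws)\<close> \<open>\<rightarrow>\<close> \<^term>\<open>tpow C X (length ws)\<close>.
  Tensor factors are labelled: the inputs, from left to right, by the distinct labels \<open>ws\<close>,
  the outputs by the rearrangement \<open>vs\<close> of \<open>ws\<close>; each input is connected to the output with the
  same label. The recursion moves the factor labelled \<open>v\<close> past the \<open>k\<close> factors to its left.
\<close>
primrec permute ::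
    "('o, 'm, 'x) monoidal_data_scheme \<Rightarrow> 'o \<Rightarrow> 'w list \<Rightarrow> 'w list \<Rightarrow> 'm" where
  "permute C X ws [] = ident C (uobj C)"
| "permute C X ws (v # vs) =
    (let k = length (takeWhile (\<lambda>w. w \<noteq> v) ws) in
      (ident C X \<otimes>\<^bsub>C\<^esub> permute C X (remove1 v ws) vs) \<cdot>\<^bsub>C\<^esub>
      (braid C (tpow C X k) X \<otimes>\<^bsub>C\<^esub> ident C (tpow C X (length vs - k))))"


section \<open>Frobenius algebras\<close>

record ('o, 'm) frobenius_data =
  carr :: 'o
  mul :: 'm
  unt :: 'm
  comul :: 'm
  counit :: 'm

locale frobenius_algebra = symmetric_strict_monoidal_category C
  for C :: "('o, 'm, 'x) monoidal_data_scheme" (structure) +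
  fixes F :: "('o, 'm, 'y) frobenius_data_scheme"
  assumes carr_obj: "carr F \<in> Obj C"
    and mul_hom: "mul F \<in> Hom C (carr F \<odot> carr F) (carr F)"
    and unt_hom: "unt F \<in> Hom C \<I> (carr F)"
    and comul_hom: "comul F \<in> Hom C (carr F) (carr F \<odot> carr F)"
    and counit_hom: "counit F \<in> Hom C (carr F) \<I>"
    and mul_assoc: "mul F \<cdot> (mul F \<otimes> \<i>\<d> (carr F)) = mul F \<cdot> (\<i>\<d> (carr F) \<otimes> mul F)"
    and mul_unt_left: "mul F \<cdot> (unt F \<otimes> \<i>\<d> (carr F)) = \<i>\<d> (carr F)"
    and mul_unt_right: "mul F \<cdot> (\<i>\<d> (carr F) \<otimes> unt F) = \<i>\<d> (carr F)"
    and comul_coassoc: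
      "(comul F \<otimes> \<i>\<d> (carr F)) \<cdot> comul F = (\<i>\<d> (carr F) \<otimes> comul F) \<cdot> comul F"
    and comul_counit_left: "(counit F \<otimes> \<i>\<d> (carr F)) \<cdot> comul F = \<i>\<d> (carr F)"
    and comul_counit_right: "(\<i>\<d> (carr F) \<otimes> counit F) \<cdot> comul F = \<i>\<d> (carr F)"
    and frobenius_left:
      "(\<i>\<d> (carr F) \<otimes> mul F) \<cdot> (comul F \<otimes> \<i>\<d> (carr F)) = comul F \<cdot> mul F"
    and frobenius_right:
      "comul F \<cdot> mul F = (mul F \<otimes> \<i>\<d> (carr F)) \<cdot> (\<i>\<d> (carr F) \<otimes> comul F)"

definition delta_separable ::
    "('o, 'm, 'x) monoidal_data_scheme \<Rightarrow> ('o, 'm, 'y) frobenius_data_scheme \<Rightarrow> bool" where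
  "delta_separable C F \<longleftrightarrow> mul F \<cdot>\<^bsub>C\<^esub> comul F \<cdot>\<^bsub>C\<^esub> unt F = unt F"

definition frob_pairing ::
    "('o, 'm, 'x) monoidal_data_scheme \<Rightarrow> ('o, 'm, 'y) frobenius_data_scheme \<Rightarrow> 'm" where
  "frob_pairing C F = counit F \<cdot>\<^bsub>C\<^esub> mul F"

definition nakayama ::
    "('o, 'm, 'x) monoidal_data_scheme \<Rightarrow> ('o, 'm, 'y) frobenius_data_scheme \<Rightarrow> 'm" where
  "nakayama C F =
    (frob_pairing C F \<otimes>\<^bsub>C\<^esub> ident C (carr F)) \<cdot>\<^bsub>C\<^esub>
    (ident C (carr F) \<otimes>\<^bsub>C\<^esub> braid C (carr F) (carr F)) \<cdot>\<^bsub>C\<^esub>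
    (ident C (carr F) \<otimes>\<^bsub>C\<^esub> (comul F \<cdot>\<^bsub>C\<^esub> unt F))"

definition convolution ::
    "('o, 'm, 'x) monoidal_data_scheme \<Rightarrow> ('o, 'm, 'y) frobenius_data_scheme \<Rightarrow> 'm \<Rightarrow> 'm \<Rightarrow> 'm"
    where
  "convolution C F f g = mul F \<cdot>\<^bsub>C\<^esub> (f \<otimes>\<^bsub>C\<^esub> g) \<cdot>\<^bsub>C\<^esub> comul F"

datatype boundary_type = type_NS | type_R

fun P_map ::
    "('o, 'm, 'x) monoidal_data_scheme \<Rightarrow> ('o, 'm, 'y) frobenius_data_scheme \<Rightarrow>
     boundary_type \<Rightarrow> 'm" where
  "P_map C F type_NS = mul F \<cdot>\<^bsub>C\<^esub> braid C (carr F) (carr F) \<cdot>\<^bsub>C\<^esub>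
     (nakayama C F \<otimes>\<^bsub>C\<^esub> ident C (carr F)) \<cdot>\<^bsub>C\<^esub> comul F"
| "P_map C F type_R = mul F \<cdot>\<^bsub>C\<^esub> braid C (carr F) (carr F) \<cdot>\<^bsub>C\<^esub> comul F"

definition iota13 ::
    "('o, 'm, 'x) monoidal_data_scheme \<Rightarrow> ('o, 'm, 'y) frobenius_data_scheme \<Rightarrow> 'm" where
  "iota13 C F = permute C (carr F) [0, 1, 2::nat] [2, 1, 0] \<cdot>\<^bsub>C\<^esub>
     (ident C (carr F) \<otimes>\<^bsub>C\<^esub> comul F) \<cdot>\<^bsub>C\<^esub> comul F"


section \<open>Oriented smooth surfaces with parametrised boundary\<close>

primrec differentiable_of_order ::
    "nat \<Rightarrow> ('a::real_normed_vector \<Rightarrow> 'b::real_normed_vector) \<Rightarrow> 'a set \<Rightarrow> bool" where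
  "differentiable_of_order 0 f W \<longleftrightarrow> continuous_on W f"
| "differentiable_of_order (Suc n) f W \<longleftrightarrow>
     (\<forall>x\<in>W. f differentiable at x) \<and>
     (\<forall>v. differentiable_of_order n (\<lambda>x. frechet_derivative f (at x) v) W)"

definition jacobian :: "(complex \<Rightarrow> complex) \<Rightarrow> complex \<Rightarrow> real" where
  "jacobian h z = (let L = frechet_derivative h (at z) in
     Re (L 1) * Im (L \<i>) - Im (L 1) * Re (L \<i>))"

text \<open>
  Real-smooth with positive Jacobian determinant on a not necessarily open set, i.e. locally
  extensible to such a map on an open subset of \<open>\<complex>\<close>. This is used for relatively open
  subsets of a half plane, an annulus or a triangle; there the derivative at a point does not
  depend on the extension \<open>h\<close>.
\<close>
definition oriented_smooth_on :: "complex set \<Rightarrow> (complex \<Rightarrow> complex) \<Rightarrow> bool" where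
  "oriented_smooth_on S f \<longleftrightarrow>
    (\<forall>z\<in>S. \<exists>W h. open W \<and> z \<in> W \<and> (\<forall>n. differentiable_of_order n h W) \<and>
       (\<forall>w\<in>W \<inter> S. h w = f w) \<and> 0 < jacobian h z)"

abbreviation half_plane :: "complex set" where
  "half_plane \<equiv> {z. 0 \<le> Im z}"

definition half_plane_chart :: "'p topology \<Rightarrow> 'p set \<Rightarrow> ('p \<Rightarrow> complex) \<Rightarrow> bool" where
  "half_plane_chart X U \<kappa> \<longleftrightarrow>
     openin X U \<and> openin (top_of_set half_plane) (\<kappa> ` U) \<and>
     homeomorphic_map (subtopology X U) (top_of_set (\<kappa> ` U)) \<kappa>"

definition two_manifold :: "'p topology \<Rightarrow> bool" where
  "two_manifold X \<longleftrightarrow> Hausdorff_space X \<and> second_countable X \<and>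
     (\<forall>p\<in>topspace X. \<exists>U \<kappa>. p \<in> U \<and> half_plane_chart X U \<kappa>)"

record 'p surface =
  points :: "'p topology"
  atlas :: "('p set \<times> ('p \<Rightarrow> complex)) set"

definition oriented_smooth_surface :: "('p, 'x) surface_scheme \<Rightarrow> bool" where
  "oriented_smooth_surface M \<longleftrightarrow>
     Hausdorff_space (points M) \<and> second_countable (points M) \<and>
     (\<forall>(U, \<kappa>)\<in>atlas M. half_plane_chart (points M) U \<kappa>) \<and>
     (\<forall>p\<in>topspace (points M). \<exists>(U, \<kappa>)\<in>atlas M. p \<in> U) \<and>
     (\<forall>(U, \<kappa>)\<in>atlas M. \<forall>(V, \<kappa>')\<in>atlas M.
        oriented_smooth_on (\<kappa> ` (U \<inter> V)) (\<kappa>' \<circ> inv_into U \<kappa>))"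

definition surface_boundary :: "('p, 'x) surface_scheme \<Rightarrow> 'p set" where
  "surface_boundary M = {p. \<exists>(U, \<kappa>)\<in>atlas M. p \<in> U \<and> Im (\<kappa> p) = 0}"

definition oriented_embedding ::
    "('p, 'x) surface_scheme \<Rightarrow> complex set \<Rightarrow> (complex \<Rightarrow> 'p) \<Rightarrow> bool" where
  "oriented_embedding M S f \<longleftrightarrow>
     embedding_map (top_of_set S) (points M) f \<and>
     (\<forall>(U, \<kappa>)\<in>atlas M. oriented_smooth_on (S \<inter> f -` U) (\<kappa> \<circ> f))"

text \<open>The boundary components are indexed by \<open>{..<nbdry M}\<close>.\<close>
record 'p parametrised_surface = "'p surface" +
  nbdry :: nat
  radius :: "nat \<Rightarrow> real"
  bparam :: "nat \<Rightarrow> complex \<Rightarrow> 'p"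

definition annulus :: "real \<Rightarrow> complex set" where
  "annulus r = {z. 1 \<le> norm z \<and> norm z < r}"

definition surface_with_parametrised_boundary :: "('p, 'x) parametrised_surface_scheme \<Rightarrow> bool"
    where
  "surface_with_parametrised_boundary M \<longleftrightarrow>
     oriented_smooth_surface M \<and> compact_space (points M) \<and>
     (\<forall>i<nbdry M. 1 < radius M i \<and> oriented_embedding M (annulus (radius M i)) (bparam M i)) \<and>
     disjoint_family_on (\<lambda>i. bparam M i ` annulus (radius M i)) {..<nbdry M} \<and>
     (\<lambda>i. bparam M i ` sphere 0 1) ` {..<nbdry M} =
       connected_components_of (subtopology (points M) (surface_boundary M))"


section \<open>Triangulated surfaces\<close>

definition simplicial_complex :: "'v set set \<Rightarrow> bool" where
  "simplicial_complex K \<longleftrightarrow>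
     (\<forall>\<tau>\<in>K. finite \<tau> \<and> \<tau> \<noteq> {} \<and> (\<forall>\<rho>. \<rho> \<subseteq> \<tau> \<and> \<rho> \<noteq> {} \<longrightarrow> \<rho> \<in> K))"

text \<open>
  Points are given by their barycentric coordinates. For a finite complex, the product topology
  on \<^typ>\<open>'v \<Rightarrow> real\<close> induces the usual topology on this set.
\<close>
definition realization :: "'v set set \<Rightarrow> ('v \<Rightarrow> real) set" where
  "realization K =
     {x. (\<forall>v. 0 \<le> x v) \<and> {v. x v \<noteq> 0} \<in> K \<and> (\<Sum>v | x v \<noteq> 0. x v) = 1}"

abbreviation vertex_point :: "'v \<Rightarrow> 'v \<Rightarrow> real" where
  "vertex_point v \<equiv> indicator {v}"

definition zeta3 :: complex  ("\<zeta>") where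
  "\<zeta> = exp (2 * of_real pi * \<i> / 3)"

definition std_triangle :: "complex set" where
  "std_triangle = convex hull {1, \<zeta>, \<zeta>\<^sup>2}"

text \<open>
  The affine map sending \<open>1\<close>, \<open>\<zeta>\<close>, \<open>\<zeta>\<^sup>2\<close> to the vertices \<open>a\<close>, \<open>b\<close>, \<open>c\<close>: the barycentric coordinate
  of \<open>z\<close> belonging to \<open>\<zeta>\<^sup>k\<close> is \<open>(1 + 2 Re (z \<zeta>\<^sup>-\<^sup>k)) / 3\<close>.
\<close>
definition affine_map :: "'v \<Rightarrow> 'v \<Rightarrow> 'v \<Rightarrow> complex \<Rightarrow> 'v \<Rightarrow> real" where
  "affine_map a b c z v =
     (1 + 2 * Re z) / 3 * indicator {a} v +
     (1 + 2 * Re (z * cnj \<zeta>)) / 3 * indicator {b} v +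
     (1 + 2 * Re (z * cnj (\<zeta>\<^sup>2))) / 3 * indicator {c} v"

text \<open>
  \<^item> \<open>(a, b, c) \<in> orient T\<close> means that \<open>a\<close>, \<open>b\<close>, \<open>c\<close> are the vertices of a triangle in
    counterclockwise order.
  \<^item> \<open>bmap T i k\<close> is the image of the vertex \<open>\<zeta>\<^sup>k\<close> of the standard triangle under the simplicial
    map \<open>f\<^sub>i\<close>, where \<open>k < 3\<close>.
  \<^item> \<open>homeo T\<close> is the homeomorphism from the realization to the surface.
\<close>
record ('p, 'v) triangulated_surface = "'p parametrised_surface" +
  cplx :: "'v set set"
  orient :: "('v \<times> 'v \<times> 'v) set"
  bmap :: "nat \<Rightarrow> nat \<Rightarrow> 'v"
  homeo :: "('v \<Rightarrow> real) \<Rightarrow> 'p"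

definition vertices :: "('p, 'v, 'x) triangulated_surface_scheme \<Rightarrow> 'v set" where
  "vertices T = {v. {v} \<in> cplx T}"

definition edges :: "('p, 'v, 'x) triangulated_surface_scheme \<Rightarrow> 'v set set" where
  "edges T = {e \<in> cplx T. card e = 2}"

definition triangles :: "('p, 'v, 'x) triangulated_surface_scheme \<Rightarrow> 'v set set" where
  "triangles T = {\<tau> \<in> cplx T. card \<tau> = 3}"

definition boundary_edges :: "('p, 'v, 'x) triangulated_surface_scheme \<Rightarrow> 'v set set" where
  "boundary_edges T = {e \<in> edges T. \<exists>!\<tau>. \<tau> \<in> triangles T \<and> e \<subseteq> \<tau>}"

definition inner_vertices :: "('p, 'v, 'x) triangulated_surface_scheme \<Rightarrow> 'v set" where
  "inner_vertices T = vertices T - \<Union> (boundary_edges T)"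

text \<open>The image under \<open>f\<^sub>i\<close> of edge \<open>k\<close> of the standard triangle.\<close>
definition bedge :: "('p, 'v, 'x) triangulated_surface_scheme \<Rightarrow> nat \<Rightarrow> nat \<Rightarrow> 'v set" where
  "bedge T i k = {bmap T i k, bmap T i (Suc k mod 3)}"

text \<open>
  The last condition says that two triangles sharing an edge induce opposite orientations on it.
\<close>
definition coherent_orientation :: "'v set set \<Rightarrow> ('v \<times> 'v \<times> 'v) set \<Rightarrow> bool" where
  "coherent_orientation K Q \<longleftrightarrow>
     (\<forall>(a, b, c)\<in>Q. {a, b, c} \<in> K \<and> card {a, b, c} = 3 \<and> (b, c, a) \<in> Q \<and> (b, a, c) \<notin> Q) \<and>
     (\<forall>a b c. {a, b, c} \<in> K \<and> card {a, b, c} = 3 \<longrightarrow> (a, b, c) \<in> Q \<or> (b, a, c) \<in> Q) \<and>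
     (\<forall>a b c d. (a, b, c) \<in> Q \<and> (a, b, d) \<in> Q \<longrightarrow> c = d)"

text \<open>
  In the clause on \<open>bmap\<close>, the adjacent triangle induces on the \<open>k\<close>-th edge the direction from
  \<open>f\<^sub>i(\<zeta>\<^sup>k\<^sup>+\<^sup>1)\<close> to \<open>f\<^sub>i(\<zeta>\<^sup>k)\<close>, opposite to the counterclockwise direction of the standard triangle.
  On the frontier of the standard triangle \<^const>\<open>affine_map\<close> with vertices \<open>f\<^sub>i(1)\<close>, \<open>f\<^sub>i(\<zeta>)\<close>,
  \<open>f\<^sub>i(\<zeta>\<^sup>2)\<close> is the realization of \<open>f\<^sub>i\<close>. Smoothness of \<open>homeo\<close> on edges and vertices
  follows by restriction, as every simplex of a 2-manifold is a face of a triangle.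
\<close>
definition triangulated_surface :: "('p, 'v, 'x) triangulated_surface_scheme \<Rightarrow> bool" where
  "triangulated_surface T \<longleftrightarrow>
     surface_with_parametrised_boundary T \<and>
     simplicial_complex (cplx T) \<and> finite (cplx T) \<and> (\<forall>\<tau>\<in>cplx T. card \<tau> \<le> 3) \<and>
     two_manifold (top_of_set (realization (cplx T))) \<and>
     coherent_orientation (cplx T) (orient T) \<and>
     inj_on (\<lambda>(i, k). bmap T i k) ({..<nbdry T} \<times> {..<3}) \<and>
     (\<lambda>(i, k). bedge T i k) ` ({..<nbdry T} \<times> {..<3}) = boundary_edges T \<and>
     (\<forall>i<nbdry T. \<forall>k<3. \<exists>c. (bmap T i (Suc k mod 3), bmap T i k, c) \<in> orient T) \<and>
     homeomorphic_map (top_of_set (realization (cplx T))) (points T) (homeo T) \<and>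
     (\<forall>(a, b, c)\<in>orient T. oriented_embedding T std_triangle (homeo T \<circ> affine_map a b c)) \<and>
     (\<forall>i<nbdry T. \<forall>z\<in>frontier std_triangle.
        homeo T (affine_map (bmap T i 0) (bmap T i 1) (bmap T i 2) z) = bparam T i (z /\<^sub>R norm z))"


section \<open>Markings and admissible edge signs\<close>

text \<open>
  \<open>eorient T e = (u, v)\<close> means that the edge \<open>e\<close> points from \<open>u\<close> to \<open>v\<close>; \<open>pref T \<tau>\<close> is the
  preferred edge of the triangle \<open>\<tau>\<close>.
\<close>
record ('p, 'v) marked_surface = "('p, 'v) triangulated_surface" +
  eorient :: "'v set \<Rightarrow> 'v \<times> 'v"
  pref :: "'v set \<Rightarrow> 'v set"

definition on_left :: "('p, 'v, 'x) marked_surface_scheme \<Rightarrow> 'v set \<Rightarrow> 'v set \<Rightarrow> bool" where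
  "on_left T e \<tau> \<longleftrightarrow>
     (\<exists>c. (fst (eorient T e), snd (eorient T e), c) \<in> orient T \<and>
          \<tau> = {fst (eorient T e), snd (eorient T e), c})"

definition on_right :: "('p, 'v, 'x) marked_surface_scheme \<Rightarrow> 'v set \<Rightarrow> 'v set \<Rightarrow> bool" where
  "on_right T e \<tau> \<longleftrightarrow>
     (\<exists>c. (snd (eorient T e), fst (eorient T e), c) \<in> orient T \<and>
          \<tau> = {snd (eorient T e), fst (eorient T e), c})"

definition marked_triangulated_surface :: "('p, 'v, 'x) marked_surface_scheme \<Rightarrow> bool" where
  "marked_triangulated_surface T \<longleftrightarrow>
     triangulated_surface T \<and>
     (\<forall>e\<in>edges T. e = {fst (eorient T e), snd (eorient T e)}) \<and>
     (\<forall>\<tau>\<in>triangles T. pref T \<tau> \<in> edges T \<and> pref T \<tau> \<subseteq> \<tau>) \<and>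
     (\<forall>e\<in>boundary_edges T. \<forall>\<tau>\<in>triangles T. e \<subseteq> \<tau> \<longrightarrow> on_right T e \<tau>)"

text \<open>The vertices \<open>(a, b, c)\<close> of \<open>\<tau>\<close> to which \<open>\<chi>\<^sub>\<tau>\<close> sends \<open>1\<close>, \<open>\<zeta>\<close>, \<open>\<zeta>\<^sup>2\<close>.\<close>
definition corners :: "('p, 'v, 'x) marked_surface_scheme \<Rightarrow> 'v set \<Rightarrow> 'v \<times> 'v \<times> 'v" where
  "corners T \<tau> = (THE (a, b, c). (a, b, c) \<in> orient T \<and> {a, b, c} = \<tau> \<and> {a, b} = pref T \<tau>)"

definition chi :: "('p, 'v, 'x) marked_surface_scheme \<Rightarrow> 'v set \<Rightarrow> complex \<Rightarrow> 'p" where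
  "chi T \<tau> = (case corners T \<tau> of (a, b, c) \<Rightarrow> homeo T \<circ> affine_map a b c)"

text \<open>The edges \<open>d\<^sup>2\<^sub>0\<close>, \<open>d\<^sup>2\<^sub>1\<close>, \<open>d\<^sup>2\<^sub>2\<close> of a triangle.\<close>
definition tri_edges :: "('p, 'v, 'x) marked_surface_scheme \<Rightarrow> 'v set \<Rightarrow> 'v set list" where
  "tri_edges T \<tau> = (case corners T \<tau> of (a, b, c) \<Rightarrow> [{a, b}, {b, c}, {c, a}])"

definition D_count :: "('p, 'v, 'x) marked_surface_scheme \<Rightarrow> 'v \<Rightarrow> nat" where
  "D_count T v = card {\<tau> \<in> triangles T. chi T \<tau> 1 = homeo T (vertex_point v)}"

definition K_count :: "('p, 'v, 'x) marked_surface_scheme \<Rightarrow> 'v \<Rightarrow> nat" where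
  "K_count T v = card {e \<in> edges T. fst (eorient T e) = v}"

definition D'_count ::
    "('p, 'v, 'x) marked_surface_scheme \<Rightarrow> nat \<Rightarrow> boundary_type \<Rightarrow> 'v \<Rightarrow> nat" where
  "D'_count T i \<delta> v =
     (if \<delta> = type_NS \<and> bparam T i 1 = homeo T (vertex_point v) then D_count T v + 1
      else D_count T v)"

definition admissible ::
    "('p, 'v, 'x) marked_surface_scheme \<Rightarrow> ('v set \<Rightarrow> int) \<Rightarrow> bool" where
  "admissible T s \<longleftrightarrow>
     (\<forall>v\<in>inner_vertices T.
        (\<Prod>e | e \<in> edges T \<and> v \<in> e. s e) = (-1) ^ (D_count T v + K_count T v + 1)) \<and>
     (\<forall>i<nbdry T. \<exists>\<delta>. \<forall>k<3. let v = bmap T i k in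
        (\<Prod>e | e \<in> edges T \<and> v \<in> e. s e) = (-1) ^ (D'_count T i \<delta> v + K_count T v + 1))"


section \<open>The morphism assigned to a marked triangulated surface\<close>

definition tri_form ::
    "('o, 'm, 'x) monoidal_data_scheme \<Rightarrow> ('o, 'm, 'y) frobenius_data_scheme \<Rightarrow> 'm" where
  "tri_form C F = counit F \<cdot>\<^bsub>C\<^esub> mul F \<cdot>\<^bsub>C\<^esub> (mul F \<otimes>\<^bsub>C\<^esub> ident C (carr F))"

definition edge_form ::
    "('o, 'm, 'x) monoidal_data_scheme \<Rightarrow> ('o, 'm, 'y) frobenius_data_scheme \<Rightarrow> int \<Rightarrow> 'm" where
  "edge_form C F \<epsilon> =
     (if \<epsilon> = 1 then braid C (carr F) (carr F) \<cdot>\<^bsub>C\<^esub> comul F \<cdot>\<^bsub>C\<^esub> unt F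
      else comul F \<cdot>\<^bsub>C\<^esub> unt F)"

text \<open>
  Tensor factors are labelled by pairs of an edge and a side: \<open>(e, Left)\<close> and \<open>(e, Right)\<close> are
  the first and second output of the morphism assigned to \<open>e\<close>.
\<close>
datatype side = Left | Right

definition edge_wires :: "'v set list \<Rightarrow> ('v set \<times> side) list" where
  "edge_wires es = concat (map (\<lambda>e. [(e, Left), (e, Right)]) es)"

definition triangle_wires ::
    "('p, 'v, 'x) marked_surface_scheme \<Rightarrow> 'v set list \<Rightarrow> ('v set \<times> side) list" where
  "triangle_wires T ts = concat (map (\<lambda>\<tau>.
     map (\<lambda>e. (e, if on_left T e \<tau> then Left else Right)) (tri_edges T \<tau>)) ts)"

definition boundary_wires ::
    "('p, 'v, 'x) marked_surface_scheme \<Rightarrow> ('v set \<times> side) list" where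
  "boundary_wires T = concat (map (\<lambda>i.
     map (\<lambda>k. (bedge T i k, Left)) [0, 1, 2]) [0..<nbdry T])"

text \<open>
  The lists \<open>es\<close> and \<open>ts\<close> enumerate the edges and the triangles. They fix the order in which the
  morphisms \<open>c\<close> and \<open>t\<close> are tensored together; the result does not depend on it, because
  the labels determine the connections.
\<close>
definition T_out ::
    "('o, 'm, 'x) monoidal_data_scheme \<Rightarrow> ('o, 'm, 'y) frobenius_data_scheme \<Rightarrow>
     ('p, 'v, 'z) marked_surface_scheme \<Rightarrow> ('v set \<Rightarrow> int) \<Rightarrow>
     'v set list \<Rightarrow> 'v set list \<Rightarrow> 'm" where
  "T_out C F T s es ts =
     (ident C (tpow C (carr F) (3 * nbdry T)) \<otimes>\<^bsub>C\<^esub>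
        tensor_list C (map (\<lambda>\<tau>. tri_form C F) ts)) \<cdot>\<^bsub>C\<^esub>
     permute C (carr F) (edge_wires es) (boundary_wires T @ triangle_wires T ts) \<cdot>\<^bsub>C\<^esub>
     tensor_list C (map (\<lambda>e. edge_form C F (s e)) es)"

text \<open>
  \<open>T_in\<close> is the morphism \<open>T'\<^sub>A\<close>. The label \<open>Inl l\<close> stands for the \<open>l\<close>-th input of \<open>T_in\<close>, the label \<open>Inr l\<close> for the \<open>l\<close>-th output
  of \<^const>\<open>T_out\<close>.
\<close>
definition T_in ::
    "('o, 'm, 'x) monoidal_data_scheme \<Rightarrow> ('o, 'm, 'y) frobenius_data_scheme \<Rightarrow>
     ('p, 'v, 'z) marked_surface_scheme \<Rightarrow> ('v set \<Rightarrow> int) \<Rightarrow>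
     'v set list \<Rightarrow> 'v set list \<Rightarrow> 'm" where
  "T_in C F T s es ts = (let n = 3 * nbdry T in
     tensor_list C (replicate n (frob_pairing C F)) \<cdot>\<^bsub>C\<^esub>
     permute C (carr F) (map Inl [0..<n] @ map Inr [0..<n])
       (concat (map (\<lambda>l. [Inl l, Inr l]) [0..<n])) \<cdot>\<^bsub>C\<^esub>
     (ident C (tpow C (carr F) n) \<otimes>\<^bsub>C\<^esub> T_out C F T s es ts))"

end

theory Submission
  imports Defs
begin

text \<open>
  An element \<open>h\<close> of \<open>A\<close> inserted at a corner of a triangle can be slid around the vertex of that
  corner: a triangle form moves it from one leg to the next, and an edge copairing moves it to the
  neighbouring triangle. Each step may apply the Nakayama automorphism \<open>N\<close>, and as \<open>N\<close> is an
  involution only the parity \<open>\<kappa>\<close> of the total number of twists around the vertex matters. At a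
  boundary vertex the loop closes through the pairings and the coproducts of \<open>\<iota>\<^sup>1\<^sup>3\<close>, the vertex
  \<open>\<phi>\<^sub>i(1)\<close> using that the image of \<open>P\<close> is (twisted) central. By \<open>\<Delta>\<close>-separability nothing changes
  when \<open>\<Sum>pq = 1\<close>, the product of the copairing \<open>\<Sum>p \<otimes> q\<close>, is inserted at one corner, and
  sliding \<open>p\<close> once around turns this into the insertion of \<open>\<Sum>q N\<^sup>\<kappa>(p)\<close>. The sign condition at
  the vertex fails exactly if \<open>\<kappa>\<close> is even, and then \<open>\<Sum>qp = \<Sum>N(p)q = (N * id)(1) = 0\<close>.
\<close>

text \<open>A morphism has no elements to slide, and the connections are composites of braidings.
  The diagram is therefore cut into \<open>Bottom\<close> (boundary insertions and edge copairings),
  a permutation of labelled strands, and \<open>Top\<close> (pairings and triangle forms). As an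
  insertion at a label commutes with the permutation, a slide only alternates between local moves at
  single pieces of \<open>Bottom\<close> and of \<open>Top\<close>.

  The count of twists explains the signs: crossing an edge e counterclockwise around v costs N
  exactly if s(e), negated when e points away from v, is -1; a triangle costs N only at its corner
  \<chi>(1), where h passes from the end of a product to its front. Hence (-1)^\<kappa> is
  (-1)^(D+K) times the product of the signs at v, and the outer face adds D' - D modulo 2.

  The turn around v has to meet every edge at v exactly once. For a complex only known to be a
  topological 2-manifold this needs proof: a point of a surface, also on the boundary, has small
  neighbourhoods that stay connected when it is removed, and therefore the link of v is
  connected.\<close>

text \<open>The same strands are labelled in several ways, by edge sides, by positions and by sums
  of both; this translates between permutation morphisms so labelled.\<close>

lemma permute_map:
  assumes "inj_on f (set ws \<union> set vs)"
  shows "permute C X (map f ws) (map f vs) = permute C X ws vs"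
  using assms
proof (induction vs arbitrary: ws)
  case (Cons v vs)
  have inj: "f w = f v \<longleftrightarrow> w = v" if "w \<in> set ws" for w
    using inj_on_eq_iff[OF Cons.prems, of w v] that by simp
  have "takeWhile (\<lambda>w. w \<noteq> f v) (map f ws) = map f (takeWhile (\<lambda>w. w \<noteq> v) ws)"
    unfolding takeWhile_map using inj by (auto intro!: arg_cong[of _ _ "map f"] takeWhile_cong)
  moreover have "remove1 (f v) (map f ws) = map f (remove1 v ws)"
  proof -
    have "\<forall>w\<in>set xs. (f v = f w) = (v = w) \<Longrightarrow> remove1 (f v) (map f xs) = map f (remove1 v xs)" for xs
      by (induction xs) auto
    then show ?thesis using inj by (auto simp: eq_commute[of "f v"] eq_commute[of v])
  qed
  moreover have "permute C X (map f (remove1 v ws)) (map f vs) = permute C X (remove1 v ws) vs"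
    by (rule Cons.IH, rule inj_on_subset[OF Cons.prems]) (auto dest: notin_set_remove1)
  ultimately show ?case by (simp add: Let_def)
qed simp

abbreviation triangle_labels :: "('p, 'v, 'x) marked_surface_scheme \<Rightarrow> 'v set \<Rightarrow> ('v set \<times> side) list" where
  "triangle_labels T \<tau> \<equiv> map (\<lambda>e. (e, if on_left T e \<tau> then Left else Right)) (tri_edges T \<tau>)"

lemma boundary_wires_nth:
  "i < nbdry T \<Longrightarrow> k < 3 \<Longrightarrow> boundary_wires T ! (3 * i + k) = (bedge T i k, Left)"
proof -
  have "i < m \<Longrightarrow> concat (map (\<lambda>i. map (\<lambda>k. (bedge T i k, Left)) [0, 1, 2]) [0..<m]) ! (3 * i + k) = (bedge T i k, Left)"
    if k: "k < 3" for m
  proof (induction m)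
    case (Suc m)
    let ?c = "concat (map (\<lambda>i. map (\<lambda>k. (bedge T i k, Left)) [0, 1, 2]) [0..<m])"
    have len: "length ?c = 3 * m" by (induction m) auto
    show ?case
    proof (cases "i < m")
      case True
      then show ?thesis using Suc.IH len k by (simp add: nth_append)
    next
      case False
      then have "i = m" using Suc.prems by simp
      moreover have "k = 0 \<or> k = 1 \<or> k = 2" using k by linarith
      ultimately show ?thesis using len by (auto simp: nth_append)
    qed
  qed simp
  then show "i < nbdry T \<Longrightarrow> k < 3 \<Longrightarrow> boundary_wires T ! (3 * i + k) = (bedge T i k, Left)"
    by (simp add: boundary_wires_def)
qed

lemma length_boundary_wires: "length (boundary_wires T) = 3 * nbdry T"
proof -
  have "length (concat (map (\<lambda>i. map (\<lambda>k. (bedge T i k, Left)) [0, 1, 2]) [0..<m])) = 3 * m" for m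
    by (induction m) auto
  then show ?thesis by (simp add: boundary_wires_def)
qed

lemma length_triangle_wires: "length (triangle_wires T ts) = 3 * length ts"
  by (induction ts) (auto simp: triangle_wires_def tri_edges_def split: prod.splits)

lemma length_edge_wires: "length (edge_wires es) = 2 * length es"
  by (induction es) (auto simp: edge_wires_def)

lemma upt_triples: "concat (map (\<lambda>i. [3 * i, 3 * i + 1, 3 * i + 2]) [0..<m]) = [0..<3 * m]"
proof (induction m)
  case (Suc m)
  have "3 * Suc m = Suc (Suc (Suc (3 * m)))" by simp
  then show ?case using Suc.IH by (simp del: mult_Suc_right)
qed simp

section \<open>Links of vertices in a triangulated 2-manifold\<close>

text \<open>The half disc is convex and contains an open set, so it is not collinear, and a
  non-collinear convex set minus a countable set is connected. Interior points and points of the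
  boundary line are thus treated alike.\<close>

lemma connected_half_disc_punctured:
  assumes "Im q \<ge> 0" "r > 0"
  shows "connected (half_plane \<inter> ball q r - {q})" "half_plane \<inter> ball q r - {q} \<noteq> {}"
proof -
  let ?B = "half_plane \<inter> ball q r"
  let ?O = "{z. 0 < Im z} \<inter> ball q r"
  have "convex ?B"
    by (intro convex_Int convex_ball) (rule convex_halfspace_Im_ge)
  have "q + \<i> * of_real (r / 2) \<in> ?O"
    using assms by (auto simp: dist_norm norm_mult)
  moreover have "open ?O"
    by (intro open_Int open_ball) (rule open_halfspace_Im_gt)
  ultimately have "?O \<noteq> {}" "open ?O" by blast+
  then have "aff_dim ?O = 2"
    using aff_dim_open[of ?O] by simp
  moreover have "aff_dim ?O \<le> aff_dim ?B"
    by (intro aff_dim_subset) auto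
  ultimately have nc: "\<not> collinear ?B"
    by (simp add: collinear_aff_dim)
  show "connected (?B - {q})"
    by (rule connected_convex_diff_countable[OF \<open>convex ?B\<close> nc]) simp
  show "?B - {q} \<noteq> {}"
  proof
    assume "?B - {q} = {}"
    then have "?B \<subseteq> {q}" by blast
    then have "collinear ?B" using collinear_subset[OF collinear_sing] by blast
    then show False using nc by simp
  qed
qed

text \<open>A small disc or half disc about the chart image of \<open>p\<close>, pulled back. The
  manifold condition enters the combinatorics through this punctured neighbourhood.\<close>

lemma two_manifold_punctured_neighbourhood:
  fixes X :: "'a::topological_space set"
  assumes M: "two_manifold (top_of_set X)" and p: "p \<in> X" and U: "open U" "p \<in> U"
  obtains W where "openin (top_of_set X) W" "p \<in> W" "W \<subseteq> U" "connected (W - {p})" "W - {p} \<noteq> {}"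
proof -
  obtain V \<kappa> where "p \<in> V" and chart: "half_plane_chart (top_of_set X) V \<kappa>"
    using M p unfolding two_manifold_def by auto
  have V: "openin (top_of_set X) V" "V \<subseteq> X"
    and im: "openin (top_of_set half_plane) (\<kappa> ` V)"
    and "homeomorphic_map (subtopology (top_of_set X) V) (top_of_set (\<kappa> ` V)) \<kappa>"
    using chart openin_imp_subset unfolding half_plane_chart_def by auto
  then have "homeomorphic_map (top_of_set V) (top_of_set (\<kappa> ` V)) \<kappa>"
    by (simp add: subtopology_subtopology Int_absorb1)
  then obtain g where "homeomorphic_maps (top_of_set V) (top_of_set (\<kappa> ` V)) \<kappa> g"
    using homeomorphic_map_maps by blast
  then have cont: "continuous_on V \<kappa>" "continuous_on (\<kappa> ` V) g"
    and inv: "\<And>x. x \<in> V \<Longrightarrow> g (\<kappa> x) = x" "\<And>y. y \<in> \<kappa> ` V \<Longrightarrow> \<kappa> (g y) = y"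
    and gV: "g ` \<kappa> ` V \<subseteq> V"
    unfolding homeomorphic_maps_def by auto
  have "openin (top_of_set (\<kappa> ` V)) (\<kappa> ` V \<inter> g -` U)"
    by (rule continuous_openin_preimage_gen[OF cont(2) U(1)])
  then have "openin (top_of_set half_plane) (\<kappa> ` V \<inter> g -` U)"
    using openin_trans im by blast
  then obtain S where S: "open S" "\<kappa> ` V \<inter> g -` U = half_plane \<inter> S"
    unfolding openin_open by blast
  have q: "\<kappa> p \<in> half_plane \<inter> S"
    using S(2) \<open>p \<in> V\<close> inv(1) U(2) by (metis IntI image_eqI vimageI)
  then obtain r where r: "r > 0" "ball (\<kappa> p) r \<subseteq> S"
    using S(1) by (auto elim: openE)
  define B where "B = half_plane \<inter> ball (\<kappa> p) r"
  have B: "B \<subseteq> \<kappa> ` V" "B \<subseteq> g -` U" "\<kappa> p \<in> B"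
    using S(2) r q unfolding B_def by auto
  define W where "W = V \<inter> \<kappa> -` ball (\<kappa> p) r"
  have kV: "\<kappa> ` V \<subseteq> half_plane" using openin_imp_subset[OF im] by simp
  have W_eq: "W = g ` B"
  proof
    show "W \<subseteq> g ` B"
    proof
      fix x assume x: "x \<in> W"
      then have "\<kappa> x \<in> B" "g (\<kappa> x) = x" using kV inv(1) unfolding W_def B_def by auto
      then show "x \<in> g ` B" by (metis image_eqI)
    qed
    show "g ` B \<subseteq> W"
    proof
      fix x assume "x \<in> g ` B"
      then obtain y where y: "y \<in> B" "x = g y" by blast
      then have "y \<in> \<kappa> ` V" using B(1) by blast
      then have "\<kappa> x = y" "x \<in> V" using inv(2) gV y by blast+
      then show "x \<in> W" using y(1) unfolding W_def B_def by auto
    qed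
  qed
  show thesis
  proof
    have "openin (top_of_set V) W"
      unfolding W_def by (rule continuous_openin_preimage_gen[OF cont(1) open_ball])
    then show "openin (top_of_set X) W" using V(1) openin_trans by blast
    show "p \<in> W" using \<open>p \<in> V\<close> r(1) by (simp add: W_def)
    show "W \<subseteq> U" using W_eq B(2) by auto
    have eq: "W - {p} = g ` (B - {\<kappa> p})"
    proof -
      have "inj_on g B" using B(1) inv(2) by (metis inj_on_def subsetD)
      then show ?thesis
        using W_eq B(3) inv(1)[OF \<open>p \<in> V\<close>] by (simp add: inj_on_image_set_diff)
    qed
    have "connected (B - {\<kappa> p})" "B - {\<kappa> p} \<noteq> {}"
      using connected_half_disc_punctured[of "\<kappa> p" r] q r(1) unfolding B_def by auto
    moreover have "continuous_on (B - {\<kappa> p}) g"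
      using cont(2) B(1) by (meson Diff_subset continuous_on_subset order_trans)
    ultimately show "connected (W - {p})" "W - {p} \<noteq> {}"
      unfolding eq by (simp_all add: connected_continuous_image)
  qed
qed

text \<open>\<open>U1\<close> and \<open>U2\<close> would separate a connected punctured
  neighbourhood of \<open>p\<close>. This contradiction is applied to the midpoint of an edge and to
  a vertex.\<close>

lemma two_manifold_not_locally_separated:
  fixes X :: "'a::topological_space set"
  assumes M: "two_manifold (top_of_set X)" and p: "p \<in> X" and U: "open U" "p \<in> U"
    and "open U1" "open U2" and cover: "X \<inter> U - {p} \<subseteq> U1 \<union> U2"
    and disj: "X \<inter> U \<inter> U1 \<inter> U2 = {}" and notin: "p \<notin> U1" "p \<notin> U2"
    and near1: "\<And>S. open S \<Longrightarrow> p \<in> S \<Longrightarrow> X \<inter> S \<inter> U1 \<noteq> {}"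
    and near2: "\<And>S. open S \<Longrightarrow> p \<in> S \<Longrightarrow> X \<inter> S \<inter> U2 \<noteq> {}"
  shows False
proof -
  obtain W where W: "openin (top_of_set X) W" "p \<in> W" "W \<subseteq> U" "connected (W - {p})"
    using two_manifold_punctured_neighbourhood[OF M p U] by metis
  obtain S where S: "open S" "W = X \<inter> S" using W(1) unfolding openin_open by blast
  have "W \<subseteq> X" using S by blast
  have "U1 \<inter> (W - {p}) = {} \<or> U2 \<inter> (W - {p}) = {}"
    using connectedD[OF W(4) \<open>open U1\<close> \<open>open U2\<close>] cover disj \<open>W \<subseteq> X\<close> W(3) by blast
  moreover have "X \<inter> S \<inter> U1 \<noteq> {}" "X \<inter> S \<inter> U2 \<noteq> {}"
    using near1[OF S(1)] near2[OF S(1)] W(2) S(2) by auto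
  ultimately show False using notin S(2) by blast
qed

definition segment_point :: "'v \<Rightarrow> 'v \<Rightarrow> real \<Rightarrow> 'v \<Rightarrow> real" where
  "segment_point v u t x = (1 - t) * indicator {v} x + t * indicator {u} x"

lemma segment_point_realization:
  assumes "v \<noteq> u" "{v, u} \<in> K" "0 < t" "t < 1"
  shows "segment_point v u t \<in> realization K"
proof -
  have "{x. segment_point v u t x \<noteq> 0} = {v, u}"
    using assms by (auto simp: segment_point_def indicator_def)
  then show ?thesis
    using assms by (auto simp: realization_def segment_point_def indicator_def)
qed

lemma vertex_point_realization: "{v} \<in> K \<Longrightarrow> vertex_point v \<in> realization K"
proof -
  assume "{v} \<in> K"
  moreover have "{x. (vertex_point v :: 'a \<Rightarrow> real) x \<noteq> 0} = {v}" by (auto simp: indicator_def)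
  ultimately show ?thesis by (auto simp: realization_def)
qed

lemma segment_point_near:
  assumes "open S" "segment_point v u t0 \<in> S"
  obtains d where "d > 0" "\<And>t. \<bar>t - t0\<bar> < d \<Longrightarrow> segment_point v u t \<in> S"
proof -
  have "continuous_on UNIV (segment_point v u)"
    unfolding segment_point_def [abs_def]
    by (intro continuous_on_coordinatewise_then_product continuous_intros)
  then have "open (segment_point v u -` S)"
    using assms(1) by (simp add: continuous_on_open_vimage)
  then obtain d where "d > 0" "ball t0 d \<subseteq> segment_point v u -` S"
    using assms(2) open_contains_ball by blast
  then show thesis
    by (intro that[of d]) (auto simp: subset_iff dist_real_def abs_minus_commute)
qed

lemma open_coordinate_pos: "open {x :: 'v \<Rightarrow> real. 0 < x v}"
  by (intro open_Collect_less continuous_intros continuous_on_product_coordinates)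

lemma realization_support:
  assumes "x \<in> realization K" "simplicial_complex K"
  shows "{v. x v \<noteq> 0} \<in> K" "x v \<noteq> 0 \<longleftrightarrow> 0 < x v"
  using assms unfolding realization_def by (auto simp: less_le)

lemma simplex_face: "\<lbrakk>simplicial_complex K; \<tau> \<in> K; \<rho> \<subseteq> \<tau>; \<rho> \<noteq> {}\<rbrakk> \<Longrightarrow> \<rho> \<in> K"
  unfolding simplicial_complex_def by blast

lemma realization_eq_vertex_point:
  assumes x: "x \<in> realization K" "simplicial_complex K" and v: "\<And>u. 0 < x u \<Longrightarrow> u = v"
  shows "x = vertex_point v"
proof -
  have "{u. x u \<noteq> 0} \<subseteq> {v}" using v realization_support(2)[OF x] by auto
  moreover have "{u. x u \<noteq> 0} \<noteq> {}"
    using x realization_support(1)[OF x] unfolding simplicial_complex_def by blast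
  ultimately have s: "{u. x u \<noteq> 0} = {v}" by blast
  then have "x v = 1" using x(1) by (auto simp: realization_def)
  then show ?thesis using s by (auto simp: indicator_def fun_eq_iff)
qed

text \<open>A 2-manifold has no isolated points: a point near \<open>vertex_point v\<close> other
  than it has \<open>v\<close> and a further vertex in its support.\<close>

lemma vertex_in_edge:
  assumes K: "simplicial_complex K" and M: "two_manifold (top_of_set (realization K))" and v: "{v} \<in> K"
  obtains u where "u \<noteq> v" "{v, u} \<in> K"
proof -
  have p: "vertex_point v \<in> realization K" using v by (rule vertex_point_realization)
  have "(vertex_point v :: 'a \<Rightarrow> real) \<in> {x. 0 < x v}" by simp
  from two_manifold_punctured_neighbourhood[OF M p open_coordinate_pos this]
  obtain W where W: "openin (top_of_set (realization K)) W" "W \<subseteq> {x. 0 < x v}" "W - {vertex_point v} \<noteq> {}"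
    by metis
  then obtain x where x: "x \<in> realization K" "0 < x v" "x \<noteq> vertex_point v"
    using openin_imp_subset by blast
  then obtain u where "0 < x u" "u \<noteq> v" using realization_eq_vertex_point[OF x(1) K] by blast
  then have "{v, u} \<subseteq> {v. x v \<noteq> 0}" using x by auto
  then show thesis
    using that[of u] \<open>u \<noteq> v\<close> simplex_face[OF K realization_support(1)[OF x(1) K]] by blast
qed

text \<open>If no triangle contained the edge, then near its midpoint the realization would be just
  the open edge, which the midpoint cuts into the parts with larger \<open>u\<close>- and larger
  \<open>v\<close>-coordinate.\<close>

lemma edge_in_triangle:
  assumes K: "simplicial_complex K" and M: "two_manifold (top_of_set (realization K))"
    and e: "{u, v} \<in> K" "u \<noteq> v"
  obtains w where "w \<noteq> u" "w \<noteq> v" "{u, v, w} \<in> K"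
proof (rule ccontr)
  assume neg: "\<not> thesis"
  note witness = that
  let ?p = "segment_point u v (1 / 2)"
  let ?U = "{x :: 'a \<Rightarrow> real. 0 < x u} \<inter> {x. 0 < x v}"
  have p: "?p \<in> realization K" using e by (intro segment_point_realization) auto
  have supp: "{w. x w \<noteq> 0} = {u, v}" if x: "x \<in> realization K" "0 < x u" "0 < x v" for x
  proof (rule ccontr)
    assume "{w. x w \<noteq> 0} \<noteq> {u, v}"
    then obtain w where "x w \<noteq> 0" "w \<noteq> u" "w \<noteq> v" using x by auto
    moreover have "{u, v, w} \<in> K"
      by (rule simplex_face[OF K realization_support(1)[OF x(1) K]]) (use x \<open>x w \<noteq> 0\<close> in auto)
    ultimately show False using neg witness by blast
  qed
  show False
  proof (rule two_manifold_not_locally_separated[OF M p, of ?U "{x. x v < x u}" "{x. x u < x v}"])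
    show "open ?U" by (intro open_Int open_coordinate_pos)
    show "?p \<in> ?U" using e by (auto simp: segment_point_def)
    show "open {x :: 'a \<Rightarrow> real. x v < x u}" "open {x :: 'a \<Rightarrow> real. x u < x v}"
      by (intro open_Collect_less continuous_on_product_coordinates)+
    show "?p \<notin> {x. x v < x u}" "?p \<notin> {x. x u < x v}" using e by (auto simp: segment_point_def)
    show "realization K \<inter> ?U \<inter> {x. x v < x u} \<inter> {x. x u < x v} = {}" by auto
    show "realization K \<inter> ?U - {?p} \<subseteq> {x. x v < x u} \<union> {x. x u < x v}"
    proof
      fix x assume x: "x \<in> realization K \<inter> ?U - {?p}"
      then have s: "{w. x w \<noteq> 0} = {u, v}" by (intro supp) auto
      then have "x u + x v = 1" using x e by (auto simp: realization_def)
      show "x \<in> {x. x v < x u} \<union> {x. x u < x v}"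
      proof (rule ccontr)
        assume "x \<notin> {x. x v < x u} \<union> {x. x u < x v}"
        then have "x u = 1 / 2" "x v = 1 / 2" using \<open>x u + x v = 1\<close> by auto
        moreover have "x w = 0" if "w \<noteq> u" "w \<noteq> v" for w using s that by blast
        ultimately have "x = ?p"
          using e by (auto simp: segment_point_def indicator_def fun_eq_iff)
        then show False using x by blast
      qed
    qed
    fix S :: "('a \<Rightarrow> real) set" assume S: "open S" "?p \<in> S"
    obtain d where d: "d > 0" "\<And>t. \<bar>t - 1 / 2\<bar> < d \<Longrightarrow> segment_point u v t \<in> S"
      using segment_point_near[OF S] by blast
    \<comment> \<open>The cap 1/4 keeps both \<open>1 / 2 - h\<close> and \<open>1 / 2 + h\<close>
      in the open unit interval.\<close>
    define h where "h = min (d / 2) (1 / 4)"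
    have h: "0 < h" "h < d" "h \<le> 1 / 4" using d by (auto simp: h_def)
    have "segment_point u v (1 / 2 - h) \<in> realization K \<inter> S"
      using e h d by (auto intro!: segment_point_realization)
    moreover have "segment_point u v (1 / 2 - h) \<in> {x. x v < x u}"
      using e h by (auto simp: segment_point_def)
    ultimately show "realization K \<inter> S \<inter> {x. x v < x u} \<noteq> {}" by blast
    have "segment_point u v (1 / 2 + h) \<in> realization K \<inter> S"
      using e h d by (auto intro!: segment_point_realization)
    moreover have "segment_point u v (1 / 2 + h) \<in> {x. x u < x v}"
      using e h by (auto simp: segment_point_def)
    ultimately show "realization K \<inter> S \<inter> {x. x u < x v} \<noteq> {}" by blast
  qed
qed

text \<open>Without such a triangle, a point near \<open>v\<close> other than \<open>v\<close>
  itself has support meeting exactly one of \<open>M1\<close> and \<open>M2\<close>; this splits the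
  punctured star of \<open>v\<close> into two open sets that both accumulate at
  \<open>v\<close>.\<close>

lemma link_connected:
  assumes K: "simplicial_complex K" and M: "two_manifold (top_of_set (realization K))" and v: "{v} \<in> K"
    and ne: "M1 \<noteq> {}" "M2 \<noteq> {}" and un: "M1 \<union> M2 = {u. u \<noteq> v \<and> {v, u} \<in> K}" and "M1 \<inter> M2 = {}"
  obtains u1 u2 where "u1 \<in> M1" "u2 \<in> M2" "{v, u1, u2} \<in> K"
proof (rule ccontr)
  assume neg: "\<not> thesis"
  let ?U = "\<lambda>N. {x :: 'a \<Rightarrow> real. 0 < x v} \<inter> (\<Union>u\<in>N. {x. 0 < x u})"
  have op: "open (?U N)" for N
    by (intro open_Int open_UN ballI open_coordinate_pos)
  have p: "vertex_point v \<in> realization K" using v by (rule vertex_point_realization)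
  have near: "realization K \<inter> S \<inter> ?U N \<noteq> {}"
    if S: "open S" "vertex_point v \<in> S" and u: "u \<in> N" "u \<noteq> v" "{v, u} \<in> K" for S N u
  proof -
    have "segment_point v u 0 = vertex_point v" by (simp add: segment_point_def fun_eq_iff)
    then obtain d where d: "d > 0" "\<And>t. \<bar>t - 0\<bar> < d \<Longrightarrow> segment_point v u t \<in> S"
      using segment_point_near[OF S(1), of v u 0] S(2) by metis
    define h where "h = min (d / 2) (1 / 2)"
    have h: "0 < h" "h < d" "h \<le> 1 / 2" using d by (auto simp: h_def)
    then have "segment_point v u h \<in> realization K \<inter> S"
      using u h d by (auto intro!: segment_point_realization)
    moreover have "segment_point v u h \<in> ?U N"
      using u h by (auto simp: segment_point_def intro!: bexI[of _ u])
    ultimately show ?thesis by blast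
  qed
  show False
  proof (rule two_manifold_not_locally_separated[OF M p, of "{x. 0 < x v}" "?U M1" "?U M2"])
    show "open {x :: 'a \<Rightarrow> real. 0 < x v}" by (rule open_coordinate_pos)
    show "vertex_point v \<in> {x. 0 < (x v :: real)}" by simp
    show "open (?U M1)" "open (?U M2)" by (rule op)+
    have "v \<notin> M1" "v \<notin> M2" using un by auto
    then show "vertex_point v \<notin> ?U M1" "vertex_point v \<notin> ?U M2" by (auto simp: indicator_def split: if_splits)
    show "realization K \<inter> {x. 0 < x v} - {vertex_point v} \<subseteq> ?U M1 \<union> ?U M2"
    proof
      fix x assume x: "x \<in> realization K \<inter> {x. 0 < x v} - {vertex_point v}"
      then obtain u where u: "0 < x u" "u \<noteq> v"
        using realization_eq_vertex_point[of x K v] K by blast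
      have "{v, u} \<in> K"
        by (rule simplex_face[OF K realization_support(1)[of x K]]) (use x u K in auto)
      then have "u \<in> M1 \<union> M2" using un u by blast
      then show "x \<in> ?U M1 \<union> ?U M2" using u x by blast
    qed
    show "realization K \<inter> {x. 0 < x v} \<inter> ?U M1 \<inter> ?U M2 = {}"
    proof (rule ccontr)
      assume "realization K \<inter> {x. 0 < x v} \<inter> ?U M1 \<inter> ?U M2 \<noteq> {}"
      then obtain x u1 u2 where x: "x \<in> realization K" "0 < x v" "u1 \<in> M1" "0 < x u1" "u2 \<in> M2" "0 < x u2"
        by auto
      have "{v, u1, u2} \<in> K"
        by (rule simplex_face[OF K realization_support(1)[OF x(1) K]]) (use x in auto)
      then show False using neg that x by blast
    qed
    show "realization K \<inter> S \<inter> ?U M1 \<noteq> {}" if "open S" "vertex_point v \<in> S" for S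
      using near[OF that] ne(1) un by blast
    show "realization K \<inter> S \<inter> ?U M2 \<noteq> {}" if "open S" "vertex_point v \<in> S" for S
      using near[OF that] ne(2) un by blast
  qed
qed

text \<open>In a finite set the iterates of an injective map return to \<open>u0\<close>. Up to the
  first return \<open>p\<close> they are distinct, and their set is invariant under
  \<open>\<pi>\<close> both forwards and backwards, so \<open>connected\<close> makes it all of
  \<open>N\<close>.\<close>

lemma cyclic_enumeration:
  assumes fin: "finite N" and maps: "\<pi> ` N \<subseteq> N" and inj: "inj_on \<pi> N" and u0: "u0 \<in> N"
    and connected: "\<And>A. \<lbrakk>A \<subseteq> N; A \<noteq> {}; \<And>u. u \<in> N \<Longrightarrow> \<pi> u \<in> A \<longleftrightarrow> u \<in> A\<rbrakk> \<Longrightarrow> A = N"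
  obtains p where "0 < p" "(\<pi> ^^ p) u0 = u0" "bij_betw (\<lambda>i. (\<pi> ^^ i) u0) {..<p} N"
proof -
  define f where "f i = (\<pi> ^^ i) u0" for i
  have f_Suc: "f (Suc i) = \<pi> (f i)" and f_0: "f 0 = u0" for i by (simp_all add: f_def)
  have fN: "f i \<in> N" for i by (induction i) (use f_0 f_Suc u0 maps in auto)
  have cancel: "f (i + d) = f i \<Longrightarrow> f d = u0" for i d
  proof (induction i)
    case (Suc i)
    then have "\<pi> (f (i + d)) = \<pi> (f i)" by (simp add: f_Suc)
    then show ?case using Suc.IH inj fN by (meson inj_onD)
  qed (simp add: f_0)
  have "\<not> inj f"
  proof
    assume "inj f"
    then have "infinite (range f)" using finite_imageD infinite_UNIV_nat by blast
    then show False using fin fN finite_subset[of "range f" N] by blast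
  qed
  then obtain i j where "f i = f j" "i < j" unfolding inj_def by (metis linorder_neqE_nat)
  then have "f (j - i) = u0" "0 < j - i" using cancel[of i "j - i"] by auto
  then have ex: "\<exists>p. 0 < p \<and> f p = u0" by blast
  define p where "p = (LEAST p. 0 < p \<and> f p = u0)"
  have p: "0 < p" "f p = u0" using LeastI_ex[OF ex] unfolding p_def by auto
  have least: "q < p \<Longrightarrow> 0 < q \<Longrightarrow> f q \<noteq> u0" for q
    using not_less_Least[of q "\<lambda>p. 0 < p \<and> f p = u0"] unfolding p_def by blast
  have inj_f: "inj_on f {..<p}"
  proof (rule inj_onI)
    have *: False if "i < j" "j < p" "f i = f j" for i j
      using cancel[of i "j - i"] least[of "j - i"] that by auto
    fix i j assume ij: "i \<in> {..<p}" "j \<in> {..<p}" "f i = f j"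
    show "i = j"
      using *[of i j] *[of j i] ij by (cases i j rule: linorder_cases) auto
  qed
  have closed: "\<pi> u \<in> f ` {..<p} \<longleftrightarrow> u \<in> f ` {..<p}" if u: "u \<in> N" for u
  proof
    assume "u \<in> f ` {..<p}"
    then obtain i where i: "i < p" "u = f i" by blast
    show "\<pi> u \<in> f ` {..<p}"
    proof (cases "Suc i = p")
      case True
      then have "\<pi> u = f 0" using i p f_Suc[of i] f_0 by simp
      then show ?thesis using p by blast
    next
      case False
      then have "\<pi> u = f (Suc i)" "Suc i < p" using i f_Suc by auto
      then show ?thesis by blast
    qed
  next
    assume "\<pi> u \<in> f ` {..<p}"
    then obtain i where i: "i < p" "\<pi> u = f i" by blast
    \<comment> \<open>A predecessor inside the orbit: \<open>f (i - 1)\<close>, or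
      \<open>f (p - 1)\<close> when \<open>i = 0\<close>.\<close>
    obtain j where j: "j < p" "\<pi> (f j) = f i"
    proof (cases i)
      case 0
      then show ?thesis using that[of "p - 1"] p f_Suc[of "p - 1"] f_0 by simp
    next
      case (Suc k)
      then show ?thesis using that[of k] i f_Suc by simp
    qed
    then have "u = f j" using i inj u fN by (metis inj_onD)
    then show "u \<in> f ` {..<p}" using j by blast
  qed
  have "f ` {..<p} = N"
    by (rule connected) (use fN p closed in auto)
  then have "bij_betw f {..<p} N" using inj_f by (simp add: bij_betw_def)
  then show thesis using that[of p] p unfolding f_def by blast
qed

section \<open>The corner 1 of the standard triangle\<close>

lemma Re_zeta3: "Re \<zeta> = - 1 / 2" "Re (\<zeta>\<^sup>2) = - 1 / 2"
proof -
  have z: "\<zeta> = cis (2 * pi / 3)"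
    by (simp add: zeta3_def cis_conv_exp mult_ac)
  have z2: "\<zeta>\<^sup>2 = cis (pi / 3 + pi)"
    unfolding z Complex.DeMoivre by (simp add: field_simps)
  show "Re \<zeta> = - 1 / 2" unfolding z using cos_120 by simp
  have "Re (\<zeta>\<^sup>2) = cos (pi / 3 + pi)" by (simp only: z2 cis.sel)
  also have "... = - cos (pi / 3)" by (rule cos_periodic_pi)
  finally show "Re (\<zeta>\<^sup>2) = - 1 / 2" by (simp add: cos_60)
qed

lemma affine_map_1: "affine_map a b c 1 = vertex_point a"
  using Re_zeta3 by (simp add: affine_map_def fun_eq_iff power2_eq_square)

text \<open>On the triangle the real part is at most 1. Being on the frontier, the corner 1 falls
  under the condition that relates \<open>homeo\<close> to \<open>bparam\<close>.\<close>

lemma one_frontier_std_triangle: "1 \<in> frontier std_triangle"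
proof -
  have "std_triangle \<subseteq> {z. Re z \<le> 1}"
    unfolding std_triangle_def
    by (rule hull_minimal) (use Re_zeta3 convex_halfspace_Re_le in auto)
  moreover have "1 \<notin> interior {z. Re z \<le> 1}"
  proof
    assume "1 \<in> interior {z. Re z \<le> 1}"
    then obtain e where e: "e > 0" "ball 1 e \<subseteq> {z. Re z \<le> 1}"
      unfolding mem_interior by blast
    then have "1 + of_real (e / 2) \<in> ball (1 :: complex) e"
      by (simp add: dist_norm norm_divide)
    then show False using e by auto
  qed
  ultimately have "1 \<notin> interior std_triangle" using interior_mono by blast
  moreover have "1 \<in> closure std_triangle"
    using closure_subset hull_inc[of 1 "{1, \<zeta>, \<zeta>\<^sup>2}"] unfolding std_triangle_def by blast
  ultimately show ?thesis by (simp add: frontier_def)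
qed

section \<open>Combinatorics of marked triangulations\<close>

locale marked_triangulation =
  fixes T :: "('p, 'v, 'z) marked_surface_scheme"
  assumes marked: "marked_triangulated_surface T"
begin

abbreviation K where "K \<equiv> cplx T"
abbreviation Q where "Q \<equiv> orient T"

lemma marked_parts:
  shows triangulated: "triangulated_surface T"
    and "\<forall>e\<in>edges T. e = {fst (eorient T e), snd (eorient T e)}"
    and "\<forall>\<tau>\<in>triangles T. pref T \<tau> \<in> edges T \<and> pref T \<tau> \<subseteq> \<tau>"
    and "\<forall>e\<in>boundary_edges T. \<forall>\<tau>\<in>triangles T. e \<subseteq> \<tau> \<longrightarrow> on_right T e \<tau>"
  using marked unfolding marked_triangulated_surface_def by - (elim conjE, assumption)+

lemma eorient_eq: "e \<in> edges T \<Longrightarrow> e = {fst (eorient T e), snd (eorient T e)}"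
  by (rule bspec[OF marked_parts(2)])

lemma pref: "\<tau> \<in> triangles T \<Longrightarrow> pref T \<tau> \<in> edges T \<and> pref T \<tau> \<subseteq> \<tau>"
  by (rule bspec[OF marked_parts(3)])

lemma boundary_on_right: "\<lbrakk>e \<in> boundary_edges T; \<tau> \<in> triangles T; e \<subseteq> \<tau>\<rbrakk> \<Longrightarrow> on_right T e \<tau>"
  using marked_parts(4) by blast

lemma triangulated_parts:
  shows "simplicial_complex K" "finite K" "two_manifold (top_of_set (realization K))"
    and coherent: "coherent_orientation K Q"
    and bmap_inj: "inj_on (\<lambda>(i, k). bmap T i k) ({..<nbdry T} \<times> {..<3})"
    and bedge_image: "(\<lambda>(i, k). bedge T i k) ` ({..<nbdry T} \<times> {..<3}) = boundary_edges T"
    and homeo: "homeomorphic_map (top_of_set (realization K)) (points T) (homeo T)"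
    and "\<forall>i<nbdry T. \<forall>k<3. \<exists>c. (bmap T i (Suc k mod 3), bmap T i k, c) \<in> Q"
    and "\<forall>i<nbdry T. \<forall>z\<in>frontier std_triangle.
        homeo T (affine_map (bmap T i 0) (bmap T i 1) (bmap T i 2) z) = bparam T i (z /\<^sub>R norm z)"
  using triangulated unfolding triangulated_surface_def by - (elim conjE, assumption)+

lemmas complex = triangulated_parts(1-3)

lemma bmap_orient: "\<lbrakk>i < nbdry T; k < 3\<rbrakk> \<Longrightarrow> \<exists>c. (bmap T i (Suc k mod 3), bmap T i k, c) \<in> Q"
  using triangulated_parts(8) by blast

text \<open>Radial projection fixes 1, so the distinguished vertex in the sign condition of type NS
  is vertex number 0 of its boundary triangle.\<close>

lemma bparam_1: "i < nbdry T \<Longrightarrow> bparam T i 1 = homeo T (vertex_point (bmap T i 0))"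
proof -
  assume "i < nbdry T"
  then have "homeo T (affine_map (bmap T i 0) (bmap T i 1) (bmap T i 2) 1) = bparam T i (1 /\<^sub>R norm (1 :: complex))"
    using triangulated_parts(9) one_frontier_std_triangle by blast
  then show ?thesis by (simp add: affine_map_1)
qed

lemma orientD:
  assumes "(a, b, c) \<in> Q"
  shows "{a, b, c} \<in> K" "a \<noteq> b" "b \<noteq> c" "a \<noteq> c" "(b, c, a) \<in> Q" "(c, a, b) \<in> Q" "(b, a, c) \<notin> Q"
proof -
  have *: "{a, b, c} \<in> K \<and> card {a, b, c} = 3 \<and> (b, c, a) \<in> Q \<and> (b, a, c) \<notin> Q" if "(a, b, c) \<in> Q" for a b c
    using coherent that unfolding coherent_orientation_def by blast
  show "{a, b, c} \<in> K" "(b, c, a) \<in> Q" "(b, a, c) \<notin> Q" using *[OF assms] by auto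
  show "(c, a, b) \<in> Q" using *[of b c a] *[OF assms] by blast
  have "card {a, b, c} = 3" using *[OF assms] by blast
  then show "a \<noteq> b" "b \<noteq> c" "a \<noteq> c" by (auto simp: card_insert_if split: if_splits)
qed

lemma orient_cases: "\<lbrakk>{a, b, c} \<in> K; a \<noteq> b; b \<noteq> c; a \<noteq> c\<rbrakk> \<Longrightarrow> (a, b, c) \<in> Q \<or> (b, a, c) \<in> Q"
  using coherent unfolding coherent_orientation_def by auto

lemma orient_unique: "\<lbrakk>(a, b, c) \<in> Q; (a, b, d) \<in> Q\<rbrakk> \<Longrightarrow> c = d"
  using coherent unfolding coherent_orientation_def by blast

lemma orient_opposite: "\<lbrakk>(a, b, c) \<in> Q; (b, a, d) \<in> Q\<rbrakk> \<Longrightarrow> c \<noteq> d"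
  using orientD(7) by blast

lemma edge_iff: "{a, b} \<in> edges T \<longleftrightarrow> a \<noteq> b \<and> {a, b} \<in> K"
  by (auto simp: edges_def card_insert_if)

lemma edgeE:
  assumes "e \<in> edges T"
  obtains a b where "e = {a, b}" "a \<noteq> b"
  using assms by (auto simp: edges_def card_2_iff)

lemma triangleE:
  assumes "\<tau> \<in> triangles T"
  obtains a b c where "\<tau> = {a, b, c}" "(a, b, c) \<in> Q"
proof -
  have "card \<tau> = 3" "\<tau> \<in> K" using assms by (auto simp: triangles_def)
  then obtain a b c where abc: "\<tau> = {a, b, c}" "a \<noteq> b" "b \<noteq> c" "a \<noteq> c" by (auto simp: card_3_iff)
  then have "(a, b, c) \<in> Q \<or> (b, a, c) \<in> Q" using orient_cases \<open>\<tau> \<in> K\<close> by blast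
  moreover have "\<tau> = {b, a, c}" using abc(1) by auto
  ultimately show thesis using that[OF abc(1)] that[of b a c] by (elim disjE)
qed

lemma orient_triangle: "(a, b, c) \<in> Q \<Longrightarrow> {a, b, c} \<in> triangles T"
  using orientD(1-4)[of a b c] by (auto simp: triangles_def card_insert_if)

lemma orient_edge:
  assumes "(a, b, c) \<in> Q"
  shows "{a, b} \<in> edges T" "{b, a} \<in> edges T"
proof -
  have "{a, b} \<in> K" using simplex_face[OF complex(1) orientD(1)[OF assms], of "{a, b}"] by auto
  then show "{a, b} \<in> edges T" "{b, a} \<in> edges T"
    using orientD(2)[OF assms] by (auto simp: edge_iff insert_commute)
qed

lemma edge_has_triangle:
  assumes "{a, b} \<in> edges T"
  shows "(\<exists>c. (a, b, c) \<in> Q) \<or> (\<exists>c. (b, a, c) \<in> Q)"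
  using edge_in_triangle[OF complex(1,3), of a b] assms orient_cases[of a b] by (metis edge_iff)

lemma eorient_cases: "{a, b} \<in> edges T \<Longrightarrow> eorient T {a, b} = (a, b) \<or> eorient T {a, b} = (b, a)"
  using eorient_eq[of "{a, b}"] by (cases "eorient T {a, b}") (auto simp: doubleton_eq_iff)

text \<open>The label of the tensor factor to the left of the edge directed from \<open>a\<close> to \<open>b\<close>.\<close>
definition wire :: "'v \<Rightarrow> 'v \<Rightarrow> 'v set \<times> side" where
  "wire a b = ({a, b}, if eorient T {a, b} = (a, b) then Left else Right)"

lemma wire_inject:
  assumes "{a, b} \<in> edges T" "{c, d} \<in> edges T" "wire a b = wire c d"
  shows "a = c \<and> b = d"
proof (rule ccontr)
  assume "\<not> (a = c \<and> b = d)"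
  then have cd: "c = b" "d = a" using assms(3) by (auto simp: wire_def doubleton_eq_iff)
  have "{b, a} = {a, b}" "a \<noteq> b" using assms by (auto simp: edge_iff)
  then show False using eorient_cases[OF assms(1)] assms(3) unfolding wire_def cd by auto
qed

text \<open>Were the edge oriented the other way, a left triangle with the same vertices would have
  to be \<open>(b, a, c)\<close>, and coherence excludes both orientations of one triangle.\<close>

lemma on_left_iff:
  assumes "(a, b, c) \<in> Q"
  shows "on_left T {a, b} {a, b, c} \<longleftrightarrow> eorient T {a, b} = (a, b)"
proof (cases "eorient T {a, b} = (a, b)")
  case True
  then show ?thesis using assms by (auto simp: on_left_def)
next
  case False
  then have o: "eorient T {a, b} = (b, a)" using eorient_cases orient_edge assms by blast
  have "\<not> on_left T {a, b} {a, b, c}"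
  proof
    assume "on_left T {a, b} {a, b, c}"
    then obtain c' where c': "(b, a, c') \<in> Q" "{a, b, c} = {b, a, c'}" by (auto simp: on_left_def o)
    then have "c' = c" using orientD(2-4)[OF assms] orientD(2-4)[OF c'(1)] by auto
    then show False using c' assms orient_opposite by blast
  qed
  then show ?thesis using False by simp
qed

text \<open>Justifies the definite description in \<open>corners\<close>: of the three rotations of
  an oriented triangle exactly one begins with the preferred edge.\<close>

lemma corners_props:
  assumes "\<tau> \<in> triangles T"
  obtains a b c where "corners T \<tau> = (a, b, c)" "(a, b, c) \<in> Q" "{a, b, c} = \<tau>"
proof -
  let ?P = "\<lambda>(a, b, c). (a, b, c) \<in> Q \<and> {a, b, c} = \<tau> \<and> {a, b} = pref T \<tau>"
  obtain x y z where xyz: "\<tau> = {x, y, z}" "(x, y, z) \<in> Q" using triangleE[OF assms] .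
  have "pref T \<tau> \<in> edges T" using pref[OF assms] by (rule conjunct1)
  then obtain a b where ab: "pref T \<tau> = {a, b}" "a \<noteq> b" by (rule edgeE)
  have rot: "(y, z, x) \<in> Q" "(z, x, y) \<in> Q" using orientD(5,6)[OF xyz(2)] .
  have "a \<in> {x, y, z}" "b \<in> {x, y, z}" using pref[OF assms] ab xyz by auto
  then have "{a, b} = {x, y} \<or> {a, b} = {y, z} \<or> {a, b} = {z, x}" using ab(2) by auto
  then have ex: "\<exists>t. ?P t"
  proof (elim disjE)
    assume "{a, b} = {x, y}"
    then show ?thesis using xyz ab by (intro exI[of _ "(x, y, z)"]) auto
  next
    assume "{a, b} = {y, z}"
    then show ?thesis using xyz ab rot by (intro exI[of _ "(y, z, x)"]) auto
  next
    assume "{a, b} = {z, x}"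
    then show ?thesis using xyz ab rot by (intro exI[of _ "(z, x, y)"]) auto
  qed
  have uniq: "t = t'" if t: "?P t" "?P t'" for t t'
  proof -
    obtain a b c a' b' c' where eq: "t = (a, b, c)" "t' = (a', b', c')" by (metis prod_cases3)
    have q: "(a, b, c) \<in> Q" "(a', b', c') \<in> Q" "{a, b, c} = {a', b', c'}" "{a, b} = {a', b'}"
      using t by (auto simp: eq)
    then have c: "c = c'" using orientD(2-4)[OF q(1)] orientD(2-4)[OF q(2)] by auto
    show ?thesis using q(2,4) c orientD(7)[OF q(1)] by (auto simp: eq doubleton_eq_iff)
  qed
  have "?P (corners T \<tau>)"
    unfolding corners_def by (rule theI', rule ex_ex1I[OF ex uniq])
  then show thesis using that by (cases "corners T \<tau>") auto
qed

lemma corners_rotation: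
  assumes "(a, b, c) \<in> Q"
  shows "corners T {a, b, c} = (a, b, c) \<or> corners T {a, b, c} = (b, c, a) \<or> corners T {a, b, c} = (c, a, b)"
proof -
  obtain x y z where xyz: "corners T {a, b, c} = (x, y, z)" "(x, y, z) \<in> Q" "{x, y, z} = {a, b, c}"
    using corners_props[OF orient_triangle[OF assms]] .
  have n: "(b, a, c) \<notin> Q" "(a, c, b) \<notin> Q" "(c, b, a) \<notin> Q"
    using orientD(7)[OF assms] orientD(7)[OF orientD(6)[OF assms]] orientD(7)[OF orientD(5)[OF assms]] .
  have "x \<in> {a, b, c}" "y \<in> {a, b, c}" "z \<in> {a, b, c}" using xyz(3) by auto
  then show ?thesis using xyz n orientD(2-4)[OF xyz(2)] by auto
qed

text \<open>A triangle lies to the left of each of its edges when these are directed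
  counterclockwise. Written with \<open>wire\<close>, its legs look the same for every choice of
  edge orientations; the preferred edge only selects the first leg.\<close>

lemma triangle_wires_eq:
  assumes "corners T \<tau> = (a, b, c)" "(a, b, c) \<in> Q" "{a, b, c} = \<tau>"
  shows "triangle_labels T \<tau> = [wire a b, wire b c, wire c a]"
proof -
  have rot: "(b, c, a) \<in> Q" "(c, a, b) \<in> Q" using orientD(5,6)[OF assms(2)] .
  have "{b, c, a} = \<tau>" "{c, a, b} = \<tau>" using assms(3) by auto
  then show ?thesis
    using on_left_iff[OF assms(2)] on_left_iff[OF rot(1)] on_left_iff[OF rot(2)] assms(1,3)
    by (simp add: tri_edges_def wire_def)
qed

text \<open>The only adjacent triangle induces the direction from \<open>w\<close> to
  \<open>v\<close>. So nothing lies to the left of the edge directed from \<open>v\<close> to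
  \<open>w\<close>, the marking convention forces this orientation, and the free first output is
  \<open>wire v w\<close>.\<close>

lemma boundary_edge:
  assumes i: "i < nbdry T" "k < 3"
  defines "v \<equiv> bmap T i k" and "w \<equiv> bmap T i (Suc k mod 3)"
  shows "bedge T i k = {v, w}" "bedge T i k \<in> boundary_edges T" "{v, w} \<in> edges T"
    and "eorient T {v, w} = (v, w)" and "wire v w = (bedge T i k, Left)"
    and "(v, w, c) \<notin> Q"
proof -
  show e: "bedge T i k = {v, w}" by (simp add: bedge_def v_def w_def)
  show b: "bedge T i k \<in> boundary_edges T" unfolding bedge_image[symmetric] using i by auto
  then show ed: "{v, w} \<in> edges T" by (auto simp: e boundary_edges_def)
  obtain c0 where c0: "(w, v, c0) \<in> Q" using bmap_orient[OF i] by (auto simp: v_def w_def)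
  have t0: "{w, v, c0} \<in> triangles T" by (rule orient_triangle[OF c0])
  show no: "(v, w, c) \<notin> Q" for c
  proof
    assume q: "(v, w, c) \<in> Q"
    have "\<exists>!\<tau>. \<tau> \<in> triangles T \<and> {v, w} \<subseteq> \<tau>" using b by (simp add: e boundary_edges_def)
    then have "{v, w, c} = {w, v, c0}" using t0 orient_triangle[OF q] by blast
    then have "c = c0" using orientD(2-4)[OF q] orientD(2-4)[OF c0] by auto
    then show False using q c0 orient_opposite by blast
  qed
  have "on_right T {v, w} {w, v, c0}" using boundary_on_right[OF b t0] by (auto simp: e)
  then show o: "eorient T {v, w} = (v, w)"
    using eorient_cases[OF ed] no by (auto simp: on_right_def)
  show "wire v w = (bedge T i k, Left)" by (simp add: wire_def o e)
qed

text \<open>The edge lies in some triangle, which can only be on its right and is then the only one.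
  The direction is settled because the reverse of each directed boundary edge does have a triangle
  on its left.\<close>

lemma no_triangle_boundary:
  assumes "{a, b} \<in> edges T" "\<And>c. (a, b, c) \<notin> Q"
  obtains i k where "i < nbdry T" "k < 3" "a = bmap T i k" "b = bmap T i (Suc k mod 3)"
proof -
  obtain c0 where c0: "(b, a, c0) \<in> Q" using edge_has_triangle[OF assms(1)] assms(2) by blast
  have uniq: "\<tau> = {b, a, c0}" if t: "\<tau> \<in> triangles T" "{a, b} \<subseteq> \<tau>" for \<tau>
  proof -
    have "card \<tau> = 3" "\<tau> \<in> K" using t by (auto simp: triangles_def)
    have "a \<noteq> b" using assms(1) by (simp add: edge_iff)
    then have "card (\<tau> - {a, b}) = 1" using t(2) \<open>card \<tau> = 3\<close> by (simp add: card_Diff_subset)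
    then obtain c where "\<tau> - {a, b} = {c}" by (rule card_1_singletonE)
    then have c: "\<tau> = {a, b, c}" "c \<noteq> a" "c \<noteq> b" using t(2) by auto
    then have "(b, a, c) \<in> Q" using orient_cases[of a b c] \<open>\<tau> \<in> K\<close> \<open>a \<noteq> b\<close> assms(2) by blast
    then have "c = c0" by (rule orient_unique[OF _ c0])
    then show ?thesis using c(1) by (simp add: insert_commute)
  qed
  have "\<exists>!\<tau>. \<tau> \<in> triangles T \<and> {a, b} \<subseteq> \<tau>"
  proof (rule ex1I[of _ "{b, a, c0}"])
    show "{b, a, c0} \<in> triangles T \<and> {a, b} \<subseteq> {b, a, c0}"
      using orient_triangle[OF c0] by simp
    show "\<tau> = {b, a, c0}" if "\<tau> \<in> triangles T \<and> {a, b} \<subseteq> \<tau>" for \<tau>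
      using uniq[OF conjunct1[OF that] conjunct2[OF that]] .
  qed
  then have "{a, b} \<in> boundary_edges T"
    by (simp add: boundary_edges_def assms(1))
  then obtain i k where ik: "i < nbdry T" "k < 3" "{a, b} = bedge T i k"
    unfolding bedge_image[symmetric] by auto
  obtain c1 where "(bmap T i (Suc k mod 3), bmap T i k, c1) \<in> Q" using bmap_orient ik by blast
  then have "a = bmap T i k \<and> b = bmap T i (Suc k mod 3)"
    using ik(3) assms(2) by (auto simp: bedge_def doubleton_eq_iff)
  then show thesis using that ik by blast
qed

end

lemma distinct_concat_map:
  assumes "distinct xs" "\<And>x. x \<in> set xs \<Longrightarrow> distinct (f x)"
    and "\<And>x y. \<lbrakk>x \<in> set xs; y \<in> set xs; x \<noteq> y\<rbrakk> \<Longrightarrow> set (f x) \<inter> set (f y) = {}"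
  shows "distinct (concat (map f xs))"
  using assms
proof (induction xs)
  case (Cons x xs)
  have "set (f x) \<inter> set (f y) = {}" if "y \<in> set xs" for y
    using Cons.prems(1) Cons.prems(3)[of x y] that by auto
  then have "set (f x) \<inter> (\<Union>y\<in>set xs. set (f y)) = {}"
    by blast
  moreover have "distinct (concat (map f xs))"
    using Cons.prems by (intro Cons.IH) simp_all
  ultimately show ?case using Cons.prems(2) by simp
qed simp

context marked_triangulation begin

lemma set_edge_wires:
  assumes "set es = edges T"
  shows "set (edge_wires es) = {wire a b |a b. {a, b} \<in> edges T}"
proof -
  have *: "{wire a b, wire b a} = {({a, b}, Left), ({a, b}, Right)}" if "{a, b} \<in> edges T" for a b
  proof -
    have "a \<noteq> b" "{b, a} = {a, b}" using that by (auto simp: edge_iff)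
    then show ?thesis using eorient_cases[OF that] by (auto simp: wire_def)
  qed
  have "set (edge_wires es) = (\<Union>e\<in>edges T. {(e, Left), (e, Right)})"
    using assms by (auto simp: edge_wires_def)
  also have "... = {wire a b |a b. {a, b} \<in> edges T}"
  proof (rule equalityI; rule subsetI)
    fix x assume "x \<in> (\<Union>e\<in>edges T. {(e, Left), (e, Right)})"
    then obtain e where e: "e \<in> edges T" "x \<in> {(e, Left), (e, Right)}" by blast
    obtain a b where ab: "e = {a, b}" using edgeE[OF e(1)] .
    have "{a, b} \<in> edges T" using e(1) ab by simp
    moreover have "x \<in> {wire a b, wire b a}" using *[OF calculation] e(2) ab by simp
    moreover have "{b, a} \<in> edges T" using calculation(1) by (simp add: insert_commute)
    ultimately show "x \<in> {wire a b |a b. {a, b} \<in> edges T}" by blast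
  next
    fix x assume "x \<in> {wire a b |a b. {a, b} \<in> edges T}"
    then obtain a b where "{a, b} \<in> edges T" "x = wire a b" by blast
    then show "x \<in> (\<Union>e\<in>edges T. {(e, Left), (e, Right)})" by (auto simp: wire_def)
  qed
  finally show ?thesis .
qed

lemma edge_wires_distinct: "distinct es \<Longrightarrow> distinct (edge_wires es)"
  unfolding edge_wires_def by (rule distinct_concat_map) auto

abbreviation left_wires where
  "left_wires \<tau> \<equiv> {wire a b |a b c. (a, b, c) \<in> Q \<and> {a, b, c} = \<tau>}"

lemma set_triangle_wires_of:
  assumes "\<tau> \<in> triangles T"
  shows "set (triangle_labels T \<tau>)
    = left_wires \<tau>"
proof -
  obtain x y z where xyz: "corners T \<tau> = (x, y, z)" "(x, y, z) \<in> Q" "{x, y, z} = \<tau>"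
    using corners_props[OF assms] .
  have rot: "(y, z, x) \<in> Q" "(z, x, y) \<in> Q" "{y, z, x} = \<tau>" "{z, x, y} = \<tau>"
    using orientD(5,6)[OF xyz(2)] xyz(3) by auto
  have "left_wires \<tau> = {wire x y, wire y z, wire z x}"
  proof (rule equalityI; rule subsetI)
    fix w assume "w \<in> left_wires \<tau>"
    then obtain a b c where abc: "w = wire a b" "(a, b, c) \<in> Q" "{a, b, c} = \<tau>" by blast
    have "(x, y, z) = (a, b, c) \<or> (x, y, z) = (b, c, a) \<or> (x, y, z) = (c, a, b)"
      using corners_rotation[OF abc(2)] unfolding abc(3) xyz(1) .
    then show "w \<in> {wire x y, wire y z, wire z x}" using abc(1) by auto
  next
    fix w assume "w \<in> {wire x y, wire y z, wire z x}"
    then show "w \<in> left_wires \<tau>"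
      using xyz(2,3) rot by blast
  qed
  then show ?thesis unfolding triangle_wires_eq[OF xyz] by simp
qed

lemma set_triangle_wires:
  assumes "set ts = triangles T"
  shows "set (triangle_wires T ts) = {wire a b |a b c. (a, b, c) \<in> Q}"
proof -
  have "set (triangle_wires T ts) =
    (\<Union>\<tau>\<in>triangles T. set (triangle_labels T \<tau>))"
    by (simp add: triangle_wires_def assms)
  also have "... = (\<Union>\<tau>\<in>triangles T. left_wires \<tau>)"
    by (rule SUP_cong[OF refl set_triangle_wires_of])
  also have "... = {wire a b |a b c. (a, b, c) \<in> Q}"
    using orient_triangle by blast
  finally show ?thesis .
qed

lemma triangle_wires_distinct:
  assumes "distinct ts" "set ts = triangles T"
  shows "distinct (triangle_wires T ts)"
  unfolding triangle_wires_def
proof (rule distinct_concat_map[OF assms(1)])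
  fix \<tau> assume "\<tau> \<in> set ts"
  then have t: "\<tau> \<in> triangles T" using assms by simp
  obtain x y z where xyz: "corners T \<tau> = (x, y, z)" "(x, y, z) \<in> Q" "{x, y, z} = \<tau>"
    using corners_props[OF t] .
  have rot: "(y, z, x) \<in> Q" "(z, x, y) \<in> Q" using orientD(5,6)[OF xyz(2)] .
  note e = orient_edge(1)[OF xyz(2)] orient_edge(1)[OF rot(1)] orient_edge(1)[OF rot(2)]
  show "distinct (triangle_labels T \<tau>)"
    unfolding triangle_wires_eq[OF xyz]
    using wire_inject[OF e(1,2)] wire_inject[OF e(1,3)] wire_inject[OF e(2,3)] orientD(2-4)[OF xyz(2)] by auto
next
  fix \<tau> \<tau>' assume "\<tau> \<in> set ts" "\<tau>' \<in> set ts" and ne: "\<tau> \<noteq> \<tau>'"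
  then have t: "\<tau> \<in> triangles T" "\<tau>' \<in> triangles T" using assms by auto
  have "left_wires \<tau> \<inter> left_wires \<tau>' = {}"
  proof (rule ccontr)
    assume "\<not> ?thesis"
    then obtain a b c a' b' c' where q: "(a, b, c) \<in> Q" "{a, b, c} = \<tau>" "(a', b', c') \<in> Q" "{a', b', c'} = \<tau>'"
      and w: "wire a b = wire a' b'" by blast
    have ab: "a = a' \<and> b = b'" by (rule wire_inject[OF orient_edge(1)[OF q(1)] orient_edge(1)[OF q(3)] w])
    then have "c = c'" using q orient_unique by blast
    then show False using q ab ne by simp
  qed
  then show "set (triangle_labels T \<tau>) \<inter>
    set (triangle_labels T \<tau>') = {}"
    by (simp only: set_triangle_wires_of[OF t(1)] set_triangle_wires_of[OF t(2)])
qed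

lemma set_boundary_wires:
  "set (boundary_wires T) = {wire (bmap T i k) (bmap T i (Suc k mod 3)) |i k. i < nbdry T \<and> k < 3}"
proof -
  have three: "{..<3} = {0, 1, 2 :: nat}" by auto
  have "set (boundary_wires T) = (\<Union>i\<in>{..<nbdry T}. \<Union>k\<in>{0, 1, 2}. {(bedge T i k, Left)})"
    by (auto simp: boundary_wires_def)
  also have "... = {(bedge T i k, Left) |i k. i < nbdry T \<and> k < 3}"
    unfolding three[symmetric] by auto
  also have "... = {wire (bmap T i k) (bmap T i (Suc k mod 3)) |i k. i < nbdry T \<and> k < 3}"
    using boundary_edge(5) by (metis (no_types, lifting))
  finally show ?thesis .
qed

lemma boundary_wires_distinct: "distinct (boundary_wires T)"
  unfolding distinct_conv_nth
proof (intro allI impI notI)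
  fix l l' assume l: "l < length (boundary_wires T)" "l' < length (boundary_wires T)" "l \<noteq> l'"
    and eq: "boundary_wires T ! l = boundary_wires T ! l'"
  define i k i' k' where ik: "i = l div 3" "k = l mod 3" "i' = l' div 3" "k' = l' mod 3"
  have b: "i < nbdry T" "k < 3" "i' < nbdry T" "k' < 3"
    using l unfolding length_boundary_wires ik by auto
  have e: "l = 3 * i + k" "l' = 3 * i' + k'" unfolding ik by simp_all
  have "bedge T i k = bedge T i' k'"
    using eq boundary_wires_nth[OF b(1,2)] boundary_wires_nth[OF b(3,4)] unfolding e by simp
  then have "fst (eorient T (bedge T i k)) = fst (eorient T (bedge T i' k'))" by simp
  then have "bmap T i k = bmap T i' k'"
    using boundary_edge(1,4)[OF b(1,2)] boundary_edge(1,4)[OF b(3,4)] by simp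
  then have "(i, k) = (i', k')"
    using inj_onD[OF bmap_inj, of "(i, k)" "(i', k')"] b by auto
  then show False using l(3) e by simp
qed

text \<open>Each directed edge has on its left either exactly one triangle or the exterior, never
  both. This matching of edge outputs with triangle legs and boundary outputs makes the permutation
  in \<open>T_out\<close> well typed.\<close>

lemma edge_wires_mset:
  assumes "distinct es" "set es = edges T" "distinct ts" "set ts = triangles T"
  shows "mset (edge_wires es) = mset (boundary_wires T @ triangle_wires T ts)"
proof -
  have "set (boundary_wires T) \<inter> set (triangle_wires T ts) = {}"
  proof (rule ccontr)
    assume "\<not> ?thesis"
    then obtain i k a b c where ik: "i < nbdry T" "k < 3" and q: "(a, b, c) \<in> Q"
      and w: "wire (bmap T i k) (bmap T i (Suc k mod 3)) = wire a b"
      unfolding set_boundary_wires set_triangle_wires[OF assms(4)] by blast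
    have "bmap T i k = a \<and> bmap T i (Suc k mod 3) = b"
      by (rule wire_inject[OF boundary_edge(3)[OF ik] orient_edge(1)[OF q] w])
    then show False using boundary_edge(6)[OF ik, of c] q by simp
  qed
  then have d: "distinct (boundary_wires T @ triangle_wires T ts)"
    using boundary_wires_distinct triangle_wires_distinct[OF assms(3,4)] by simp
  have "{wire a b |a b. {a, b} \<in> edges T} =
    {wire (bmap T i k) (bmap T i (Suc k mod 3)) |i k. i < nbdry T \<and> k < 3} \<union> {wire a b |a b c. (a, b, c) \<in> Q}"
  proof (rule equalityI; rule subsetI)
    fix x assume "x \<in> {wire a b |a b. {a, b} \<in> edges T}"
    then obtain a b where ab: "x = wire a b" "{a, b} \<in> edges T" by blast
    show "x \<in> {wire (bmap T i k) (bmap T i (Suc k mod 3)) |i k. i < nbdry T \<and> k < 3} \<union> {wire a b |a b c. (a, b, c) \<in> Q}"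
    proof (cases "\<exists>c. (a, b, c) \<in> Q")
      case False
      then obtain i k where "i < nbdry T" "k < 3" "a = bmap T i k" "b = bmap T i (Suc k mod 3)"
        using no_triangle_boundary[OF ab(2)] by blast
      then show ?thesis using ab(1) by blast
    qed (use ab in blast)
  next
    fix x assume "x \<in> {wire (bmap T i k) (bmap T i (Suc k mod 3)) |i k. i < nbdry T \<and> k < 3} \<union> {wire a b |a b c. (a, b, c) \<in> Q}"
    then show "x \<in> {wire a b |a b. {a, b} \<in> edges T}"
      using boundary_edge(3) orient_edge(1) by blast
  qed
  then have "set (edge_wires es) = set (boundary_wires T @ triangle_wires T ts)"
    unfolding set_edge_wires[OF assms(2)] set_append set_boundary_wires set_triangle_wires[OF assms(4)] .
  then show ?thesis
    using set_eq_iff_mset_eq_distinct[OF edge_wires_distinct[OF assms(1)] d] by blast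
qed

section \<open>The cyclic link of a vertex and the twists around it\<close>

definition link :: "'v \<Rightarrow> 'v set" where
  "link v = {u. {v, u} \<in> edges T}"

lemma finite_link: "finite (link v)"
proof -
  have "finite (\<Union>K)" using complex(1,2) unfolding simplicial_complex_def by blast
  moreover have "link v \<subseteq> \<Union>K" by (auto simp: link_def edges_def)
  ultimately show ?thesis by (rule rev_finite_subset)
qed

text \<open>
  At a boundary vertex the link is a path; it is closed up to a cycle by sending its last vertex to
  the first one, \<open>w\<close>. This extra step is the corner of the outer face.
\<close>
definition next_in_link :: "'v \<Rightarrow> 'v \<Rightarrow> 'v \<Rightarrow> 'v" where
  "next_in_link w v u = (if \<exists>c. (v, u, c) \<in> Q then THE c. (v, u, c) \<in> Q else w)"

lemma next_in_link_triangle: "(v, u, c) \<in> Q \<Longrightarrow> next_in_link w v u = c"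
proof -
  assume q: "(v, u, c) \<in> Q"
  then have "(THE c. (v, u, c) \<in> Q) = c" by (rule the_equality) (rule orient_unique[OF _ q])
  then show ?thesis using q unfolding next_in_link_def by auto
qed

lemma next_in_link_end: "(\<And>c. (v, u, c) \<notin> Q) \<Longrightarrow> next_in_link w v u = w"
  by (simp add: next_in_link_def)

text \<open>The directed edge from \<open>c\<close> to \<open>v\<close> determines its triangle, so
  steps through triangles are injective; by \<open>ends\<close> at most one neighbour needs the
  closing step. A proper invariant subset is impossible, since \<open>link_connected\<close> yields
  a triangle, hence a step, between it and its complement. So one orbit contains all edges at
  \<open>v\<close>.\<close>

lemma link_cycle:
  assumes v: "{v} \<in> K" and u0: "u0 \<in> link v"
    and ends: "\<And>u. \<lbrakk>u \<in> link v; \<And>c. (v, u, c) \<notin> Q\<rbrakk> \<Longrightarrow> u = u1 \<and> w \<in> link v \<and> (\<forall>x. (v, x, w) \<notin> Q)"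
  obtains p where "0 < p" "(next_in_link w v ^^ p) u0 = u0"
    "bij_betw (\<lambda>i. (next_in_link w v ^^ i) u0) {..<p} (link v)"
proof (rule cyclic_enumeration[OF finite_link _ _ u0])
  let ?\<pi> = "next_in_link w v"
  show "?\<pi> ` link v \<subseteq> link v"
  proof
    fix x assume "x \<in> ?\<pi> ` link v"
    then obtain u where u: "u \<in> link v" "x = ?\<pi> u" by blast
    show "x \<in> link v"
    proof (cases "\<exists>c. (v, u, c) \<in> Q")
      case True
      then obtain c where c: "(v, u, c) \<in> Q" by blast
      then have "x = c" using u next_in_link_triangle by simp
      then show ?thesis using orient_edge(2)[OF orientD(6)[OF c]] by (simp add: link_def)
    next
      case False
      then have n: "\<And>c. (v, u, c) \<notin> Q" by blast
      show ?thesis using ends[OF u(1) n] next_in_link_end[OF n, of w] u(2) by simp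
    qed
  qed
  show "inj_on ?\<pi> (link v)"
  proof (rule inj_onI)
    fix u u' assume u: "u \<in> link v" "u' \<in> link v" and eq: "?\<pi> u = ?\<pi> u'"
    \<comment> \<open>Triangle steps never arrive at \<open>w\<close>, whereas the closing step
      does.\<close>
    have mixed: False if c: "(v, x, c) \<in> Q" and n: "\<And>c. (v, y, c) \<notin> Q" and "y \<in> link v" "?\<pi> x = ?\<pi> y" for x y c
      using ends[OF that(3) n] next_in_link_triangle[OF c, of w] next_in_link_end[OF n, of w] that(4) c by metis
    show "u = u'"
    proof (cases "\<exists>c. (v, u, c) \<in> Q")
      case True
      then obtain c where c: "(v, u, c) \<in> Q" by blast
      then obtain c' where c': "(v, u', c') \<in> Q" using mixed[OF c _ u(2) eq] by blast
      have "c = c'" using eq next_in_link_triangle[OF c] next_in_link_triangle[OF c'] by simp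
      then show ?thesis using orient_unique[OF orientD(6)[OF c]] orientD(6)[OF c'] by blast
    next
      case False
      then have n: "\<And>c. (v, u, c) \<notin> Q" by blast
      then have n': "\<And>c. (v, u', c) \<notin> Q" using mixed[OF _ n u(1) eq[symmetric]] by blast
      show ?thesis using ends[OF u(1) n] ends[OF u(2) n'] by simp
    qed
  qed
  fix A assume A: "A \<subseteq> link v" "A \<noteq> {}" "\<And>u. u \<in> link v \<Longrightarrow> ?\<pi> u \<in> A \<longleftrightarrow> u \<in> A"
  show "A = link v"
  proof (rule ccontr)
    assume "A \<noteq> link v"
    then have ne: "link v - A \<noteq> {}" using A(1) by blast
    have un: "A \<union> (link v - A) = {u. u \<noteq> v \<and> {v, u} \<in> K}"
      using A(1) by (auto simp: link_def edge_iff)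
    obtain x y where xy: "x \<in> A" "y \<in> link v - A" "{v, x, y} \<in> K"
      using link_connected[OF complex(1,3) v A(2) ne un] by blast
    have "x \<noteq> v" "y \<noteq> v" "x \<noteq> y" using xy A(1) by (auto simp: link_def edge_iff)
    then have "(v, x, y) \<in> Q \<or> (x, v, y) \<in> Q" using orient_cases[OF xy(3)] by blast
    then show False
    proof
      assume "(v, x, y) \<in> Q"
      then show False using next_in_link_triangle A(3)[of x] xy A(1) by auto
    next
      assume "(x, v, y) \<in> Q"
      then have "(v, y, x) \<in> Q" by (rule orientD(5))
      then show False using next_in_link_triangle A(3)[of y] xy by auto
    qed
  qed
qed (use that in blast)

text \<open>The corner at \<open>v\<close> of the triangle to the left of the edge from
  \<open>v\<close> to \<open>u\<close>. It counts if it is \<chi>(1), which lies between the third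
  and the first input of t.\<close>

definition corner_twist :: "'v \<Rightarrow> 'v \<Rightarrow> nat" where
  "corner_twist v u = (if \<exists>c. (v, u, c) \<in> Q \<and> corners T {v, u, c} = (v, u, c) then 1 else 0)"

text \<open>The number of Nakayama automorphisms picked up when the edge is crossed counterclockwise
  around \<open>v\<close>. The table is such that (-1) to this power is the sign of the edge, times
  -1 if it points away from \<open>v\<close>.\<close>

definition edge_twist :: "('v set \<Rightarrow> int) \<Rightarrow> 'v \<Rightarrow> 'v \<Rightarrow> nat" where
  "edge_twist s v u =
    (if eorient T {u, v} = (u, v) then (if s {u, v} = 1 then 0 else 1) else (if s {u, v} = 1 then 1 else 0))"

lemma homeo_vertex_iff: "\<lbrakk>{a} \<in> K; {b} \<in> K\<rbrakk> \<Longrightarrow> homeo T (vertex_point a) = homeo T (vertex_point b) \<longleftrightarrow> a = b"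
proof -
  assume ab: "{a} \<in> K" "{b} \<in> K"
  have "inj_on (homeo T) (realization K)"
    using homeomorphic_imp_injective_map[OF homeo] by simp
  then have "homeo T (vertex_point a) = homeo T (vertex_point b) \<longleftrightarrow> (vertex_point a :: 'v \<Rightarrow> real) = vertex_point b"
    using inj_on_eq_iff ab vertex_point_realization by metis
  moreover have "(vertex_point a :: 'v \<Rightarrow> real) = vertex_point b \<longleftrightarrow> a = b"
    by (auto simp: indicator_def fun_eq_iff)
  ultimately show ?thesis by simp
qed

lemma vertex_of_simplex: "\<tau> \<in> K \<Longrightarrow> v \<in> \<tau> \<Longrightarrow> {v} \<in> K"
  by (rule simplex_face[OF complex(1)]) auto

text \<open>A triangle with \<chi>(1) at \<open>v\<close> is matched with its second corner, a
  neighbour of \<open>v\<close>. Injectivity of \<open>homeo\<close> turns the condition on points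
  of the surface into one on vertices.\<close>

lemma sum_corner_twist:
  assumes v: "{v} \<in> K"
  shows "(\<Sum>u\<in>link v. corner_twist v u) = D_count T v"
proof -
  let ?U = "{u \<in> link v. \<exists>c. (v, u, c) \<in> Q \<and> corners T {v, u, c} = (v, u, c)}"
  let ?S = "{\<tau> \<in> triangles T. chi T \<tau> 1 = homeo T (vertex_point v)}"
  have chi: "chi T \<tau> 1 = homeo T (vertex_point v) \<longleftrightarrow> fst (corners T \<tau>) = v" if t: "\<tau> \<in> triangles T" for \<tau>
  proof -
    obtain a b c where abc: "corners T \<tau> = (a, b, c)" "(a, b, c) \<in> Q" "{a, b, c} = \<tau>"
      using corners_props[OF t] .
    have "{a} \<in> K" using vertex_of_simplex[OF orientD(1)[OF abc(2)]] by simp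
    then show ?thesis using homeo_vertex_iff v by (simp add: chi_def abc(1) affine_map_1)
  qed
  have "bij_betw (\<lambda>\<tau>. fst (snd (corners T \<tau>))) ?S ?U"
  proof (rule bij_betwI')
    have S: "\<exists>u c. corners T \<tau> = (v, u, c) \<and> (v, u, c) \<in> Q \<and> {v, u, c} = \<tau>" if "\<tau> \<in> ?S" for \<tau>
    proof -
      have t: "\<tau> \<in> triangles T" "fst (corners T \<tau>) = v" using that chi by auto
      obtain a b c where "corners T \<tau> = (a, b, c)" "(a, b, c) \<in> Q" "{a, b, c} = \<tau>"
        using corners_props[OF t(1)] .
      then show ?thesis using t(2) by auto
    qed
    fix \<tau> assume t: "\<tau> \<in> ?S"
    obtain u c where uc: "corners T \<tau> = (v, u, c)" "(v, u, c) \<in> Q" "{v, u, c} = \<tau>" using S[OF t] by blast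
    show "fst (snd (corners T \<tau>)) \<in> ?U"
      using uc orient_edge(1)[OF uc(2)] by (auto simp: link_def)
    fix \<tau>' assume t': "\<tau>' \<in> ?S"
    obtain u' c' where uc': "corners T \<tau>' = (v, u', c')" "(v, u', c') \<in> Q" "{v, u', c'} = \<tau>'" using S[OF t'] by blast
    show "fst (snd (corners T \<tau>)) = fst (snd (corners T \<tau>')) \<longleftrightarrow> \<tau> = \<tau>'"
    proof
      assume "fst (snd (corners T \<tau>)) = fst (snd (corners T \<tau>'))"
      then have "u = u'" using uc(1) uc'(1) by simp
      then have "c = c'" using uc(2) uc'(2) orient_unique by blast
      then show "\<tau> = \<tau>'" using \<open>u = u'\<close> uc(3) uc'(3) by blast
    qed simp
  next
    fix u assume "u \<in> ?U"
    then obtain c where c: "(v, u, c) \<in> Q" "corners T {v, u, c} = (v, u, c)" by blast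
    have "{v, u, c} \<in> ?S" using orient_triangle[OF c(1)] chi c(2) by simp
    then show "\<exists>\<tau>\<in>?S. u = fst (snd (corners T \<tau>))" using c(2) by (intro bexI) auto
  qed
  then have "card ?S = card ?U" by (rule bij_betw_same_card)
  moreover have "(\<Sum>u\<in>link v. corner_twist v u) = card ?U"
    unfolding corner_twist_def by (simp add: sum.If_cases[OF finite_link] Int_def)
  ultimately show ?thesis by (simp add: D_count_def)
qed

lemma bij_link_edges: "bij_betw (\<lambda>u. {v, u}) (link v) {e \<in> edges T. v \<in> e}"
proof (rule bij_betwI')
  show "({v, u} = {v, u'}) = (u = u')" if "u \<in> link v" "u' \<in> link v" for u u'
    by (auto simp: doubleton_eq_iff)
  show "{v, u} \<in> {e \<in> edges T. v \<in> e}" if "u \<in> link v" for u using that by (simp add: link_def)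
  fix e assume e: "e \<in> {e \<in> edges T. v \<in> e}"
  then obtain a b where ab: "e = {a, b}" using edgeE by blast
  then have "e = {v, if v = a then b else a}" using e by auto
  then show "\<exists>u\<in>link v. e = {v, u}" using e by (auto simp: link_def)
qed

lemma K_count_link: "K_count T v = (\<Sum>u\<in>link v. if eorient T {v, u} = (v, u) then 1 else 0)"
proof -
  have "bij_betw (\<lambda>u. {v, u}) {u \<in> link v. eorient T {v, u} = (v, u)} {e \<in> edges T. fst (eorient T e) = v}"
  proof (rule bij_betwI')
    fix u u' assume "u \<in> {u \<in> link v. eorient T {v, u} = (v, u)}"
    then show "{v, u} \<in> {e \<in> edges T. fst (eorient T e) = v}" by (simp add: link_def)
    show "({v, u} = {v, u'}) = (u = u')" by (auto simp: doubleton_eq_iff)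
  next
    fix e assume e: "e \<in> {e \<in> edges T. fst (eorient T e) = v}"
    define u where "u = snd (eorient T e)"
    have "e = {v, u}" "eorient T e = (v, u)" using e eorient_eq[of e] by (auto simp: u_def)
    then show "\<exists>u\<in>{u \<in> link v. eorient T {v, u} = (v, u)}. e = {v, u}" using e by (auto simp: link_def)
  qed
  then have "card {u \<in> link v. eorient T {v, u} = (v, u)} = K_count T v"
    unfolding K_count_def by (rule bij_betw_same_card)
  then show ?thesis by (simp add: sum.If_cases[OF finite_link] Int_def)
qed

text \<open>Multiplying over the edges at \<open>v\<close>, (-1) to the total edge twist is the
  product of the signs times (-1)^K. As both sides of the sign condition are 1 or -1, its failure
  says that the product is (-1)^(d+K). Here \<open>d\<close> stands for D or D'.\<close>

lemma even_twist:
  fixes s :: "'v set \<Rightarrow> int"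
  assumes s: "\<forall>e\<in>edges T. s e \<in> {1, -1}"
    and viol: "(\<Prod>e | e \<in> edges T \<and> v \<in> e. s e) \<noteq> (-1) ^ (d + K_count T v + 1)"
  shows "even (d + (\<Sum>u\<in>link v. edge_twist s v u))"
proof -
  let ?k = "\<lambda>u. if eorient T {v, u} = (v, u) then 1 else 0 :: nat"
  have prod: "(\<Prod>e | e \<in> edges T \<and> v \<in> e. s e) = (\<Prod>u\<in>link v. s {v, u})"
    using prod.reindex_bij_betw[OF bij_link_edges[of v], of s] by simp
  have tw: "(-1) ^ edge_twist s v u = s {v, u} * (-1) ^ ?k u" if "u \<in> link v" for u
  proof -
    have e: "{v, u} \<in> edges T" "{u, v} = {v, u}" using that by (auto simp: link_def)
    then have "u \<noteq> v" "eorient T {v, u} = (v, u) \<or> eorient T {v, u} = (u, v)"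
      using eorient_cases[OF e(1)] by (auto simp: edge_iff)
    moreover have "s {v, u} = 1 \<or> s {v, u} = -1" using s e(1) by blast
    ultimately show ?thesis unfolding edge_twist_def e(2) by auto
  qed
  have "(-1) ^ (\<Sum>u\<in>link v. edge_twist s v u) = (\<Prod>u\<in>link v. s {v, u} * (-1) ^ ?k u)"
    unfolding power_sum using tw by (intro prod.cong) auto
  also have "... = (\<Prod>e | e \<in> edges T \<and> v \<in> e. s e) * (-1) ^ K_count T v"
    unfolding prod K_count_link power_sum by (rule prod.distrib)
  finally have 1: "(-1) ^ (\<Sum>u\<in>link v. edge_twist s v u) = (\<Prod>e | e \<in> edges T \<and> v \<in> e. s e) * (-1) ^ K_count T v" .
  have "(\<Prod>u\<in>link v. s {v, u}) \<in> {1, -1}"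
    using finite_link[of v]
  proof (rule finite_subset_induct[where A = "link v" and F = "link v"])
    fix a F assume "a \<in> link v" "finite F" "a \<notin> F" "(\<Prod>u\<in>F. s {v, u}) \<in> {1, -1}"
    moreover have "s {v, a} \<in> {1, -1}" using s calculation(1) by (auto simp: link_def)
    ultimately show "(\<Prod>u\<in>insert a F. s {v, u}) \<in> {1, -1}" by auto
  qed auto
  then have "(\<Prod>e | e \<in> edges T \<and> v \<in> e. s e) = (-1) ^ (d + K_count T v)"
    using viol unfolding prod by (cases "even (d + K_count T v)") auto
  then have "(-1 :: int) ^ (d + (\<Sum>u\<in>link v. edge_twist s v u)) = (-1) ^ (2 * (d + K_count T v))"
    unfolding power_add 1 by (simp add: power_add power_mult mult_ac power2_eq_square)
  then show ?thesis by (simp add: minus_one_power_iff split: if_splits)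
qed

end

section \<open>Morphisms between tensor powers of a Frobenius algebra\<close>

text \<open>
  Source and target are recorded as exponents, because different tensor powers of \<open>A\<close> may be equal
  as objects, so that a morphism does not determine them.
\<close>
datatype 'm arrow = Arrow (src: nat) (tgt: nat) (mor: 'm)

locale frobenius_network =
  additive_symmetric_strict_monoidal_category C + frobenius_algebra C F
  for C :: "('o, 'm, 'x) monoidal_data_scheme" (structure)
    and F :: "('o, 'm, 'y) frobenius_data_scheme" +
  assumes separable: "delta_separable C F"
    and nakayama_involutive: "nakayama C F \<cdot> nakayama C F = \<i>\<d> (carr F)"
    and nakayama_convolution: "convolution C F (nakayama C F) (\<i>\<d> (carr F)) = \<zero> (carr F) (carr F)"
begin

declare One_nat_def [simp del]

lemma one_plus_Suc [simp]: "1 + n = Suc n"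
  by simp

abbreviation pow :: "nat \<Rightarrow> 'o" where "pow n \<equiv> tpow C (carr F) n"

definition ok :: "'m arrow \<Rightarrow> bool" where
  "ok x \<longleftrightarrow> mor x \<in> Hom C (pow (src x)) (pow (tgt x))"

definition comp :: "'m arrow \<Rightarrow> 'm arrow \<Rightarrow> 'm arrow"  (infixr "oo" 60) where
  "x oo y = Arrow (src y) (tgt x) (mor x \<cdot> mor y)"

definition tens :: "'m arrow \<Rightarrow> 'm arrow \<Rightarrow> 'm arrow"  (infixr "||" 70) where
  "x || y = Arrow (src x + src y) (tgt x + tgt y) (mor x \<otimes> mor y)"

definition idn :: "nat \<Rightarrow> 'm arrow" where
  "idn n = Arrow n n (\<i>\<d> (pow n))"

definition Sw :: "nat \<Rightarrow> nat \<Rightarrow> 'm arrow" where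
  "Sw n m = Arrow (n + m) (m + n) (\<sigma> (pow n) (pow m))"

definition Zero :: "nat \<Rightarrow> nat \<Rightarrow> 'm arrow" where
  "Zero n m = Arrow n m (\<zero> (pow n) (pow m))"

lemma pow_obj [simp, intro]: "pow n \<in> Obj C"
  by (induction n) (auto intro: uobj_obj tobj_obj carr_obj)

lemma pow_add: "pow (n + m) = pow n \<odot> pow m"
  by (induction n) (auto simp: tobj_unit_left tobj_assoc carr_obj)

lemma pow_1: "pow 1 = carr F"
  by (simp add: One_nat_def tobj_unit_right carr_obj)

lemma pow_2: "pow 2 = carr F \<odot> carr F"
  by (simp add: numeral_2_eq_2 tobj_unit_right carr_obj)

abbreviation I :: "'m arrow" where "I \<equiv> idn 1"

lemma src_tgt [simp]:
  "src (x oo y) = src y" "tgt (x oo y) = tgt x"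
  "src (x || y) = src x + src y" "tgt (x || y) = tgt x + tgt y"
  "src (idn n) = n" "tgt (idn n) = n"
  "src (Sw n m) = n + m" "tgt (Sw n m) = m + n"
  "src (Zero n m) = n" "tgt (Zero n m) = m"
  by (simp_all add: comp_def tens_def idn_def Sw_def Zero_def)

lemma mor_simps:
  "mor (x oo y) = mor x \<cdot> mor y" "mor (x || y) = mor x \<otimes> mor y"
  "mor (idn n) = \<i>\<d> (pow n)" "mor (Sw n m) = \<sigma> (pow n) (pow m)"
  "mor (Zero n m) = \<zero> (pow n) (pow m)"
  by (simp_all add: comp_def tens_def idn_def Sw_def Zero_def)

lemma ok_comp [simp]: "\<lbrakk>ok x; ok y; src x = tgt y\<rbrakk> \<Longrightarrow> ok (x oo y)"
  unfolding ok_def comp_def using cmp_hom[OF pow_obj pow_obj pow_obj] by auto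

lemma ok_tens [simp]: "\<lbrakk>ok x; ok y\<rbrakk> \<Longrightarrow> ok (x || y)"
  unfolding ok_def tens_def using tmor_hom[OF pow_obj pow_obj pow_obj pow_obj]
  by (auto simp: pow_add)

lemma ok_idn [simp]: "ok (idn n)"
  unfolding ok_def idn_def by (simp add: ident_hom)

lemma ok_Sw [simp]: "ok (Sw n m)"
  unfolding ok_def Sw_def by (simp add: pow_add braid_hom)

lemma ok_Zero [simp]: "ok (Zero n m)"
  unfolding ok_def Zero_def by (simp add: hzero_hom)

lemma comp_assoc:
  "\<lbrakk>ok x; ok y; ok z; src x = tgt y; src y = tgt z\<rbrakk> \<Longrightarrow> (x oo y) oo z = x oo (y oo z)"
  unfolding ok_def comp_def
  by (auto intro!: cmp_assoc[OF pow_obj[of "src z"] pow_obj[of "tgt z"] pow_obj[of "tgt y"] pow_obj[of "tgt x"]])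

lemma idn_comp [simp]: "\<lbrakk>ok x; tgt x = n\<rbrakk> \<Longrightarrow> idn n oo x = x"
  unfolding ok_def comp_def idn_def
  using ident_left[OF pow_obj[of "src x"] pow_obj[of "tgt x"]] by (cases x) auto

lemma comp_idn [simp]: "\<lbrakk>ok x; src x = n\<rbrakk> \<Longrightarrow> x oo idn n = x"
  unfolding ok_def comp_def idn_def
  using ident_right[OF pow_obj[of "src x"] pow_obj[of "tgt x"]] by (cases x) auto

lemma tens_assoc: "\<lbrakk>ok x; ok y; ok z\<rbrakk> \<Longrightarrow> (x || y) || z = x || (y || z)"
  unfolding ok_def tens_def
  by (auto intro!: tmor_assoc[OF pow_obj[of "src x"] pow_obj[of "tgt x"] pow_obj[of "src y"] pow_obj[of "tgt y"] pow_obj[of "src z"] pow_obj[of "tgt z"]])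

lemma idn_tens_idn: "idn n || idn m = idn (n + m)"
  unfolding tens_def idn_def by (simp add: tmor_ident pow_add)

lemma idn_0_tens [simp]: "ok x \<Longrightarrow> idn 0 || x = x"
  unfolding ok_def tens_def idn_def
  by (cases x) (auto intro!: tmor_unit_left[of "pow (src x)" "pow (tgt x)"])

lemma tens_idn_0 [simp]: "ok x \<Longrightarrow> x || idn 0 = x"
  unfolding ok_def tens_def idn_def
  by (cases x) (auto intro!: tmor_unit_right[of "pow (src x)" "pow (tgt x)"])

lemma tens_comp:
  "\<lbrakk>ok g; ok f; ok g'; ok f'; src g = tgt f; src g' = tgt f'\<rbrakk>
   \<Longrightarrow> (g oo f) || (g' oo f') = (g || g') oo (f || f')"
  unfolding ok_def tens_def comp_def
  by (auto intro!: interchange[OF pow_obj[of "src f"] pow_obj[of "tgt f"] pow_obj[of "tgt g"] pow_obj[of "src f'"] pow_obj[of "tgt f'"] pow_obj[of "tgt g'"]])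

lemma Sw_natural:
  "\<lbrakk>ok f; ok g; src f = a; tgt f = b; src g = c; tgt g = d\<rbrakk> \<Longrightarrow> Sw b d oo (f || g) = (g || f) oo Sw a c"
  unfolding ok_def tens_def comp_def Sw_def
  by (auto intro!: braid_natural[OF pow_obj pow_obj pow_obj pow_obj])

lemma Sw_Sw [simp]: "Sw m n oo Sw n m = idn (n + m)"
  unfolding comp_def Sw_def idn_def by (simp add: braid_symmetric pow_add)

lemma Sw_add_left: "Sw (n + m) k = (Sw n k || idn m) oo (idn n || Sw m k)"
  unfolding comp_def Sw_def idn_def tens_def
  by (simp add: braid_hexagon pow_add)


lemma tens_idn_comp:
  "\<lbrakk>ok g; ok f; src g = tgt f\<rbrakk> \<Longrightarrow> idn n || (g oo f) = (idn n || g) oo (idn n || f)"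
  using tens_comp[of "idn n" "idn n" g f] by simp

lemma comp_tens_idn:
  "\<lbrakk>ok g; ok f; src g = tgt f\<rbrakk> \<Longrightarrow> (g oo f) || idn n = (g || idn n) oo (f || idn n)"
  using tens_comp[of g f "idn n" "idn n"] by simp

lemma idn_tens_idn_tens: "ok x \<Longrightarrow> idn n || (idn m || x) = idn (n + m) || x"
  by (simp add: tens_assoc[symmetric] idn_tens_idn)

lemma tens_split_left: "\<lbrakk>ok f; ok g; tgt f = a; src g = b\<rbrakk> \<Longrightarrow> (idn a || g) oo (f || idn b) = f || g"
  using tens_comp[of "idn a" f g "idn b"] by simp

lemma tens_split_right: "\<lbrakk>ok f; ok g; src f = a; tgt g = b\<rbrakk> \<Longrightarrow> (f || idn b) oo (idn a || g) = f || g"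
  using tens_comp[of f "idn a" "idn b" g] by simp

lemma exchange:
  "\<lbrakk>ok f; ok g; tgt f = a; src g = b; src f = c; tgt g = d\<rbrakk>
   \<Longrightarrow> (idn a || g) oo (f || idn b) = (f || idn d) oo (idn c || g)"
  by (simp add: tens_split_left tens_split_right)

text \<open>Normal form of a diagram: a right-nested composite of layers, in each of which factors
  are padded by identities.\<close>

lemmas normalize = comp_assoc tens_assoc tens_idn_comp comp_tens_idn idn_tens_idn idn_tens_idn_tens

lemma comp_cong_assoc:
  "\<lbrakk>x oo y = z; ok x; ok y; ok w; src x = tgt y; src y = tgt w\<rbrakk> \<Longrightarrow> x oo (y oo w) = z oo w"
  using comp_assoc[of x y w] by simp

abbreviation S :: "'m arrow" where "S \<equiv> Sw 1 1"

text \<open>The hexagon makes the braiding with the unit object idempotent, and by symmetry it is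
  invertible.\<close>

lemma Sw_0_left [simp]: "Sw 0 n = idn n"
proof -
  have a: "Sw 0 n = Sw 0 n oo Sw 0 n"
    using Sw_add_left[of 0 0 n] by simp
  have "Sw n 0 oo Sw 0 n = Sw n 0 oo (Sw 0 n oo Sw 0 n)"
    using a by simp
  also have "... = Sw 0 n"
    by (simp add: comp_assoc[symmetric])
  finally show ?thesis by simp
qed

lemma Sw_0_right [simp]: "Sw n 0 = idn n"
  using Sw_Sw[of 0 n] by simp

text \<open>Second hexagon: both sides are inverse to \<open>Sw (n + m) k\<close>.\<close>

lemma Sw_add_right: "Sw k (n + m) = (idn n || Sw k m) oo (Sw k n || idn m)"
proof -
  let ?x = "(idn n || Sw k m) oo (Sw k n || idn m)"
  have "Sw (n + m) k oo ?x
     = (Sw n k || idn m) oo ((idn n || (Sw m k oo Sw k m)) oo (Sw k n || idn m))"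
    unfolding Sw_add_left by (simp add: comp_assoc tens_idn_comp del: Sw_Sw)
  also have "... = (Sw n k || idn m) oo (Sw k n || idn m)"
    by (simp add: idn_tens_idn add_ac)
  also have "... = (Sw n k oo Sw k n) || idn m"
    by (simp add: comp_tens_idn del: Sw_Sw)
  also have "... = idn (k + n + m)"
    by (simp add: idn_tens_idn)
  finally have e: "Sw (n + m) k oo ?x = idn (k + n + m)" .
  have "Sw k (n + m) = Sw k (n + m) oo (Sw (n + m) k oo ?x)"
    unfolding e by (simp add: ac_simps)
  also have "... = ?x"
    by (subst comp_assoc[symmetric]) (simp_all add: ac_simps)
  finally show ?thesis .
qed

definition binop :: "'m arrow \<Rightarrow> bool" where
  "binop g \<longleftrightarrow> ok g \<and> src g = 2 \<and> tgt g = 1"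

lemma binopD [simp]: "binop g \<Longrightarrow> ok g" "binop g \<Longrightarrow> src g = 2" "binop g \<Longrightarrow> tgt g = 1"
  by (simp_all add: binop_def)

lemma S_binop_left:
  assumes "binop g"
  shows "S oo (g || I) = (I || g) oo (S || I) oo (I || S)"
  using Sw_natural[of g "I" 2 1 1 1] Sw_add_left[of 1 1 1] assms
  by (simp add: one_add_one)

lemma S_binop_right:
  assumes "binop g"
  shows "S oo (I || g) oo (S || I) = (g || I) oo (I || S)"
proof -
  have "S oo (I || g) = (g || I) oo (I || S) oo (S || I)"
    using Sw_natural[of "I" g 1 1 2 1] Sw_add_right[of 1 1 1] assms
    by (simp add: one_add_one)
  then have "(S oo (I || g)) oo (S || I)
     = (g || I) oo (I || S) oo ((S oo S) || I)"
    using assms by (simp add: comp_assoc comp_tens_idn del: Sw_Sw)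
  then show ?thesis using assms by (simp add: comp_assoc idn_tens_idn)
qed

text \<open>Naturality of the braiding with respect to \<open>S\<close> itself.\<close>

lemma yang_baxter:
  "(S || I) oo (I || S) oo (S || I) = (I || S) oo (S || I) oo (I || S)"
proof -
  have "Sw 2 1 oo (S || I) = (I || S) oo Sw 2 1"
    using Sw_natural[of S "I" 2 2 1 1] by simp
  then show ?thesis
    using Sw_add_left[of 1 1 1] by (simp add: one_add_one comp_assoc)
qed

lemma S_binop_left_pad:
  assumes "binop g"
  shows "(S || idn m) oo (g || idn (Suc m))
    = (I || g || idn m) oo (S || idn (Suc m)) oo (I || S || idn m)"
  using arg_cong[OF S_binop_left[OF assms], of "\<lambda>x. x || idn m"] assms
  by (simp add: normalize)

lemma S_binop_right_pad:
  assumes "binop g"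
  shows "(S || idn m) oo (I || g || idn m) oo (S || idn (Suc m))
    = (g || idn (Suc m)) oo (I || S || idn m)"
  using arg_cong[OF S_binop_right[OF assms], of "\<lambda>x. x || idn m"] assms
  by (simp add: normalize)

lemma yang_baxter_pad:
  "(S || idn (Suc m)) oo (I || S || idn m) oo (S || idn (Suc m))
    = (I || S || idn m) oo (S || idn (Suc m)) oo (I || S || idn m)"
  using arg_cong[OF yang_baxter, of "\<lambda>x. x || idn m"]
  by (simp add: normalize)


text \<open>
  \<open>Act g ws w\<close> multiplies the first input into the factor labelled \<open>w\<close> by means of \<open>g\<close>, from the
  left for \<open>g = \<mu>\<close> and from the right for \<open>g = \<mu> \<circ> \<sigma>\<close>.
\<close>
primrec Act :: "'m arrow \<Rightarrow> 'w list \<Rightarrow> 'w \<Rightarrow> 'm arrow" where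
  "Act g [] w = Arrow 1 0 undefined"
| "Act g (x # xs) w =
    (if x = w then g || idn (length xs)
     else (I || Act g xs w) oo (S || idn (length xs)))"

lemma src_tgt_Act [simp]:
  "binop g \<Longrightarrow> src (Act g ws w) = Suc (length ws)" "binop g \<Longrightarrow> tgt (Act g ws w) = length ws"
  by (induction ws) auto

lemma ok_Act [simp]: "\<lbrakk>binop g; w \<in> set ws\<rbrakk> \<Longrightarrow> ok (Act g ws w)"
  by (induction ws) auto

text \<open>The braiding in the recursion of \<open>permute\<close>, spelled out as adjacent swaps
  so that it matches the recursion of \<open>Act\<close>. \<open>Front_eq_Sw\<close> returns to the
  original form.\<close>

primrec Front :: "'w list \<Rightarrow> 'w \<Rightarrow> 'm arrow" where
  "Front [] w = Arrow 0 0 undefined"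
| "Front (x # xs) w =
    (if x = w then idn (Suc (length xs))
     else (S || idn (length (remove1 w xs))) oo (I || Front xs w))"

lemma src_tgt_Front [simp]:
  "w \<in> set ws \<Longrightarrow> src (Front ws w) = length ws" "w \<in> set ws \<Longrightarrow> tgt (Front ws w) = length ws"
  by (induction ws) (auto simp: length_remove1 Suc_diff_Suc dest: length_pos_if_in_set)

lemma length_remove1_Suc: "w \<in> set ws \<Longrightarrow> length ws = Suc (length (remove1 w ws))"
  by (auto simp: length_remove1 dest: length_pos_if_in_set)

lemma ok_Front [simp]: "w \<in> set ws \<Longrightarrow> ok (Front ws w)"
  by (induction ws) (auto simp: length_remove1_Suc[symmetric] simp flip: numeral_2_eq_2 dest: length_remove1_Suc)

text \<open>Induction along the strands. If the head is \<open>w\<close>, or if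
  \<open>v = w\<close>, naturality of \<open>S\<close> moves \<open>g\<close> through a swap; if
  \<open>v\<close> and \<open>w\<close> are different strands behind the head, the inserted input,
  the moved strand and the head cross pairwise, which is Yang-Baxter.\<close>

lemma Front_Act:
  assumes g: "binop g"
  shows "\<lbrakk>v \<in> set ws; w \<in> set ws\<rbrakk> \<Longrightarrow>
    Front ws v oo Act g ws w = Act g (v # remove1 v ws) w oo (I || Front ws v)"
proof (induction ws)
  case (Cons x xs)
  show ?case
  proof (cases "x = v")
    case True
    then show ?thesis using Cons.prems g by (auto simp: idn_tens_idn)
  next
    case False
    then have v: "v \<in> set xs" using Cons.prems by simp
    define m where "m = length (remove1 v xs)"
    have len: "length xs = Suc m"
      using length_remove1_Suc[OF v] by (simp add: m_def)
    show ?thesis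
    proof (cases "x = w")
      case True
      have "(S || idn m) oo (I || Front xs v) oo (g || idn (Suc m))
        = (S || idn m) oo (g || idn (Suc m)) oo (idn 2 || Front xs v)"
        using g v len by (simp add: exchange)
      also have "... = ((S || idn m) oo (g || idn (Suc m))) oo (idn 2 || Front xs v)"
        using g v len by (simp add: comp_assoc)
      also have "... = (I || g || idn m) oo (S || idn (Suc m)) oo (I || S || idn m) oo (idn 2 || Front xs v)"
        unfolding S_binop_left_pad[OF g] using g v len by (simp add: comp_assoc)
      finally show ?thesis using True False g v len
        by (simp add: m_def[symmetric] normalize)
    next
      case w: False
      then have w': "w \<in> set xs" using Cons.prems by simp
      have "(S || idn m) oo (I || Front xs v) oo (I || Act g xs w) oo (S || idn (Suc m))
        = (S || idn m) oo (I || (Front xs v oo Act g xs w)) oo (S || idn (Suc m))"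
        using g v w' len by (simp add: normalize)
      also have "... = (S || idn m) oo (I || Act g (v # remove1 v xs) w) oo (idn 2 || Front xs v) oo (S || idn (Suc m))"
        unfolding Cons.IH[OF v w'] using g v w' len length_remove1_Suc[OF v]
        by (cases "v = w") (auto simp: normalize m_def)
      also have "... = (S || idn m) oo (I || Act g (v # remove1 v xs) w) oo (S || idn (Suc m)) oo (idn 2 || Front xs v)"
        using g v w' len by (simp add: exchange)
      also have "... = Act g (v # x # remove1 v xs) w oo (I || S || idn m) oo (idn 2 || Front xs v)"
      proof (cases "v = w")
        case True
        have "length (remove1 w xs) = m" using m_def True by simp
        then show ?thesis
          using g v w' len comp_cong_assoc[OF S_binop_right_pad[OF g, of m], of "idn 2 || Front xs v"]
          by (simp add: normalize True)
      next
        case vw: False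
        then have r: "w \<in> set (remove1 v xs)" using w' by simp
        let ?A = "Act g (remove1 v xs) w"
        let ?Z = "idn 2 || Front xs v"
        have ex: "(S || idn m) oo (idn 2 || ?A) = (idn 2 || ?A) oo (S || idn (Suc m))"
          using g r exchange[of S ?A 2 "Suc m" 2 m] by (simp add: m_def[symmetric])
        have "(S || idn m) oo (idn 2 || ?A) oo (I || S || idn m) oo (S || idn (Suc m)) oo ?Z
          = ((S || idn m) oo (idn 2 || ?A)) oo (I || S || idn m) oo (S || idn (Suc m)) oo ?Z"
          using g v r len by (simp add: comp_assoc m_def[symmetric])
        also have "... = (idn 2 || ?A) oo ((S || idn (Suc m)) oo (I || S || idn m) oo (S || idn (Suc m))) oo ?Z"
          unfolding ex using g v r len by (simp add: comp_assoc m_def[symmetric])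
        also have "... = (idn 2 || ?A) oo (I || S || idn m) oo (S || idn (Suc m)) oo (I || S || idn m) oo ?Z"
          unfolding yang_baxter_pad using g v r len by (simp add: comp_assoc m_def[symmetric])
        finally show ?thesis
          using vw w g v r len by (simp add: normalize m_def[symmetric])
      qed
      finally show ?thesis using w False g v w' len
        by (simp add: m_def[symmetric] normalize)
    qed
  qed
qed simp


section \<open>Permutation morphisms and their compatibility with insertions\<close>

definition Perm :: "'w list \<Rightarrow> 'w list \<Rightarrow> 'm arrow" where
  "Perm ws vs = Arrow (length ws) (length vs) (permute C (carr F) ws vs)"

lemma src_tgt_Perm [simp]: "src (Perm ws vs) = length ws" "tgt (Perm ws vs) = length vs"
  by (simp_all add: Perm_def)

lemma Perm_Nil: "Perm [] [] = idn 0"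
  by (simp add: Perm_def idn_def)

lemma length_takeWhile_neq: "w \<in> set ws \<Longrightarrow> length (takeWhile (\<lambda>x. x \<noteq> w) ws) < length ws"
  by (induction ws) auto

lemma Front_eq_Sw:
  "w \<in> set ws \<Longrightarrow> length ws = Suc n \<Longrightarrow>
    Front ws w = Sw (length (takeWhile (\<lambda>x. x \<noteq> w) ws)) 1 || idn (n - length (takeWhile (\<lambda>x. x \<noteq> w) ws))"
proof (induction ws arbitrary: n)
  case (Cons x xs)
  show ?case
  proof (cases "x = w")
    case True
    then show ?thesis using Cons.prems by (simp add: idn_tens_idn)
  next
    case False
    then have w: "w \<in> set xs" using Cons.prems by simp
    then obtain m where m: "length xs = Suc m" "n = Suc m" "length (remove1 w xs) = m"
      using Cons.prems(2) length_remove1_Suc[OF w] by auto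
    define k where "k = length (takeWhile (\<lambda>x. x \<noteq> w) xs)"
    have "k < length xs"
      unfolding k_def using w by (rule length_takeWhile_neq)
    then obtain r where r: "m = k + r" using m by (auto simp: le_iff_add less_Suc_eq_le)
    have "Sw (1 + k) 1 = (S || idn k) oo (I || Sw k 1)"
      by (rule Sw_add_left)
    then show ?thesis
      using False m Cons.IH[OF w m(1)] r by (simp add: k_def[symmetric] normalize)
  qed
qed simp

lemma Perm_Cons:
  assumes "v \<in> set ws" "length ws = Suc (length vs)"
  shows "Perm ws (v # vs) = (I || Perm (remove1 v ws) vs) oo Front ws v"
proof -
  let ?k = "length (takeWhile (\<lambda>x. x \<noteq> v) ws)"
  have "?k < length ws" using length_takeWhile_neq[OF assms(1)] .
  then show ?thesis
    unfolding Front_eq_Sw[OF assms]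
    using assms by (simp add: Perm_def comp_def tens_def idn_def Sw_def Let_def pow_1 length_remove1)
qed

lemma ok_Perm [simp]: "mset ws = mset vs \<Longrightarrow> ok (Perm ws vs)"
proof (induction vs arbitrary: ws)
  case Nil
  then show ?case by (simp add: Perm_Nil)
next
  case (Cons v vs)
  have v: "v \<in> set ws" and l: "length ws = Suc (length vs)"
    using Cons.prems by (metis list.set_intros(1) mset_eq_setD, metis length_Cons mset_eq_length)
  have "mset (remove1 v ws) = mset vs" using Cons.prems by simp
  then show ?case
    using Cons.IH Perm_Cons[OF v l] v l by (simp add: length_remove1)
qed

text \<open>Lets insertions ignore the connections: below or above a permutation, only the label
  counts.\<close>

lemma Perm_Act:
  assumes g: "binop g"
  shows "\<lbrakk>mset ws = mset vs; w \<in> set ws\<rbrakk> \<Longrightarrow>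
    Perm ws vs oo Act g ws w = Act g vs w oo (I || Perm ws vs)"
proof (induction vs arbitrary: ws)
  case (Cons v vs)
  have v: "v \<in> set ws" and l: "length ws = Suc (length vs)"
    using Cons.prems by (metis list.set_intros(1) mset_eq_setD, metis length_Cons mset_eq_length)
  have m: "mset (remove1 v ws) = mset vs" using Cons.prems by simp
  have lr: "length (remove1 v ws) = length vs" using m mset_eq_length by blast
  let ?P = "Perm (remove1 v ws) vs"
  have "Perm ws (v # vs) oo Act g ws w = (I || ?P) oo Front ws v oo Act g ws w"
    using Perm_Cons[OF v l] v l g Cons.prems m lr by (simp add: comp_assoc)
  also have "... = (I || ?P) oo Act g (v # remove1 v ws) w oo (I || Front ws v)"
    using Front_Act[OF g v Cons.prems(2)] by simp
  also have "... = Act g (v # vs) w oo (idn 2 || ?P) oo (I || Front ws v)"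
  proof (cases "v = w")
    case True
    then show ?thesis
      using v l g m lr exchange[of g ?P 1 "length vs" 2 "length vs"]
      by (simp add: comp_assoc[symmetric])
  next
    case False
    then have w: "w \<in> set (remove1 v ws)" using Cons.prems by simp
    then have w': "w \<in> set vs" using m mset_eq_setD by blast
    let ?Z = "I || Front ws v"
    have "(I || ?P) oo (I || Act g (remove1 v ws) w) oo (S || idn (length vs)) oo ?Z
       = (I || (?P oo Act g (remove1 v ws) w)) oo (S || idn (length vs)) oo ?Z"
      using v l g m lr w by (simp add: normalize)
    also have "... = (I || Act g vs w) oo ((idn 2 || ?P) oo (S || idn (length vs))) oo ?Z"
      unfolding Cons.IH[OF m w]
      using v l g m lr w' by (simp add: normalize)
    also have "... = (I || Act g vs w) oo ((S || idn (length vs)) oo (idn 2 || ?P)) oo ?Z"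
      using v l g m lr w' exchange[of S ?P 2 "length vs" 2 "length vs"] by simp
    finally show ?thesis
      using False v l g m lr w w' by (simp add: normalize)
  qed
  also have "... = Act g (v # vs) w oo (I || Perm ws (v # vs))"
    using Perm_Cons[OF v l] v l m lr by (simp add: normalize)
  finally show ?case .
qed simp

lemma Act_append_left:
  "\<lbrakk>binop g; w \<in> set xs\<rbrakk> \<Longrightarrow> Act g (xs @ ys) w = Act g xs w || idn (length ys)"
proof (induction xs)
  case (Cons x xs)
  then show ?case by (auto simp: normalize)
qed simp

lemma Act_append_right:
  "\<lbrakk>binop g; w \<notin> set xs; w \<in> set ys\<rbrakk> \<Longrightarrow>
    Act g (xs @ ys) w = (idn (length xs) || Act g ys w) oo (Sw 1 (length xs) || idn (length ys))"
proof (induction xs)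
  case (Cons x xs)
  have "Sw 1 (1 + length xs) = (I || Sw 1 (length xs)) oo (S || idn (length xs))"
    by (rule Sw_add_right)
  then show ?case using Cons by (auto simp: normalize)
qed (simp add: idn_tens_idn)

text \<open>Swapping the two inputs is an involution, so the case where \<open>w'\<close> is the
  head follows from that where \<open>w\<close> is.\<close>

lemma Act_commute_sym:
  assumes "binop g" "binop g'" "w \<in> set ws" "w' \<in> set ws"
    and "Act g' ws w' oo (I || Act g ws w) = Act g ws w oo (I || Act g' ws w') oo (S || idn (length ws))"
  shows "Act g ws w oo (I || Act g' ws w') = Act g' ws w' oo (I || Act g ws w) oo (S || idn (length ws))"
proof -
  have "(Act g' ws w' oo (I || Act g ws w)) oo (S || idn (length ws))
    = Act g ws w oo (I || Act g' ws w') oo ((S oo S) || idn (length ws))"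
    unfolding assms(5) using assms(1-4) by (simp add: comp_assoc comp_tens_idn del: Sw_Sw)
  then show ?thesis using assms(1-4) by (simp add: comp_assoc idn_tens_idn)
qed

lemma Act_commute_head:
  assumes "binop g" "binop g'" "x \<noteq> w'" "w' \<in> set xs"
  shows "Act g (x # xs) x oo (I || Act g' (x # xs) w')
    = Act g' (x # xs) w' oo (I || Act g (x # xs) x) oo (S || idn (length (x # xs)))"
proof -
  let ?n = "length xs" and ?A = "Act g' xs w'"
  have "(g || idn ?n) oo (idn 2 || ?A) oo (I || S || idn ?n)
    = ((g || idn ?n) oo (idn 2 || ?A)) oo (I || S || idn ?n)"
    using assms by (simp add: comp_assoc)
  also have "(g || idn ?n) oo (idn 2 || ?A) = (I || ?A) oo (g || idn (Suc ?n))"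
    using assms exchange[of g ?A 1 "Suc ?n" 2 ?n] by simp
  also have "((I || ?A) oo (g || idn (Suc ?n))) oo (I || S || idn ?n)
    = (I || ?A) oo (S || idn ?n) oo (I || g || idn ?n) oo (S || idn (Suc ?n))"
    unfolding S_binop_right_pad[OF assms(1)] using assms by (simp add: comp_assoc)
  finally show ?thesis using assms by (simp add: normalize)
qed

text \<open>Distinct labels matter: into one factor, left multiplications by different elements need
  not commute. With both strands behind the head, Yang-Baxter reorders the crossings.\<close>

lemma Act_commute:
  assumes g: "binop g" "binop g'" and "w \<noteq> w'"
  shows "\<lbrakk>w \<in> set ws; w' \<in> set ws\<rbrakk> \<Longrightarrow>
    Act g ws w oo (I || Act g' ws w') = Act g' ws w' oo (I || Act g ws w) oo (S || idn (length ws))"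
proof (induction ws)
  case (Cons x xs)
  consider "x = w" | "x = w'" | "x \<noteq> w" "x \<noteq> w'" by blast
  then show ?case
  proof cases
    case 1
    then show ?thesis using Act_commute_head[OF g, of x w' xs] Cons.prems \<open>w \<noteq> w'\<close> by simp
  next
    case 2
    then have "w \<in> set xs" using Cons.prems \<open>w \<noteq> w'\<close> by simp
    then show ?thesis
      using Act_commute_sym[OF g Cons.prems] Act_commute_head[OF g(2,1), of x w xs] 2 \<open>w \<noteq> w'\<close> by simp
  next
    case 3
    then have w: "w \<in> set xs" "w' \<in> set xs" using Cons.prems by auto
    let ?n = "length xs" and ?A = "Act g xs w" and ?B = "Act g' xs w'"
    have exA: "(S || idn ?n) oo (idn 2 || ?A) = (idn 2 || ?A) oo (S || idn (Suc ?n))"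
      and exB: "(S || idn ?n) oo (idn 2 || ?B) = (idn 2 || ?B) oo (S || idn (Suc ?n))"
      using g w exchange[of S ?A 2 "Suc ?n" 2 ?n] exchange[of S ?B 2 "Suc ?n" 2 ?n] by simp_all
    have IH: "(I || ?A) oo (idn 2 || ?B) = (I || ?B) oo (idn 2 || ?A) oo (I || S || idn ?n)"
      using arg_cong[OF Cons.IH[OF w], of "\<lambda>x. I || x"] g w by (simp add: normalize)
    have "Act g (x # xs) w oo (I || Act g' (x # xs) w')
      = (I || ?A) oo ((S || idn ?n) oo (idn 2 || ?B)) oo (I || S || idn ?n)"
      using 3 g w by (simp add: normalize)
    also have "... = ((I || ?A) oo (idn 2 || ?B)) oo (S || idn (Suc ?n)) oo (I || S || idn ?n)"
      unfolding exB using g w by (simp add: comp_assoc)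
    also have "... = (I || ?B) oo (idn 2 || ?A) oo ((I || S || idn ?n) oo (S || idn (Suc ?n)) oo (I || S || idn ?n))"
      unfolding IH using g w by (simp add: comp_assoc)
    also have "... = (I || ?B) oo ((idn 2 || ?A) oo (S || idn (Suc ?n))) oo (I || S || idn ?n) oo (S || idn (Suc ?n))"
      unfolding yang_baxter_pad[symmetric] using g w by (simp add: comp_assoc)
    also have "... = Act g' (x # xs) w' oo (I || Act g (x # xs) w) oo (S || idn (length (x # xs)))"
      unfolding exA[symmetric] using 3 g w by (simp add: normalize)
    finally show ?thesis .
  qed
qed simp

section \<open>Structure morphisms and the Nakayama automorphism\<close>

definition Mu where "Mu = Arrow 2 1 (mul F)"
definition Eta where "Eta = Arrow 0 1 (unt F)"
definition Dl where "Dl = Arrow 1 2 (comul F)"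
definition Ep where "Ep = Arrow 1 0 (counit F)"
definition Nk where "Nk = Arrow 1 1 (nakayama C F)"

abbreviation Mr where "Mr \<equiv> Mu oo S"
abbreviation Cup where "Cup \<equiv> Dl oo Eta"
abbreviation Cap where "Cap \<equiv> Ep oo Mu"

lemma src_tgt_generators [simp]:
  "src Mu = 2" "tgt Mu = 1" "src Eta = 0" "tgt Eta = 1" "src Dl = 1" "tgt Dl = 2"
  "src Ep = 1" "tgt Ep = 0" "src Nk = 1" "tgt Nk = 1"
  by (simp_all add: Mu_def Eta_def Dl_def Ep_def Nk_def)

lemma ok_generators [simp]: "ok Mu" "ok Eta" "ok Dl" "ok Ep"
  using mul_hom unt_hom comul_hom counit_hom
  by (simp_all add: ok_def Mu_def Eta_def Dl_def Ep_def pow_1 pow_2)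

lemma Nk_eq: "Nk = (Cap || I) oo (I || S) oo (I || Cup)"
  by (simp add: Nk_def nakayama_def frob_pairing_def comp_def tens_def idn_def Sw_def Mu_def Eta_def Dl_def Ep_def pow_1)

lemma ok_Nk [simp]: "ok Nk"
  by (simp add: Nk_eq)

lemma binop_Mu [simp]: "binop Mu" and binop_Mr [simp]: "binop Mr"
  by (simp_all add: binop_def)

lemma Mu_assoc: "Mu oo (Mu || I) = Mu oo (I || Mu)"
  by (simp add: comp_def tens_def idn_def Mu_def mul_assoc pow_1)

lemma Mu_Eta_left: "Mu oo (Eta || I) = I"
  by (simp add: comp_def tens_def idn_def Mu_def Eta_def mul_unt_left pow_1)

lemma Mu_Eta_right: "Mu oo (I || Eta) = I"
  by (simp add: comp_def tens_def idn_def Mu_def Eta_def mul_unt_right pow_1)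

lemma Ep_Dl_left: "(Ep || I) oo Dl = I"
  by (simp add: comp_def tens_def idn_def Dl_def Ep_def comul_counit_left pow_1)

lemma Ep_Dl_right: "(I || Ep) oo Dl = I"
  by (simp add: comp_def tens_def idn_def Dl_def Ep_def comul_counit_right pow_1)

lemma Frobenius_left: "(I || Mu) oo (Dl || I) = Dl oo Mu"
  by (simp add: comp_def tens_def idn_def Dl_def Mu_def frobenius_left pow_1)

lemma Frobenius_right: "(Mu || I) oo (I || Dl) = Dl oo Mu"
  by (simp add: comp_def tens_def idn_def Dl_def Mu_def frobenius_right pow_1)

lemma Nk_Nk [simp]: "Nk oo Nk = I"
  by (simp add: comp_def Nk_def idn_def nakayama_involutive pow_1)

lemma separable_Cup: "Mu oo Cup = Eta"
  using separable by (simp add: delta_separable_def comp_def Mu_def Dl_def Eta_def)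

lemma Nk_conv: "Mu oo (Nk || I) oo Dl = Zero 1 1"
  using nakayama_convolution
  by (simp add: convolution_def comp_def tens_def idn_def Mu_def Dl_def Nk_def Zero_def pow_1)

text \<open>Left multiplications make each strand a module over the algebra; this lets a product be
  inserted as two separate elements.\<close>

lemma Act_Mu_Mu:
  "w \<in> set ws \<Longrightarrow> Act Mu ws w oo (I || Act Mu ws w) = Act Mu ws w oo (Mu || idn (length ws))"
proof (induction ws)
  case (Cons x xs)
  let ?n = "length xs" and ?A = "Act Mu xs w"
  show ?case
  proof (cases "x = w")
    case True
    then show ?thesis
      using arg_cong[OF Mu_assoc, of "\<lambda>x. x || idn ?n"] by (simp add: normalize)
  next
    case False
    then have w: "w \<in> set xs" using Cons.prems by simp
    have ex: "(S || idn ?n) oo (idn 2 || ?A) = (idn 2 || ?A) oo (S || idn (Suc ?n))"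
      using w exchange[of S ?A 2 "Suc ?n" 2 ?n] by simp
    have IH: "(I || ?A) oo (idn 2 || ?A) = (I || ?A) oo (I || Mu || idn ?n)"
      using arg_cong[OF Cons.IH[OF w], of "\<lambda>x. I || x"] w by (simp add: normalize)
    have "Act Mu (x # xs) w oo (I || Act Mu (x # xs) w)
      = (I || ?A) oo ((S || idn ?n) oo (idn 2 || ?A)) oo (I || S || idn ?n)"
      using False w by (simp add: normalize)
    also have "... = ((I || ?A) oo (idn 2 || ?A)) oo (S || idn (Suc ?n)) oo (I || S || idn ?n)"
      unfolding ex using w by (simp add: comp_assoc)
    also have "... = (I || ?A) oo (S || idn ?n) oo (Mu || idn (Suc ?n))"
      unfolding IH S_binop_left_pad[OF binop_Mu] using w by (simp add: comp_assoc)
    finally show ?thesis using False w by (simp add: normalize)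
  qed
qed simp

lemma Act_Mu_Eta: "w \<in> set ws \<Longrightarrow> Act Mu ws w oo (Eta || idn (length ws)) = idn (length ws)"
proof (induction ws)
  case (Cons x xs)
  let ?n = "length xs" and ?A = "Act Mu xs w"
  show ?case
  proof (cases "x = w")
    case True
    then show ?thesis
      using arg_cong[OF Mu_Eta_left, of "\<lambda>x. x || idn ?n"] by (simp add: normalize)
  next
    case False
    then have w: "w \<in> set xs" using Cons.prems by simp
    have S_Eta: "S oo (Eta || I) = I || Eta"
      using Sw_natural[of Eta "I" 0 1 1 1] by simp
    have e: "(S || idn ?n) oo (Eta || idn (Suc ?n)) = I || Eta || idn ?n"
      using arg_cong[OF S_Eta, of "\<lambda>x. x || idn ?n"] by (simp add: normalize)
    have "I || (?A oo (Eta || idn ?n)) = (I || ?A) oo (I || Eta || idn ?n)"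
      using w by (simp add: normalize)
    then show ?thesis using False w e Cons.IH[OF w] by (simp add: comp_assoc idn_tens_idn)
  qed
qed simp


section \<open>Moving an insertion from one tensor factor to another\<close>

text \<open>The power of N with exponent \<open>e\<close>, which depends on the parity only as N is
  an involution.\<close>

definition Np :: "nat \<Rightarrow> 'm arrow" where
  "Np e = (if even e then I else Nk)"

lemma Np_simps [simp]: "src (Np e) = 1" "tgt (Np e) = 1" "ok (Np e)" "Np 0 = I" "Np 1 = Nk"
  by (simp_all add: Np_def)

lemma Np_add: "Np a oo Np b = Np (a + b)"
  by (simp add: Np_def)

text \<open>
  Inserting \<open>h\<close> at \<open>w\<close> by \<open>g\<close> has the same effect as inserting \<open>N\<^sup>e(h)\<close> at \<open>w'\<close> by \<open>g'\<close>, if the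
  insertions are made after (\<open>below\<close>) or before (\<open>above\<close>) applying \<open>f\<close>.
\<close>
definition below ::
    "'m arrow \<Rightarrow> 'w list \<Rightarrow> 'm arrow \<Rightarrow> 'w \<Rightarrow> 'm arrow \<Rightarrow> 'w \<Rightarrow> nat \<Rightarrow> bool" where
  "below f ws g w g' w' e \<longleftrightarrow>
     ok f \<and> tgt f = length ws \<and> binop g \<and> binop g' \<and> w \<in> set ws \<and> w' \<in> set ws \<and>
     Act g ws w oo (I || f) = Act g' ws w' oo (Np e || f)"

definition above ::
    "'m arrow \<Rightarrow> 'w list \<Rightarrow> 'm arrow \<Rightarrow> 'w \<Rightarrow> 'm arrow \<Rightarrow> 'w \<Rightarrow> nat \<Rightarrow> bool" where
  "above f ws g w g' w' e \<longleftrightarrow>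
     ok f \<and> src f = length ws \<and> binop g \<and> binop g' \<and> w \<in> set ws \<and> w' \<in> set ws \<and>
     f oo Act g ws w = f oo Act g' ws w' oo (Np e || idn (length ws))"

text \<open>The property of the connections on which sliding relies; it survives composition and
  padding by identities.\<close>

definition equivariant :: "'m arrow \<Rightarrow> 'w list \<Rightarrow> 'w list \<Rightarrow> bool" where
  "equivariant P ws vs \<longleftrightarrow>
     ok P \<and> src P = length ws \<and> tgt P = length vs \<and> set ws = set vs \<and>
     (\<forall>g. \<forall>w\<in>set ws. binop g \<longrightarrow> P oo Act g ws w = Act g vs w oo (I || P))"

lemma Np_twice [simp]: "Np e oo Np e = I"
  by (simp add: Np_def)

lemma tens_Np: "\<lbrakk>ok x; src x = 1 + n\<rbrakk> \<Longrightarrow> ok f \<Longrightarrow> tgt f = n \<Longrightarrow>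
    x oo (Np e || f) = (x oo (I || f)) oo (Np e || idn (src f))"
  by (simp add: comp_assoc tens_split_left)

text \<open>The way back costs the inverse power of N, which is the same one as N is an
  involution.\<close>

lemma below_sym: "below f ws g w g' w' e \<Longrightarrow> below f ws g' w' g w e"
proof -
  assume a: "below f ws g w g' w' e"
  then have ok: "ok f" "tgt f = length ws" "binop g" "binop g'" "w \<in> set ws" "w' \<in> set ws"
    and eq: "Act g ws w oo (I || f) = Act g' ws w' oo (Np e || f)"
    by (auto simp: below_def)
  have "Act g ws w oo (Np e || f) = (Act g ws w oo (I || f)) oo (Np e || idn (src f))"
    using ok by (simp add: tens_Np)
  also have "... = Act g' ws w' oo ((Np e || f) oo (Np e || idn (src f)))"
    unfolding eq using ok by (simp add: comp_assoc)
  also have "... = Act g' ws w' oo (I || f)"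
    using ok by (simp add: tens_comp[symmetric])
  finally show ?thesis using ok by (simp add: below_def)
qed

lemma above_sym: "above f ws g w g' w' e \<Longrightarrow> above f ws g' w' g w e"
proof -
  assume a: "above f ws g w g' w' e"
  then have ok: "ok f" "src f = length ws" "binop g" "binop g'" "w \<in> set ws" "w' \<in> set ws"
    and eq: "f oo Act g ws w = f oo Act g' ws w' oo (Np e || idn (length ws))"
    by (auto simp: above_def)
  have "f oo Act g ws w oo (Np e || idn (length ws)) = (f oo Act g ws w) oo (Np e || idn (length ws))"
    using ok by (simp add: comp_assoc)
  also have "... = f oo Act g' ws w' oo ((Np e || idn (length ws)) oo (Np e || idn (length ws)))"
    unfolding eq using ok by (simp add: comp_assoc)
  also have "... = f oo Act g' ws w'"
    using ok by (simp add: tens_comp[symmetric] idn_tens_idn)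
  finally show ?thesis using ok by (simp add: above_def)
qed

lemma below_precomp: "\<lbrakk>below f ws g w g' w' e; ok k; tgt k = src f\<rbrakk> \<Longrightarrow> below (f oo k) ws g w g' w' e"
proof -
  assume a: "below f ws g w g' w' e" and k: "ok k" "tgt k = src f"
  then have ok: "ok f" "tgt f = length ws" "binop g" "binop g'" "w \<in> set ws" "w' \<in> set ws"
    and eq: "Act g ws w oo (I || f) = Act g' ws w' oo (Np e || f)"
    by (auto simp: below_def)
  have "Act g ws w oo (I || (f oo k)) = (Act g ws w oo (I || f)) oo (I || k)"
    using ok k by (simp add: normalize)
  also have "... = Act g' ws w' oo ((Np e || f) oo (I || k))"
    unfolding eq using ok k by (simp add: comp_assoc)
  also have "... = Act g' ws w' oo (Np e || (f oo k))"
    using ok k by (simp add: tens_comp[symmetric])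
  finally show ?thesis using ok k by (simp add: below_def)
qed

lemma below_equivariant:
  assumes "below f ws g w g' w' e" and P: "equivariant P ws vs"
  shows "below (P oo f) vs g w g' w' e"
proof -
  have ok: "ok f" "tgt f = length ws" "binop g" "binop g'" "w \<in> set ws" "w' \<in> set ws"
      "ok P" "src P = length ws" "tgt P = length vs" "set vs = set ws"
    and eq: "Act g ws w oo (I || f) = Act g' ws w' oo (Np e || f)"
    and eqP: "P oo Act g ws w = Act g vs w oo (I || P)" "P oo Act g' ws w' = Act g' vs w' oo (I || P)"
    using assms by (auto simp: below_def equivariant_def)
  have "Act g vs w oo (I || (P oo f)) = (Act g vs w oo (I || P)) oo (I || f)"
    using ok by (simp add: normalize)
  also have "... = P oo (Act g ws w oo (I || f))"
    unfolding eqP[symmetric] using ok by (simp add: comp_assoc)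
  also have "... = (P oo Act g' ws w') oo (Np e || f)"
    unfolding eq using ok by (simp add: comp_assoc)
  also have "... = Act g' vs w' oo ((I || P) oo (Np e || f))"
    unfolding eqP using ok by (simp add: comp_assoc)
  also have "... = Act g' vs w' oo (Np e || (P oo f))"
    using ok by (simp add: tens_comp[symmetric])
  finally show ?thesis using ok by (simp add: below_def)
qed

lemma above_equivariant:
  assumes "above f vs g w g' w' e" and P: "equivariant P ws vs"
  shows "above (f oo P) ws g w g' w' e"
proof -
  have ok: "ok f" "src f = length vs" "binop g" "binop g'" "w \<in> set ws" "w' \<in> set ws"
      "ok P" "src P = length ws" "tgt P = length vs" "set vs = set ws"
    and eq: "f oo Act g vs w = f oo Act g' vs w' oo (Np e || idn (length vs))"
    and eqP: "P oo Act g ws w = Act g vs w oo (I || P)" "P oo Act g' ws w' = Act g' vs w' oo (I || P)"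
    using assms by (auto simp: above_def equivariant_def)
  have "(f oo P) oo Act g ws w = (f oo Act g vs w) oo (I || P)"
    using ok by (simp add: comp_assoc eqP)
  also have "... = f oo Act g' vs w' oo (Np e || idn (length vs)) oo (I || P)"
    unfolding eq using ok by (simp add: comp_assoc)
  also have "... = f oo Act g' vs w' oo (I || P) oo (Np e || idn (length ws))"
    using ok by (simp add: tens_split_left tens_split_right)
  also have "... = f oo (Act g' vs w' oo (I || P)) oo (Np e || idn (length ws))"
    using ok by (simp add: comp_assoc)
  also have "... = (f oo P) oo Act g' ws w' oo (Np e || idn (length ws))"
    unfolding eqP[symmetric] using ok by (simp add: comp_assoc)
  finally show ?thesis using ok by (simp add: above_def)
qed

lemma equivariant_Perm: "mset ws = mset vs \<Longrightarrow> equivariant (Perm ws vs) ws vs"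
  using mset_eq_setD[of ws vs] mset_eq_length[of ws vs] by (simp add: equivariant_def Perm_Act)

lemma equivariant_comp: "\<lbrakk>equivariant P us vs; equivariant Q vs ws\<rbrakk> \<Longrightarrow> equivariant (Q oo P) us ws"
proof -
  assume a: "equivariant P us vs" "equivariant Q vs ws"
  then have ok: "ok P" "src P = length us" "tgt P = length vs" "ok Q" "src Q = length vs" "tgt Q = length ws"
    "set us = set vs" "set vs = set ws"
    by (auto simp: equivariant_def)
  have "(Q oo P) oo Act g us w = Act g ws w oo (I || (Q oo P))" if g: "binop g" and w: "w \<in> set us" for g w
  proof -
    have "(Q oo P) oo Act g us w = Q oo (P oo Act g us w)"
      using ok g w by (simp add: comp_assoc)
    also have "P oo Act g us w = Act g vs w oo (I || P)"
      using a g w by (auto simp: equivariant_def)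
    also have "Q oo (Act g vs w oo (I || P)) = (Q oo Act g vs w) oo (I || P)"
      using ok g w by (simp add: comp_assoc)
    also have "Q oo Act g vs w = Act g ws w oo (I || Q)"
      using a g w by (auto simp: equivariant_def)
    finally show ?thesis using ok g w by (simp add: normalize)
  qed
  then show ?thesis using ok by (simp add: equivariant_def)
qed

lemma Act_tens_left:
  assumes "binop g" "w \<in> set xs" "ok z" "tgt z = 1" "ok f" "tgt f = length xs" "ok h" "tgt h = length ys"
  shows "Act g (xs @ ys) w oo (z || f || h) = (Act g xs w oo (z || f)) || h"
  using assms tens_comp[of "Act g xs w" "z || f" "idn (length ys)" h]
  by (simp add: Act_append_left tens_assoc)

lemma Act_tens_right:
  assumes "binop g" "w \<notin> set xs" "w \<in> set ys" "ok z" "src z = 1" "tgt z = 1"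
    and "ok f" "tgt f = length xs" "ok h" "tgt h = length ys"
  shows "Act g (xs @ ys) w oo (z || f || h) = (f || (Act g ys w oo (z || h))) oo (Sw 1 (src f) || idn (src h))"
proof -
  have sw: "Sw 1 (length xs) oo (z || f) = (f || z) oo Sw 1 (src f)"
    using Sw_natural[of z f 1 1 "src f" "length xs"] assms by simp
  have "Act g (xs @ ys) w oo (z || f || h)
    = (idn (length xs) || Act g ys w) oo ((Sw 1 (length xs) || idn (length ys)) oo ((z || f) || h))"
    using assms by (simp add: Act_append_right normalize)
  also have "(Sw 1 (length xs) || idn (length ys)) oo ((z || f) || h) = ((f || z) oo Sw 1 (src f)) || h"
    using assms by (simp add: tens_comp[symmetric] sw)
  also have "... = (f || (z || h)) oo (Sw 1 (src f) || idn (src h))"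
    using assms tens_comp[of "f || z" "Sw 1 (src f)" h "idn (src h)"] by (simp add: tens_assoc)
  also have "(idn (length xs) || Act g ys w) oo ... = (f || (Act g ys w oo (z || h))) oo (Sw 1 (src f) || idn (src h))"
    using assms tens_comp[of "idn (length xs)" f "Act g ys w" "z || h"] by (simp add: comp_assoc[symmetric])
  finally show ?thesis .
qed

lemma below_tens_left:
  assumes "below f xs g w g' w' e" "ok h" "tgt h = length ys"
  shows "below (f || h) (xs @ ys) g w g' w' e"
  using assms Act_tens_left[of g w xs "I" f h ys] Act_tens_left[of g' w' xs "Np e" f h ys]
  by (simp add: below_def)

lemma below_tens_right:
  assumes "below h ys g w g' w' e" "ok f" "tgt f = length xs" "set xs \<inter> set ys = {}"
  shows "below (f || h) (xs @ ys) g w g' w' e"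
proof -
  have "w \<notin> set xs" "w' \<notin> set xs" using assms by (auto simp: below_def)
  then show ?thesis
    using assms Act_tens_right[of g w xs ys "I" f h] Act_tens_right[of g' w' xs ys "Np e" f h]
    by (simp add: below_def)
qed

lemma above_tens_left:
  assumes "above f xs g w g' w' e" "ok h" "src h = length ys"
  shows "above (f || h) (xs @ ys) g w g' w' e"
proof -
  have ok: "ok f" "src f = length xs" "binop g" "binop g'" "w \<in> set xs" "w' \<in> set xs"
    and eq: "f oo Act g xs w = f oo Act g' xs w' oo (Np e || idn (length xs))"
    using assms by (auto simp: above_def)
  have "(f || h) oo (Act g xs w || idn (length ys)) = (f oo Act g' xs w' oo (Np e || idn (length xs))) || h"
    using ok assms(2,3) eq by (simp add: tens_comp[symmetric])
  also have "... = (f || h) oo (Act g' xs w' || idn (length ys)) oo ((Np e || idn (length xs)) || idn (length ys))"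
    using ok assms(2,3) by (simp add: tens_comp[symmetric])
  finally show ?thesis
    using ok assms(2,3) by (simp add: above_def Act_append_left tens_assoc idn_tens_idn)
qed

lemma above_tens_right:
  assumes "above h ys g w g' w' e" "ok f" "src f = length xs" "set xs \<inter> set ys = {}"
  shows "above (f || h) (xs @ ys) g w g' w' e"
proof -
  let ?n = "length xs" and ?m = "length ys"
  have ok: "ok h" "src h = ?m" "binop g" "binop g'" "w \<in> set ys" "w' \<in> set ys" "w \<notin> set xs" "w' \<notin> set xs"
    and eq: "h oo Act g ys w = h oo Act g' ys w' oo (Np e || idn ?m)"
    using assms by (auto simp: above_def)
  have sw: "Sw 1 ?n oo (Np e || idn ?n) = (idn ?n || Np e) oo Sw 1 ?n"
    using Sw_natural[of "Np e" "idn ?n" 1 1 ?n ?n] by simp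
  have "(f || h) oo (idn ?n || Act g ys w) oo (Sw 1 ?n || idn ?m)
     = (f || (h oo Act g ys w)) oo (Sw 1 ?n || idn ?m)"
    using ok assms(2,3) tens_comp[of f "idn ?n" h "Act g ys w"] by (simp add: comp_assoc[symmetric])
  also have "... = ((f || h) oo (idn ?n || Act g' ys w') oo (idn ?n || (Np e || idn ?m))) oo (Sw 1 ?n || idn ?m)"
    unfolding eq using ok assms(2,3) by (simp add: tens_comp[symmetric])
  also have "... = (f || h) oo (idn ?n || Act g' ys w') oo (((idn ?n || Np e) oo Sw 1 ?n) || idn ?m)"
    using ok assms(2,3) by (simp add: normalize)
  also have "... = (f || h) oo (idn ?n || Act g' ys w') oo (Sw 1 ?n || idn ?m) oo (Np e || idn (?n + ?m))"
    unfolding sw[symmetric] using ok assms(2,3) by (simp add: normalize)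
  finally show ?thesis
    using ok assms(2,3) by (simp add: above_def Act_append_right comp_assoc)
qed

fun Tens :: "'m arrow list \<Rightarrow> 'm arrow" where
  "Tens [] = idn 0"
| "Tens (f # fs) = f || Tens fs"

lemma ok_Tens: "(\<forall>f\<in>set fs. ok f) \<Longrightarrow> ok (Tens fs)"
  by (induction fs) auto

lemma src_tgt_Tens [simp]:
  "src (Tens fs) = sum_list (map src fs)" "tgt (Tens fs) = sum_list (map tgt fs)"
  by (induction fs) auto

lemma below_Tens:
  assumes "\<And>i. i \<in> set is \<Longrightarrow> ok (f i) \<and> tgt (f i) = length (ws i)"
    and "distinct (concat (map ws is))"
    and "i \<in> set is" "below (f i) (ws i) g w g' w' e"
  shows "below (Tens (map f is)) (concat (map ws is)) g w g' w' e"
  using assms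
proof (induction "is")
  case (Cons j js)
  have *: "ok (Tens (map f js))" "tgt (Tens (map f js)) = length (concat (map ws js))"
    using Cons.prems(1) by (auto intro!: ok_Tens simp: length_concat o_def intro!: arg_cong[of _ _ sum_list])
  show ?case
  proof (cases "i = j")
    case True
    then show ?thesis using below_tens_left[OF Cons.prems(4)[unfolded True] *] by simp
  next
    case False
    then have "below (Tens (map f js)) (concat (map ws js)) g w g' w' e"
      using Cons by auto
    then show ?thesis using Cons.prems * below_tens_right[of _ _ g w g' w' e "f j" "ws j"] by auto
  qed
qed simp

lemma above_Tens:
  assumes "\<And>i. i \<in> set is \<Longrightarrow> ok (f i) \<and> src (f i) = length (ws i)"
    and "distinct (concat (map ws is))"
    and "i \<in> set is" "above (f i) (ws i) g w g' w' e"
  shows "above (Tens (map f is)) (concat (map ws is)) g w g' w' e"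
  using assms
proof (induction "is")
  case (Cons j js)
  have *: "ok (Tens (map f js))" "src (Tens (map f js)) = length (concat (map ws js))"
    using Cons.prems(1) by (auto intro!: ok_Tens simp: length_concat o_def intro!: arg_cong[of _ _ sum_list])
  show ?case
  proof (cases "i = j")
    case True
    then show ?thesis using above_tens_left[OF Cons.prems(4)[unfolded True] *] by simp
  next
    case False
    then have "above (Tens (map f js)) (concat (map ws js)) g w g' w' e"
      using Cons by auto
    then show ?thesis using Cons.prems * above_tens_right[of _ _ g w g' w' e "f j" "ws j"] by auto
  qed
qed simp


lemma Suc_0_one [simp]: "Suc 0 = 1"
  by (simp add: One_nat_def)

section \<open>Insertions at edges, triangles and boundary components\<close>

text \<open>Frobenius relation, unit and counit together: the pairing and the copairing are dual to
  each other.\<close>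

lemma snake_left: "(Cap || I) oo (I || Cup) = I"
proof -
  have "(Cap || I) oo (I || Cup) = (Ep || I) oo ((Mu || I) oo (I || Dl)) oo (I || Eta)"
    by (simp add: normalize)
  also have "... = ((Ep || I) oo Dl) oo (Mu oo (I || Eta))"
    unfolding Frobenius_right by (simp add: comp_assoc)
  finally show ?thesis by (simp add: Ep_Dl_left Mu_Eta_right)
qed

lemma snake_right: "(I || Cap) oo (Cup || I) = I"
proof -
  have "(I || Cap) oo (Cup || I) = (I || Ep) oo ((I || Mu) oo (Dl || I)) oo (Eta || I)"
    by (simp add: normalize)
  also have "... = ((I || Ep) oo Dl) oo (Mu oo (Eta || I))"
    unfolding Frobenius_left by (simp add: comp_assoc)
  finally show ?thesis by (simp add: Ep_Dl_right Mu_Eta_left)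
qed

lemma Sw_1_2: "Sw 1 2 = (I || S) oo (S || I)"
  using Sw_add_right[of 1 1 1] by (simp add: one_add_one)

lemma Sw_2_1: "Sw 2 1 = (S || I) oo (I || S)"
  using Sw_add_left[of 1 1 1] by (simp add: one_add_one)

lemma S_natural: "\<lbrakk>ok f; ok g; src f = 1; tgt f = 1; src g = 1; tgt g = 1\<rbrakk> \<Longrightarrow> S oo (f || g) = (g || f) oo S"
  using Sw_natural[of f g 1 1 1 1] by simp

lemma Cap_Mu: "Cap oo (I || Mu) = Cap oo (Mu || I)"
  by (simp add: comp_assoc Mu_assoc)

text \<open>By definition N(y) is \<Sum> b(y, q) p for the copairing \<Sum>p \<otimes> q, and a
  zigzag turns \<Sum> b(x, p) q back into x. So N measures the asymmetry of the pairing.\<close>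

lemma Cap_Nk_right: "Cap oo (I || Nk) = Cap oo S"
proof -
  have r: "I || Cap = (Cap || I) oo (I || S) oo (S || I)"
    using Sw_natural[of "I" Cap 1 1 2 0] by (simp add: Sw_1_2)
  have l: "Cap || I = (I || Cap) oo (S || I) oo (I || S)"
    using Sw_natural[of Cap "I" 2 0 1 1] by (simp add: Sw_2_1)
  have r': "(I || Cap) || I = (Cap || idn 2) oo (I || S || I) oo (S || idn 2)"
    unfolding r by (simp add: normalize)
  have l': "I || (Cap || I) = (idn 2 || Cap) oo (I || S || I) oo (idn 2 || S)"
    unfolding l by (simp add: normalize)
  have "Cap oo (I || Nk) = Cap oo (I || (Cap || I)) oo (idn 2 || S) oo (idn 2 || Cup)"
    by (simp add: Nk_eq normalize)
  also have "... = (Cap oo (idn 2 || Cap)) oo (I || S || I) oo (idn 2 || (S oo S)) oo (idn 2 || Cup)"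
    unfolding l' by (simp add: normalize del: Sw_Sw)
  also have "... = (Cap oo (Cap || idn 2)) oo (I || S || I) oo ((S oo S) || idn 2) oo (idn 2 || Cup)"
    using tens_split_left[of Cap Cap 0 2] tens_split_right[of Cap Cap 2 0] by (simp add: idn_tens_idn)
  also have "... = Cap oo ((I || Cap) || I) oo (S || idn 2) oo (idn 2 || Cup)"
    unfolding r' by (simp add: normalize del: Sw_Sw)
  also have "(S || idn 2) oo (idn 2 || Cup) = (idn 2 || Cup) oo S"
    using exchange[of S Cup 2 0 2 2] by simp
  also have "Cap oo ((I || Cap) || I) oo (idn 2 || Cup) oo S
     = Cap oo (I || ((Cap || I) oo (I || Cup))) oo S"
    by (simp add: normalize)
  finally show ?thesis by (simp add: snake_left idn_tens_idn)
qed

text \<open>Using the preceding rule twice, N preserves b; then N moves from one argument to the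
  other because it is an involution.\<close>

lemma Cap_Nk_left: "Cap oo (Nk || I) = Cap oo S"
proof -
  have NN: "Cap oo (Nk || Nk) = Cap"
  proof -
    have "Cap oo (Nk || Nk) = (Cap oo (I || Nk)) oo (Nk || I)"
      by (simp add: comp_assoc tens_split_left)
    also have "... = Cap oo (S oo (Nk || I))"
      unfolding Cap_Nk_right by (simp add: comp_assoc)
    also have "... = (Cap oo (I || Nk)) oo S"
      by (simp add: S_natural comp_assoc)
    finally show ?thesis unfolding Cap_Nk_right by (simp add: comp_assoc idn_tens_idn)
  qed
  have "Cap oo (Nk || I) = (Cap oo (Nk || Nk)) oo (I || Nk)"
    using tens_comp[of Nk "I" Nk Nk] by (simp add: comp_assoc)
  then show ?thesis unfolding NN Cap_Nk_right .
qed

lemma Cup_Nk_right: "(I || Nk) oo Cup = S oo Cup"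
proof -
  have "(I || Nk) oo Cup = (I || Cap || I) oo (idn 2 || S) oo ((idn 2 || Cup) oo Cup)"
    by (simp add: Nk_eq normalize)
  also have "(idn 2 || Cup) oo Cup = (Cup || idn 2) oo Cup"
    using tens_split_left[of Cup Cup 2 0] tens_split_right[of Cup Cup 0 2] by simp
  also have "(I || Cap || I) oo (idn 2 || S) oo ... = (I || Cap || I) oo ((idn 2 || S) oo (Cup || idn 2)) oo Cup"
    by (simp add: comp_assoc)
  also have "(idn 2 || S) oo (Cup || idn 2) = (Cup || idn 2) oo S"
    using exchange[of Cup S 2 2 0 2] by simp
  also have "(I || Cap || I) oo ((Cup || idn 2) oo S) oo Cup
     = (((I || Cap) oo (Cup || I)) || I) oo S oo Cup"
    by (simp add: normalize)
  finally show ?thesis by (simp add: snake_right idn_tens_idn)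
qed

lemma S_Cup: "(Nk || I) oo S oo Cup = Cup"
proof -
  have "S oo (I || Nk) oo Cup = S oo S oo Cup"
    unfolding Cup_Nk_right ..
  then have "(S oo (I || Nk)) oo Cup = (S oo S) oo Cup"
    by (simp add: comp_assoc del: Sw_Sw)
  then show ?thesis by (simp add: S_natural comp_assoc)
qed

lemma Cap_nondegenerate:
  assumes "ok f" "ok g" "tgt f = 1" "tgt g = 1" "src g = src f" "Cap oo (I || f) = Cap oo (I || g)"
  shows "f = g"
proof -
  have *: "h = (I || (Cap oo (I || h))) oo (Cup || idn (src h))" if "ok h" "tgt h = 1" for h
  proof -
    have "h = ((I || Cap) oo (Cup || I)) oo h"
      using that by (simp add: snake_right)
    also have "... = (I || Cap) oo ((Cup || I) oo h)"
      using that by (simp add: comp_assoc)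
    also have "(Cup || I) oo h = (idn 2 || h) oo (Cup || idn (src h))"
      using that exchange[of Cup h 2 "src h" 0 1] by simp
    finally show ?thesis using that by (simp add: normalize)
  qed
  show ?thesis using *[of f] *[of g] assms by simp
qed

text \<open>Cyclic rotation under the pairing: b(x, N(y) N(z)) = b(x N(y), N(z)) = b(z, x N(y)) =
  b(z x, N(y)) = b(y, z x) = b(y z, x) = b(x, N(y z)). Then nondegeneracy.\<close>

lemma Nk_Mu: "Nk oo Mu = Mu oo (Nk || Nk)"
proof (rule Cap_nondegenerate)
  have "Cap oo (I || (Mu oo (Nk || Nk))) = (Cap oo (I || Mu)) oo (I || Nk || Nk)"
    by (simp add: normalize)
  also have "... = Cap oo ((Mu oo (I || Nk)) || Nk)"
    unfolding Cap_Mu using tens_comp[of Mu "I || Nk" "I" Nk] by (simp add: comp_assoc tens_assoc)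
  also have "... = (Cap oo (I || Nk)) oo ((Mu oo (I || Nk)) || I)"
    by (simp add: comp_assoc tens_split_left)
  also have "... = Cap oo (S oo ((Mu oo (I || Nk)) || I))"
    unfolding Cap_Nk_right by (simp add: comp_assoc)
  also have "S oo ((Mu oo (I || Nk)) || I) = (I || (Mu oo (I || Nk))) oo Sw 2 1"
    using Sw_natural[of "Mu oo (I || Nk)" "I" 2 1 1 1] by simp
  also have "Cap oo ... = (Cap oo (I || Mu)) oo (idn 2 || Nk) oo Sw 2 1"
    by (simp add: normalize)
  also have "... = Cap oo ((Mu || I) oo (idn 2 || Nk)) oo Sw 2 1"
    unfolding Cap_Mu by (simp add: comp_assoc)
  also have "(Mu || I) oo (idn 2 || Nk) = (I || Nk) oo (Mu || I)"
    using exchange[of Mu Nk 1 1 2 1] by simp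
  also have "Cap oo ((I || Nk) oo (Mu || I)) oo Sw 2 1 = (Cap oo (I || Nk)) oo (Mu || I) oo Sw 2 1"
    by (simp add: comp_assoc)
  also have "... = Cap oo (S oo (Mu || I)) oo Sw 2 1"
    unfolding Cap_Nk_right by (simp add: comp_assoc)
  also have "S oo (Mu || I) = (I || Mu) oo Sw 2 1"
    using Sw_natural[of Mu "I" 2 1 1 1] by simp
  also have "Cap oo ((I || Mu) oo Sw 2 1) oo Sw 2 1 = Cap oo (I || Mu) oo Sw 2 1 oo Sw 2 1"
    by (simp add: comp_assoc)
  \<comment> \<open>Two cyclic rotations of three strands are one rotation backwards.\<close>
  also have "Sw 2 1 oo Sw 2 1 = ((S || I) oo (I || S) oo (S || I)) oo (I || S)"
    by (simp add: Sw_2_1 comp_assoc)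
  also have "... = (I || S) oo (S || I) oo (I || (S oo S))"
    unfolding yang_baxter by (simp add: normalize del: Sw_Sw)
  also have "... = Sw 1 2"
    by (simp add: Sw_1_2 idn_tens_idn)
  also have "Cap oo (I || Mu) oo Sw 1 2 = (Cap oo (I || Mu)) oo Sw 1 2"
    by (simp add: comp_assoc)
  also have "... = Cap oo ((Mu || I) oo Sw 1 2)"
    unfolding Cap_Mu by (simp add: comp_assoc)
  also have "(Mu || I) oo Sw 1 2 = S oo (I || Mu)"
    using Sw_natural[of "I" Mu 1 1 2 1] by simp
  also have "Cap oo (S oo (I || Mu)) = (Cap oo S) oo (I || Mu)"
    by (simp add: comp_assoc)
  also have "... = Cap oo (I || (Nk oo Mu))"
    unfolding Cap_Nk_right[symmetric] by (simp add: normalize)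
  finally show "Cap oo (I || (Nk oo Mu)) = Cap oo (I || (Mu oo (Nk || Nk)))" ..
qed simp_all

lemma Mr_Nk: "Mr oo (I || Nk) = Nk oo Mr oo (Nk || I)"
proof -
  have "Nk oo Mr oo (Nk || I) = (Nk oo Mu) oo (S oo (Nk || I))"
    by (simp add: comp_assoc)
  also have "... = Mu oo ((Nk || Nk) oo (I || Nk)) oo S"
    by (simp add: Nk_Mu S_natural comp_assoc)
  also have "(Nk || Nk) oo (I || Nk) = Nk || I"
    by (simp add: tens_comp[symmetric])
  finally show ?thesis by (simp add: S_natural comp_assoc)
qed

lemma S_eq_Perm: "l \<noteq> r \<Longrightarrow> S = Perm [r, l] [l, r]"
  by (simp add: Perm_Cons Perm_Nil idn_tens_idn)

lemma equivariant_S: "l \<noteq> r \<Longrightarrow> equivariant S [r, l] [l, r]"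
  using equivariant_Perm[of "[r, l]" "[l, r]"] S_eq_Perm[of l r] by simp

section \<open>Moves at edge copairings\<close>

text \<open>Both \<Sum>hp \<otimes> q and \<Sum>p \<otimes> qh are \<Delta>(h), by the two Frobenius
  relations.\<close>

lemma below_Cup:
  assumes "l \<noteq> r"
  shows "below Cup [l, r] Mu l Mr r 0"
proof -
  have "(Mu || I) oo (I || Cup) = ((Mu || I) oo (I || Dl)) oo (I || Eta)"
    by (simp add: normalize)
  also have "... = Dl"
    unfolding Frobenius_right by (simp add: comp_assoc Mu_Eta_right)
  finally have 1: "(Mu || I) oo (I || Cup) = Dl" .
  have "((I || Mr) oo (S || I)) oo (I || Cup) = (I || Mu) oo (Sw 1 2 oo (I || Cup))"
    by (simp add: Sw_1_2 normalize)
  also have "Sw 1 2 oo (I || Cup) = Cup || I"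
    using Sw_natural[of "I" Cup 1 1 0 2] by simp
  also have "(I || Mu) oo (Cup || I) = ((I || Mu) oo (Dl || I)) oo (Eta || I)"
    by (simp add: normalize)
  also have "... = Dl"
    unfolding Frobenius_left by (simp add: comp_assoc Mu_Eta_left)
  finally show ?thesis using assms 1 by (simp add: below_def)
qed

lemma below_S_Cup:
  assumes "l \<noteq> r"
  shows "below (S oo Cup) [l, r] Mr l Mu r 0"
  using below_sym[OF below_equivariant[OF below_Cup[of r l] equivariant_S[of l r]]] assms by simp

text \<open>With the copairing written as \<Sum>N(q) \<otimes> p, the factor N(q) h equals N(q
  N(h)), and inside N the untwisted move applies to N(h).\<close>

lemma below_Cup_twisted:
  assumes "l \<noteq> r"
  shows "below Cup [l, r] Mr l Mu r 1"
proof -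
  have e: "(Mr || I) oo (I || (S oo Cup)) = ((I || Mu) oo (S || I)) oo (I || (S oo Cup))"
    using below_S_Cup[OF assms] assms by (simp add: below_def)
  have "(Mr || I) oo (I || Cup) = (Mr || I) oo (I || ((Nk || I) oo S oo Cup))"
    by (simp add: S_Cup)
  also have "... = ((Mr oo (I || Nk)) || I) oo (I || (S oo Cup))"
    by (simp add: normalize)
  also have "... = (Nk || I) oo (Mr || I) oo ((Nk || idn 2) oo (I || (S oo Cup)))"
    unfolding Mr_Nk by (simp add: normalize)
  also have "(Nk || idn 2) oo (I || (S oo Cup)) = (I || (S oo Cup)) oo Nk"
    using tens_split_left[of Nk "S oo Cup" 1 0] tens_split_right[of Nk "S oo Cup" 1 2] by simp
  also have "(Nk || I) oo (Mr || I) oo ((I || (S oo Cup)) oo Nk)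
     = (Nk || I) oo ((Mr || I) oo (I || (S oo Cup))) oo Nk"
    by (simp add: comp_assoc)
  also have "... = ((Nk || I) oo (I || Mu)) oo (S || I) oo (I || (S oo Cup)) oo Nk"
    unfolding e by (simp add: comp_assoc)
  also have "(Nk || I) oo (I || Mu) = (I || Mu) oo (Nk || idn 2)"
    using exchange[of Nk Mu 1 2 1 1] by simp
  also have "((I || Mu) oo (Nk || idn 2)) oo (S || I) oo (I || (S oo Cup)) oo Nk
     = (I || Mu) oo (((Nk || I) oo S) || I) oo (I || (S oo Cup)) oo Nk"
    by (simp add: normalize)
  also have "(Nk || I) oo S = S oo (I || Nk)"
    by (simp add: S_natural)
  also have "(I || Mu) oo ((S oo (I || Nk)) || I) oo (I || (S oo Cup)) oo Nk
     = (I || Mu) oo (S || I) oo (I || ((Nk || I) oo S oo Cup)) oo Nk"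
    by (simp add: normalize)
  also have "... = (I || Mu) oo (S || I) oo (Nk || Cup)"
    unfolding S_Cup using tens_split_left[of Nk Cup 1 0] by simp
  finally show ?thesis using assms by (simp add: below_def comp_assoc)
qed


section \<open>Moves at the coproduct and centrality of the image of P\<close>

text \<open>Reduced to the copairing by \<Delta>(x) = \<Sum>p \<otimes> qx: what arrives on the
  second leg from the left does not meet the x on the right.\<close>

lemma below_Dl:
  assumes "l \<noteq> r"
  shows "below Dl [l, r] Mr l Mu r 1"
proof -
  have Dl: "Dl = (I || Mu) oo (Cup || I)"
  proof -
    have "(I || Mu) oo (Cup || I) = ((I || Mu) oo (Dl || I)) oo (Eta || I)"
      by (simp add: normalize)
    then show ?thesis
      unfolding Frobenius_left by (simp add: comp_assoc Mu_Eta_left)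
  qed
  have e: "(Mr || I) oo (I || Cup) = (I || Mu) oo (S || I) oo (Nk || Cup)"
    using below_Cup_twisted[OF assms] assms by (simp add: below_def comp_assoc)
  have "(Mr || I) oo (I || Dl) = ((Mr || I) oo (idn 2 || Mu)) oo (I || (Cup || I))"
    by (subst Dl) (simp add: normalize)
  also have "(Mr || I) oo (idn 2 || Mu) = (I || Mu) oo (Mr || idn 2)"
    using exchange[of Mr Mu 1 2 2 1] by simp
  also have "((I || Mu) oo (Mr || idn 2)) oo (I || (Cup || I))
    = (I || Mu) oo (((Mr || I) oo (I || Cup)) || I)"
    by (simp add: normalize)
  also have "... = (I || (Mu oo (Mu || I))) oo (S || idn 2) oo (Nk || Cup || I)"
    unfolding e by (simp add: normalize)
  also have "... = (I || Mu) oo ((idn 2 || Mu) oo (S || idn 2)) oo (Nk || Cup || I)"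
    unfolding Mu_assoc by (simp add: normalize)
  also have "(idn 2 || Mu) oo (S || idn 2) = (S || I) oo (idn 2 || Mu)"
    using exchange[of S Mu 2 2 2 1] by simp
  also have "(I || Mu) oo ((S || I) oo (idn 2 || Mu)) oo (Nk || Cup || I)
     = (I || Mu) oo (S || I) oo ((I || (I || Mu)) oo (Nk || (Cup || I)))"
    by (simp add: normalize)
  also have "(I || (I || Mu)) oo (Nk || (Cup || I)) = Nk || Dl"
    using tens_comp[of "I" Nk "I || Mu" "Cup || I"] by (simp add: Dl[symmetric])
  finally show ?thesis using assms by (simp add: below_def comp_assoc)
qed

definition Dl3 where "Dl3 = (I || Dl) oo Dl"

lemma Dl3_typing [simp]: "ok Dl3" "src Dl3 = 1" "tgt Dl3 = 3"
  by (simp_all add: Dl3_def)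

lemma below_Dl3_first:
  assumes "distinct [x, y, z]"
  shows "below Dl3 [x, y, z] Mr x Mu y 1"
proof -
  have e: "(Mr || I) oo (I || Dl) = (I || Mu) oo (S || I) oo (Nk || Dl)"
    using below_Dl[of x y] assms by (simp add: below_def comp_assoc)
  have "(Mr || idn 2) oo (I || Dl3) = ((Mr || idn 2) oo (idn 2 || Dl)) oo (I || Dl)"
    by (simp add: Dl3_def normalize)
  also have "(Mr || idn 2) oo (idn 2 || Dl) = (I || Dl) oo (Mr || I)"
    using exchange[of Mr Dl 1 1 2 2] by simp
  also have "((I || Dl) oo (Mr || I)) oo (I || Dl) = (I || Dl) oo ((Mr || I) oo (I || Dl))"
    by (simp add: comp_assoc)
  also have "... = (I || (Dl oo Mu)) oo (S || I) oo (Nk || Dl)"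
    unfolding e by (simp add: normalize)
  also have "... = (I || Mu || I) oo ((idn 2 || Dl) oo (S || I)) oo (Nk || Dl)"
    unfolding Frobenius_right[symmetric] by (simp add: normalize)
  also have "(idn 2 || Dl) oo (S || I) = (S || idn 2) oo (idn 2 || Dl)"
    using exchange[of S Dl 2 1 2 2] by simp
  also have "(I || Mu || I) oo ((S || idn 2) oo (idn 2 || Dl)) oo (Nk || Dl)
    = (I || Mu || I) oo (S || idn 2) oo ((I || (I || Dl)) oo (Nk || Dl))"
    by (simp add: normalize)
  also have "(I || (I || Dl)) oo (Nk || Dl) = Nk || Dl3"
    by (simp add: tens_comp[symmetric] Dl3_def)
  finally show ?thesis using assms by (simp add: below_def comp_assoc)
qed

lemma below_Dl3_second:
  assumes "distinct [x, y, z]"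
  shows "below Dl3 [x, y, z] Mr y Mu z 1"
  unfolding Dl3_def
  using below_precomp[OF below_tens_right[OF below_Dl[of y z], of "I" "[x]"], of Dl] assms by auto

lemma Dl3_Mu: "(Mu || idn 2) oo (I || Dl3) = Dl3 oo Mu"
proof -
  have "(Mu || idn 2) oo (I || Dl3) = ((Mu || idn 2) oo (idn 2 || Dl)) oo (I || Dl)"
    by (simp add: Dl3_def normalize)
  also have "(Mu || idn 2) oo (idn 2 || Dl) = (I || Dl) oo (Mu || I)"
    using exchange[of Mu Dl 1 1 2 2] by simp
  also have "((I || Dl) oo (Mu || I)) oo (I || Dl) = (I || Dl) oo ((Mu || I) oo (I || Dl))"
    by (simp add: comp_assoc)
  finally show ?thesis unfolding Frobenius_right by (simp add: Dl3_def comp_assoc)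
qed

lemma Dl3_Mr: "((idn 2 || Mr) oo (I || S || I) oo (S || idn 2)) oo (I || Dl3) = Dl3 oo Mr"
proof -
  have "Sw 1 3 = (I || Sw 1 2) oo (S || idn 2)"
    using Sw_add_right[of 1 1 2] by simp
  then have sw: "Sw 1 3 = (idn 2 || S) oo (I || S || I) oo (S || idn 2)"
    by (simp add: Sw_1_2 normalize)
  have "((idn 2 || Mr) oo (I || S || I) oo (S || idn 2)) oo (I || Dl3)
     = (idn 2 || Mu) oo (Sw 1 3 oo (I || Dl3))"
    by (simp add: sw normalize)
  also have "Sw 1 3 oo (I || Dl3) = (Dl3 || I) oo S"
    using Sw_natural[of "I" Dl3 1 1 1 3] by simp
  also have "(idn 2 || Mu) oo ((Dl3 || I) oo S)
     = ((idn 2 || Mu) oo ((I || Dl) || I)) oo (Dl || I) oo S"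
    by (simp add: Dl3_def normalize)
  also have "(idn 2 || Mu) oo ((I || Dl) || I) = I || ((I || Mu) oo (Dl || I))"
    by (simp add: normalize)
  also have "... = (I || Dl) oo (I || Mu)"
    unfolding Frobenius_left by (simp add: normalize)
  also have "((I || Dl) oo (I || Mu)) oo (Dl || I) oo S
     = (I || Dl) oo ((I || Mu) oo (Dl || I)) oo S"
    by (simp add: comp_assoc)
  finally show ?thesis unfolding Frobenius_left by (simp add: Dl3_def comp_assoc)
qed

text \<open>The iterated coproduct is a bimodule map: h on the right of the last leg and h on the
  left of the first leg come out as multiplications of its argument. Moving h between these legs
  thus amounts to commuting it with the image of \<open>P\<close>.\<close>

lemma below_Dl3_third:
  assumes "distinct [x, y, z]" and P: "ok P" "src P = 1" "tgt P = 1" "Mr oo (I || P) = Mu oo (Np e || P)"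
  shows "below (Dl3 oo P) [x, y, z] Mr z Mu x e"
proof -
  let ?R = "(idn 2 || Mr) oo (I || S || I) oo (S || idn 2)"
  have "?R oo (I || (Dl3 oo P)) = (?R oo (I || Dl3)) oo (I || P)"
    using P by (simp add: normalize)
  also have "... = Dl3 oo (Mr oo (I || P))"
    unfolding Dl3_Mr using P by (simp add: comp_assoc)
  also have "... = (Dl3 oo Mu) oo (Np e || P)"
    unfolding P(4) using P by (simp add: comp_assoc)
  also have "... = (Mu || idn 2) oo ((I || Dl3) oo (Np e || P))"
    unfolding Dl3_Mu[symmetric] using P by (simp add: comp_assoc)
  also have "... = (Mu || idn 2) oo (Np e || (Dl3 oo P))"
    using P by (simp add: tens_comp[symmetric])
  finally show ?thesis using assms by (simp add: below_def normalize)
qed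

lemma Mr_Mr: "Mr oo (I || Mr) = Mr oo (Mr || I)"
proof -
  have "Mr oo (I || Mr) = Mu oo (S oo (I || Mr))"
    by (simp add: comp_assoc)
  also have "S oo (I || Mr) = (Mr || I) oo Sw 1 2"
    using Sw_natural[of "I" Mr 1 1 2 1] by simp
  also have "Mu oo ((Mr || I) oo Sw 1 2) = (Mu oo (Mu || I)) oo (S || I) oo (I || S) oo (S || I)"
    by (simp add: Sw_1_2 normalize)
  also have "... = Mu oo ((I || Mu) oo Sw 2 1) oo (S || I)"
    unfolding Mu_assoc by (simp add: Sw_2_1 normalize)
  also have "(I || Mu) oo Sw 2 1 = S oo (Mu || I)"
    using Sw_natural[of Mu "I" 2 1 1 1] by simp
  finally show ?thesis by (simp add: normalize)
qed

lemma Mr_Mu: "Mr oo (I || Mu) oo (S || I) = Mu oo (I || Mr)"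
proof -
  have "Mr oo (I || Mu) oo (S || I) = Mu oo (S oo (I || Mu)) oo (S || I)"
    by (simp add: comp_assoc)
  also have "S oo (I || Mu) = (Mu || I) oo Sw 1 2"
    using Sw_natural[of "I" Mu 1 1 2 1] by simp
  also have "Mu oo ((Mu || I) oo Sw 1 2) oo (S || I)
     = (Mu oo (Mu || I)) oo (I || S) oo ((S oo S) || I)"
    by (simp add: Sw_1_2 normalize del: Sw_Sw)
  also have "... = Mu oo (I || Mr)"
    unfolding Mu_assoc by (simp add: normalize)
  finally show ?thesis .
qed

lemma Dl_twisted: "(Mr || I) oo (I || Dl) = (I || Mu) oo (S || I) oo (Nk || Dl)"
  using below_Dl[of False True] by (simp add: below_def comp_assoc)

fun Projector :: "boundary_type \<Rightarrow> 'm arrow" where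
  "Projector type_NS = Mr oo (Nk || I) oo Dl"
| "Projector type_R = Mr oo Dl"

lemma Projector_typing [simp]:
  "ok (Projector \<delta>)" "src (Projector \<delta>) = 1" "tgt (Projector \<delta>) = 1"
  by (cases \<delta>; simp)+

text \<open>For \<Delta>(a) = \<Sum>a' \<otimes> a'', the coproduct move reads \<Sum>a' h \<otimes>
  a'' = \<Sum>a' \<otimes> N(h) a''; multiplying in opposite order gives \<Sum>a'' a' h = N(h)
  \<Sum>a'' a'.\<close>

lemma Projector_R:
  "Mr oo (I || Projector type_R) = Mu oo (Nk || Projector type_R)"
proof -
  have "Mr oo (I || (Mr oo Dl)) = (Mr oo (I || Mr)) oo (I || Dl)"
    by (simp add: normalize)
  also have "... = Mr oo ((Mr || I) oo (I || Dl))"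
    unfolding Mr_Mr by (simp add: comp_assoc)
  also have "... = (Mr oo (I || Mu) oo (S || I)) oo (Nk || Dl)"
    unfolding Dl_twisted by (simp add: comp_assoc)
  also have "... = Mu oo ((I || Mr) oo (Nk || Dl))"
    unfolding Mr_Mu by (simp add: comp_assoc)
  finally show ?thesis by (simp add: tens_comp[symmetric])
qed

text \<open>The same computation with N(a'): since N(a') h = N(a' N(h)), the twist is applied twice
  to h and cancels.\<close>

lemma Projector_NS:
  "Mr oo (I || Projector type_NS) = Mu oo (I || Projector type_NS)"
proof -
  have "Mr oo (I || (Mr oo (Nk || I) oo Dl)) = (Mr oo (I || Mr)) oo (I || Nk || I) oo (I || Dl)"
    by (simp add: normalize)
  also have "... = Mr oo ((Mr oo (I || Nk)) || I) oo (I || Dl)"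
    unfolding Mr_Mr by (simp add: normalize)
  also have "... = Mr oo (Nk || I) oo (Mr || I) oo ((Nk || idn 2) oo (I || Dl))"
    unfolding Mr_Nk by (simp add: normalize)
  also have "(Nk || idn 2) oo (I || Dl) = (I || Dl) oo (Nk || I)"
    using exchange[of Nk Dl 1 1 1 2] by simp
  also have "Mr oo (Nk || I) oo (Mr || I) oo ((I || Dl) oo (Nk || I))
     = Mr oo (Nk || I) oo ((Mr || I) oo (I || Dl)) oo (Nk || I)"
    by (simp add: comp_assoc)
  also have "... = Mr oo ((Nk || I) oo (I || Mu)) oo (S || I) oo ((Nk || Dl) oo (Nk || I))"
    unfolding Dl_twisted by (simp add: comp_assoc)
  also have "(Nk || Dl) oo (Nk || I) = I || Dl"
    using tens_comp[of Nk Nk Dl "I"] by simp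
  also have "(Nk || I) oo (I || Mu) = (I || Mu) oo (Nk || idn 2)"
    using exchange[of Nk Mu 1 2 1 1] by simp
  also have "Mr oo ((I || Mu) oo (Nk || idn 2)) oo (S || I) oo (I || Dl)
     = Mr oo (I || Mu) oo (((Nk || I) oo S) || I) oo (I || Dl)"
    by (simp add: normalize)
  also have "(Nk || I) oo S = S oo (I || Nk)"
    by (simp add: S_natural)
  also have "Mr oo (I || Mu) oo ((S oo (I || Nk)) || I) oo (I || Dl)
     = (Mr oo (I || Mu) oo (S || I)) oo (I || Nk || I) oo (I || Dl)"
    by (simp add: normalize)
  also have "... = Mu oo (I || (Mr oo (Nk || I) oo Dl))"
    unfolding Mr_Mu by (simp add: normalize)
  finally show ?thesis by simp
qed

lemma Projector_central:
  "Mr oo (I || Projector \<delta>) = Mu oo (Np (if \<delta> = type_R then 1 else 0) || Projector \<delta>)"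
  using Projector_R Projector_NS by (cases \<delta>) simp_all

section \<open>Moves at triangle forms and pairings\<close>

definition Tri where "Tri = Cap oo (Mu || I)"

lemma Tri_typing [simp]: "ok Tri" "src Tri = 3" "tgt Tri = 0"
  by (simp_all add: Tri_def)

lemma Mu_Mr: "Mu oo (Mr || I) = Mu oo (I || Mu) oo (S || I)"
proof -
  have "Mu oo (Mr || I) = (Mu oo (Mu || I)) oo (S || I)"
    by (simp add: normalize)
  then show ?thesis unfolding Mu_assoc by (simp add: comp_assoc)
qed

lemma above_Tri_first:
  assumes "distinct [x, y, z]"
  shows "above Tri [x, y, z] Mr x Mu y 0"
proof -
  have "Tri oo (Mr || idn 2) = Cap oo ((Mu oo (Mr || I)) || I)"
    by (simp add: Tri_def normalize)
  also have "... = Tri oo (I || Mu || I) oo (S || idn 2)"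
    unfolding Mu_Mr by (simp add: Tri_def normalize)
  finally show ?thesis using assms by (simp add: above_def idn_tens_idn)
qed

lemma above_Tri_second:
  assumes "distinct [x, y, z]"
  shows "above Tri [x, y, z] Mr y Mu z 0"
proof -
  have "Tri oo (I || Mr || I) oo (S || idn 2) = Cap oo (I || (Mu oo (Mr || I))) oo (S || idn 2)"
    by (simp add: Tri_def Cap_Mu[symmetric] normalize del: Sw_Sw)
  also have "... = (Cap oo (I || Mu)) oo (idn 2 || Mu) oo (I || S || I) oo (S || idn 2)"
    unfolding Mu_Mr by (simp add: normalize)
  also have "... = Tri oo (idn 2 || Mu) oo (I || S || I) oo (S || idn 2)"
    unfolding Cap_Mu Tri_def by (simp add: normalize)
  finally show ?thesis using assms by (simp add: above_def normalize)
qed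

text \<open>At the other two corners associativity suffices. Here h goes from the end of the product
  to its front, and b(x, h) = b(N(h), x).\<close>

lemma above_Tri_third:
  assumes "distinct [x, y, z]"
  shows "above Tri [x, y, z] Mr z Mu x 1"
proof -
  let ?M = "Mu oo (Mu || I)"
  have "Sw 1 3 = (I || Sw 1 2) oo (S || idn 2)"
    using Sw_add_right[of 1 1 2] by simp
  then have sw: "Sw 1 3 = (idn 2 || S) oo (I || S || I) oo (S || idn 2)"
    by (simp add: Sw_1_2 normalize)
  have "Tri oo (idn 2 || Mr) oo (I || S || I) oo (S || idn 2) = Cap oo ((Mu || I) oo (idn 2 || Mu)) oo Sw 1 3"
    by (simp add: sw Tri_def normalize)
  also have "(Mu || I) oo (idn 2 || Mu) = (I || Mu) oo (Mu || idn 2)"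
    using exchange[of Mu Mu 1 2 2 1] by simp
  also have "Cap oo ((I || Mu) oo (Mu || idn 2)) oo Sw 1 3 = (Cap oo (I || Mu)) oo (Mu || idn 2) oo Sw 1 3"
    by (simp add: comp_assoc)
  also have "... = Cap oo ((?M || I) oo Sw 1 3)"
    unfolding Cap_Mu by (simp add: normalize)
  also have "(?M || I) oo Sw 1 3 = S oo (I || ?M)"
    using Sw_natural[of "I" ?M 1 1 3 1] by simp
  also have "Cap oo (S oo (I || ?M)) = (Cap oo S) oo (I || ?M)"
    by (simp add: comp_assoc)
  also have "... = Cap oo ((Nk || I) oo (I || ?M))"
    unfolding Cap_Nk_left[symmetric] by (simp add: comp_assoc)
  also have "(Nk || I) oo (I || ?M) = (I || ?M) oo (Nk || idn 3)"
    using exchange[of Nk ?M 1 3 1 1] by simp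
  also have "Cap oo ((I || ?M) oo (Nk || idn 3)) = (Cap oo (I || Mu)) oo (I || Mu || I) oo (Nk || idn 3)"
    by (simp add: normalize)
  also have "... = Cap oo ((Mu oo (I || Mu)) || I) oo (Nk || idn 3)"
    unfolding Cap_Mu by (simp add: normalize)
  also have "... = Tri oo (Mu || idn 2) oo (Nk || idn 3)"
    unfolding Mu_assoc[symmetric] Tri_def by (simp add: normalize)
  finally show ?thesis using assms by (simp add: above_def normalize)
qed

lemma above_Cap_first:
  assumes "x \<noteq> y"
  shows "above Cap [x, y] Mr x Mu y 0"
proof -
  have "Cap oo (Mr || I) = Ep oo (Mu oo (Mr || I))"
    by (simp add: comp_assoc)
  also have "... = Cap oo (I || Mu) oo (S || I)"
    unfolding Mu_Mr by (simp add: comp_assoc)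
  finally show ?thesis using assms by (simp add: above_def idn_tens_idn)
qed

lemma above_Cap_second:
  assumes "x \<noteq> y"
  shows "above Cap [x, y] Mr y Mu x 1"
proof -
  have "Cap oo (I || Mr) oo (S || I) = (Cap oo (I || Mu)) oo Sw 1 2"
    by (simp add: Sw_1_2 normalize)
  also have "... = Cap oo ((Mu || I) oo Sw 1 2)"
    unfolding Cap_Mu by (simp add: comp_assoc)
  also have "(Mu || I) oo Sw 1 2 = S oo (I || Mu)"
    using Sw_natural[of "I" Mu 1 1 2 1] by simp
  also have "Cap oo (S oo (I || Mu)) = (Cap oo S) oo (I || Mu)"
    by (simp add: comp_assoc)
  also have "... = Cap oo ((Nk || I) oo (I || Mu))"
    unfolding Cap_Nk_left[symmetric] by (simp add: comp_assoc)
  also have "(Nk || I) oo (I || Mu) = (I || Mu) oo (Nk || idn 2)"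
    using exchange[of Nk Mu 1 2 1 1] by simp
  also have "Cap oo ((I || Mu) oo (Nk || idn 2)) = (Cap oo (I || Mu)) oo (Nk || idn 2)"
    by (simp add: comp_assoc)
  also have "... = Cap oo (Mu || I) oo (Nk || idn 2)"
    unfolding Cap_Mu by (simp add: comp_assoc)
  finally show ?thesis using assms by (simp add: above_def normalize)
qed


section \<open>Sliding around a vertex\<close>

lemma hzero_unique:
  assumes X: "X \<in> Obj C" "Y \<in> Obj C" and u: "u \<in> Hom C X Y" "u \<oplus> u = u"
  shows "u = \<zero> X Y"
proof -
  obtain v where v: "v \<in> Hom C X Y" "u \<oplus> v = \<zero> X Y"
    using hadd_inverse[OF X u(1)] by blast
  have "\<zero> X Y = (u \<oplus> u) \<oplus> v" using u v by simp
  also have "... = u \<oplus> (u \<oplus> v)" using hadd_assoc[OF X u(1) u(1) v(1)] .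
  also have "... = u" using v hadd_zero[OF X u(1)] by simp
  finally show ?thesis by simp
qed

lemma hzero_add: "X \<in> Obj C \<Longrightarrow> Y \<in> Obj C \<Longrightarrow> \<zero> X Y \<oplus> \<zero> X Y = \<zero> X Y"
  using hadd_zero hzero_hom by blast

lemma comp_Zero: "\<lbrakk>ok x; src x = m\<rbrakk> \<Longrightarrow> x oo Zero n m = Zero n (tgt x)"
proof -
  assume x: "ok x" "src x = m"
  then have h: "mor x \<in> Hom C (pow m) (pow (tgt x))" by (simp add: ok_def)
  have z: "\<zero> (pow n) (pow m) \<in> Hom C (pow n) (pow m)" by (simp add: hzero_hom)
  have "mor x \<cdot> \<zero> (pow n) (pow m) = \<zero> (pow n) (pow (tgt x))"
  proof (rule hzero_unique)
    show "mor x \<cdot> \<zero> (pow n) (pow m) \<in> Hom C (pow n) (pow (tgt x))"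
      using cmp_hom[OF _ _ _ h z] by simp
    show "(mor x \<cdot> \<zero> (pow n) (pow m)) \<oplus> (mor x \<cdot> \<zero> (pow n) (pow m)) = mor x \<cdot> \<zero> (pow n) (pow m)"
      using cmp_hadd_right[OF _ _ _ h z z] by (simp add: hzero_add)
  qed simp_all
  then show ?thesis by (simp add: comp_def Zero_def)
qed

lemma Zero_comp: "\<lbrakk>ok x; tgt x = n\<rbrakk> \<Longrightarrow> Zero n m oo x = Zero (src x) m"
proof -
  assume x: "ok x" "tgt x = n"
  then have h: "mor x \<in> Hom C (pow (src x)) (pow n)" by (simp add: ok_def)
  have z: "\<zero> (pow n) (pow m) \<in> Hom C (pow n) (pow m)" by (simp add: hzero_hom)
  have "\<zero> (pow n) (pow m) \<cdot> mor x = \<zero> (pow (src x)) (pow m)"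
  proof (rule hzero_unique)
    show "\<zero> (pow n) (pow m) \<cdot> mor x \<in> Hom C (pow (src x)) (pow m)"
      using cmp_hom[OF _ _ _ z h] by simp
    show "(\<zero> (pow n) (pow m) \<cdot> mor x) \<oplus> (\<zero> (pow n) (pow m) \<cdot> mor x) = \<zero> (pow n) (pow m) \<cdot> mor x"
      using cmp_hadd_left[OF _ _ _ z z h] by (simp add: hzero_add)
  qed simp_all
  then show ?thesis by (simp add: comp_def Zero_def)
qed

lemma Zero_tens: "ok x \<Longrightarrow> Zero n m || x = Zero (n + src x) (m + tgt x)"
proof -
  assume "ok x"
  then have h: "mor x \<in> Hom C (pow (src x)) (pow (tgt x))" by (simp add: ok_def)
  have z: "\<zero> (pow n) (pow m) \<in> Hom C (pow n) (pow m)" by (simp add: hzero_hom)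
  have "\<zero> (pow n) (pow m) \<otimes> mor x = \<zero> (pow (n + src x)) (pow (m + tgt x))"
  proof (rule hzero_unique)
    show "\<zero> (pow n) (pow m) \<otimes> mor x \<in> Hom C (pow (n + src x)) (pow (m + tgt x))"
      using tmor_hom[OF _ _ _ _ z h] by (simp add: pow_add)
    show "(\<zero> (pow n) (pow m) \<otimes> mor x) \<oplus> (\<zero> (pow n) (pow m) \<otimes> mor x) = \<zero> (pow n) (pow m) \<otimes> mor x"
      using tmor_hadd_left[OF _ _ _ _ z z h] by (simp add: hzero_add)
  qed simp_all
  then show ?thesis by (simp add: tens_def Zero_def)
qed

lemma Mr_Cup: "Mr oo Cup = Zero 0 1"
proof -
  have "Mr oo Cup = Mu oo (Nk || I) oo ((Nk || I) oo S oo Cup)"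
  proof -
    have "(Nk || I) oo ((Nk || I) oo S oo Cup) = ((Nk || I) oo (Nk || I)) oo S oo Cup"
      by (simp add: comp_assoc)
    also have "... = S oo Cup"
      by (simp add: comp_tens_idn[symmetric] idn_tens_idn)
    finally show ?thesis by (simp add: comp_assoc)
  qed
  also have "... = (Mu oo (Nk || I) oo Dl) oo Eta"
    unfolding S_Cup by (simp add: comp_assoc)
  finally show ?thesis unfolding Nk_conv by (simp add: Zero_comp)
qed

text \<open>
  A second insertion stays at \<open>w0\<close> during the slide; hence moves across \<open>G\<close> have to avoid \<open>w0\<close>.
\<close>
context
  fixes G Bot :: "'m arrow" and ws :: "'w list" and w0 :: 'w
begin

inductive slides :: "'m arrow \<Rightarrow> 'w \<Rightarrow> 'm arrow \<Rightarrow> 'w \<Rightarrow> nat \<Rightarrow> bool" where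
  slides_refl: "binop g \<Longrightarrow> w \<in> set ws \<Longrightarrow> slides g w g w 0"
| slides_below: "slides g w g' w' e \<Longrightarrow> below Bot ws g' w' g'' w'' e' \<Longrightarrow> slides g w g'' w'' (e + e')"
| slides_above: "slides g w g' w' e \<Longrightarrow> above G ws g' w' g'' w'' e' \<Longrightarrow> w' \<noteq> w0 \<Longrightarrow> w'' \<noteq> w0
    \<Longrightarrow> slides g w g'' w'' (e + e')"

end

lemma below_imp_slides: "below Bot ws g w g' w' e \<Longrightarrow> slides G Bot ws w0 g w g' w' e"
proof -
  assume a: "below Bot ws g w g' w' e"
  then have "binop g" "w \<in> set ws" by (simp_all add: below_def)
  from slides_below[OF slides_refl[OF this] a] show ?thesis by simp
qed

lemma above_imp_slides: "\<lbrakk>above G ws g w g' w' e; w \<noteq> w0; w' \<noteq> w0\<rbrakk> \<Longrightarrow> slides G Bot ws w0 g w g' w' e"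
proof -
  assume a: "above G ws g w g' w' e" and ne: "w \<noteq> w0" "w' \<noteq> w0"
  then have "binop g" "w \<in> set ws" by (simp_all add: above_def)
  from slides_above[OF slides_refl[OF this] a ne] show ?thesis by simp
qed

lemma slides_trans:
  "slides G Bot ws w0 g' w' g'' w'' e' \<Longrightarrow> slides G Bot ws w0 g w g' w' e \<Longrightarrow> slides G Bot ws w0 g w g'' w'' (e + e')"
proof (induction rule: slides.induct)
  case (slides_below g1 w1 g2 w2 e1 g3 w3 e2)
  show ?case
    using slides.slides_below[OF slides_below.IH[OF slides_below.prems] slides_below.hyps(2)] by (simp add: add.assoc)
next
  case (slides_above g1 w1 g2 w2 e1 g3 w3 e2)
  show ?case
    using slides.slides_above[OF slides_above.IH[OF slides_above.prems] slides_above.hyps(2-4)] by (simp add: add.assoc)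
qed simp

text \<open>\<open>Np e\<close> accumulates on the moving input. A move across \<open>Bot\<close>
  takes place directly above it; for a move across \<open>G\<close>, the moving insertion is first
  commuted up past the one at \<open>w0\<close> and afterwards back.\<close>

lemma slides_eq:
  assumes "slides G Bot ws w0 g w g' w' e"
    and G: "ok G" "src G = length ws" and B: "ok Bot" "tgt Bot = length ws" and w0: "w0 \<in> set ws"
  shows "G oo Act Mu ws w0 oo (I || (Act g ws w oo (I || Bot)))
    = G oo Act Mu ws w0 oo (I || (Act g' ws w' oo (Np e || Bot)))"
  using assms(1)
proof (induction rule: slides.induct)
  case (slides_below g w g' w' e g'' w'' e')
  then have ok: "binop g'" "binop g''" "w' \<in> set ws" "w'' \<in> set ws"
    and eq: "Act g' ws w' oo (I || Bot) = Act g'' ws w'' oo (Np e' || Bot)"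
    by (auto simp: below_def)
  have "Act g' ws w' oo (Np e || Bot) = (Act g' ws w' oo (I || Bot)) oo (Np e || idn (src Bot))"
    using ok B by (simp add: comp_assoc tens_split_left)
  also have "... = Act g'' ws w'' oo ((Np e' || Bot) oo (Np e || idn (src Bot)))"
    unfolding eq using ok B by (simp add: comp_assoc)
  also have "(Np e' || Bot) oo (Np e || idn (src Bot)) = Np (e + e') || Bot"
    using ok B by (simp add: tens_comp[symmetric] Np_add add.commute)
  finally show ?case using slides_below.IH by simp
next
  case (slides_above g w g' w' e g'' w'' e')
  let ?n = "length ws" and ?M = "Act Mu ws w0" and ?A = "Act g' ws w'" and ?B = "Act g'' ws w''"
  have ok: "binop g'" "binop g''" "w' \<in> set ws" "w'' \<in> set ws" "w' \<noteq> w0" "w'' \<noteq> w0"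
    and eq: "G oo ?A = G oo ?B oo (Np e' || idn ?n)"
    using slides_above by (auto simp: above_def)
  have c: "?M oo (I || ?A) = ?A oo (I || ?M) oo (S || idn ?n)"
    "?B oo (I || ?M) = ?M oo (I || ?B) oo (S || idn ?n)"
    using ok w0 Act_commute[of Mu g' w0 w' ws] Act_commute[of g'' Mu w'' w0 ws] by auto
  have "G oo ?M oo (I || ?A) = (G oo ?A) oo (I || ?M) oo (S || idn ?n)"
    unfolding c using ok w0 G by (simp add: comp_assoc)
  also have "... = G oo ?B oo ((Np e' || idn ?n) oo (I || ?M)) oo (S || idn ?n)"
    unfolding eq using ok w0 G by (simp add: comp_assoc)
  also have "(Np e' || idn ?n) oo (I || ?M) = (I || ?M) oo (Np e' || idn (Suc ?n))"
    using w0 exchange[of "Np e'" ?M 1 "Suc ?n" 1 ?n] by simp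
  also have "G oo ?B oo ((I || ?M) oo (Np e' || idn (Suc ?n))) oo (S || idn ?n)
     = G oo (?B oo (I || ?M)) oo (((Np e' || I) oo S) || idn ?n)"
    using ok w0 G by (simp add: normalize)
  also have "(Np e' || I) oo S = S oo (I || Np e')"
    by (simp add: S_natural)
  also have "G oo (?B oo (I || ?M)) oo ((S oo (I || Np e')) || idn ?n)
     = G oo ?M oo (I || ?B) oo ((S oo S) || idn ?n) oo (I || Np e' || idn ?n)"
    unfolding c using ok w0 G by (simp add: normalize del: Sw_Sw)
  finally have *: "G oo ?M oo (I || ?A) = G oo ?M oo (I || ?B) oo (I || Np e' || idn ?n)"
    using ok w0 by (simp add: idn_tens_idn)
  have "G oo ?M oo (I || (?A oo (Np e || Bot))) = (G oo ?M oo (I || ?A)) oo (I || Np e || Bot)"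
    using ok w0 G B by (simp add: comp_assoc tens_idn_comp)
  also have "... = G oo ?M oo (I || ?B) oo (I || ((Np e' || idn ?n) oo (Np e || Bot)))"
    unfolding * using ok w0 G B by (simp add: comp_assoc tens_idn_comp)
  also have "(Np e' || idn ?n) oo (Np e || Bot) = Np (e + e') || Bot"
    using B by (simp add: tens_comp[symmetric] Np_add add.commute)
  finally show ?case using slides_above.IH ok w0 G B by (simp add: tens_idn_comp)
qed simp

text \<open>The opening move takes p off the strand \<open>w0\<close>, so that p and q can be
  exchanged while on different strands. Thereafter q is the insertion held fixed, and p returns
  below it: the product on \<open>w0\<close> is now qp.\<close>

lemma loop_vanishes:
  assumes start: "above G ws Mu w0 Mr wa e0" and ne: "wa \<noteq> w0"
    and loop: "slides G Bot ws w0 Mr wa Mu w0 e" and even: "even (e0 + e)"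
    and B: "ok Bot" "tgt Bot = length ws"
  shows "G oo Bot = Zero (src Bot) (tgt G)"
proof -
  let ?n = "length ws" and ?M = "Act Mu ws w0" and ?A = "Act Mr ws wa" and ?b = "src Bot"
  have ok: "ok G" "src G = ?n" "w0 \<in> set ws" "wa \<in> set ws"
    and st: "G oo ?M = G oo ?A oo (Np e0 || idn ?n)"
    using start by (auto simp: above_def)
  have c: "?A oo (I || ?M) = ?M oo (I || ?A) oo (S || idn ?n)"
    using Act_commute[OF binop_Mr binop_Mu ne ok(4,3)] .
  have MM: "?M oo (I || ?M) = ?M oo (Mu || idn ?n)"
    using Act_Mu_Mu[OF ok(3)] .
  have sl: "G oo ?M oo (I || (?A oo (I || Bot))) = G oo ?M oo (I || (?M oo (Np e || Bot)))"
    using slides_eq[OF loop ok(1,2) B ok(3)] .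
  have "G oo Bot = G oo (?M oo (Eta || idn ?n)) oo Bot"
    using ok B by (simp add: Act_Mu_Eta)
  also have "... = G oo ?M oo (Eta || Bot)"
    using ok B tens_split_right[of Eta Bot 0 ?n] by (simp add: comp_assoc)
  also have "Eta || Bot = (Mu || idn ?n) oo (Cup || Bot)"
    using B by (simp add: tens_comp[symmetric] separable_Cup)
  also have "G oo ?M oo ((Mu || idn ?n) oo (Cup || Bot)) = G oo (?M oo (Mu || idn ?n)) oo (Cup || Bot)"
    using ok B by (simp add: comp_assoc)
  also have "... = (G oo ?M) oo (I || ?M) oo (Cup || Bot)"
    unfolding MM[symmetric] using ok B by (simp add: comp_assoc)
  also have "... = G oo ?A oo ((Np e0 || idn ?n) oo (I || ?M)) oo (Cup || Bot)"
    unfolding st using ok B by (simp add: comp_assoc)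
  also have "(Np e0 || idn ?n) oo (I || ?M) = (I || ?M) oo (Np e0 || idn (Suc ?n))"
    using ok exchange[of "Np e0" ?M 1 "Suc ?n" 1 ?n] by simp
  also have "G oo ?A oo ((I || ?M) oo (Np e0 || idn (Suc ?n))) oo (Cup || Bot)
     = G oo (?A oo (I || ?M)) oo ((Np e0 || I) || idn ?n) oo (Cup || Bot)"
    using ok B by (simp add: normalize)
  \<comment> \<open>From here on the first input, which is now q, goes to \<open>w0\<close>; p is
    the moving input.\<close>
  also have "... = G oo ?M oo (I || ?A) oo ((S || idn ?n) oo ((Np e0 || I) || idn ?n) oo (Cup || Bot))"
    unfolding c using ok B by (simp add: comp_assoc)
  also have "(S || idn ?n) oo ((Np e0 || I) || idn ?n) oo (Cup || Bot) = (S oo (Np e0 || I) oo Cup) || Bot"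
    using B by (simp add: tens_comp[symmetric])
  also have "... = (idn 2 || Bot) oo ((S oo (Np e0 || I) oo Cup) || idn ?b)"
    using B by (simp add: tens_split_left)
  also have "G oo ?M oo (I || ?A) oo ((idn 2 || Bot) oo ((S oo (Np e0 || I) oo Cup) || idn ?b))
     = (G oo ?M oo (I || (?A oo (I || Bot)))) oo ((S oo (Np e0 || I) oo Cup) || idn ?b)"
    using ok B by (simp add: comp_assoc tens_idn_comp idn_tens_idn_tens)
  also have "... = G oo (?M oo (I || ?M)) oo ((I || Np e || Bot) oo ((S oo (Np e0 || I) oo Cup) || idn ?b))"
    unfolding sl using ok B by (simp add: comp_assoc tens_idn_comp)
  also have "(I || Np e || Bot) oo ((S oo (Np e0 || I) oo Cup) || idn ?b)
     = ((I || Np e) oo S oo (Np e0 || I) oo Cup) || Bot"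
    using B tens_comp[of "I || Np e" "S oo (Np e0 || I) oo Cup" Bot "idn ?b"] by (simp add: tens_assoc)
  also have "(I || Np e) oo S oo (Np e0 || I) oo Cup = ((I || Np e) oo S) oo (Np e0 || I) oo Cup"
    by (simp add: comp_assoc)
  also have "(I || Np e) oo S = S oo (Np e || I)"
    by (simp add: S_natural)
  also have "(S oo (Np e || I)) oo (Np e0 || I) oo Cup = S oo ((Np e oo Np e0) || I) oo Cup"
    by (simp add: normalize)
  \<comment> \<open>The parity hypothesis: the twists \<open>e0\<close> and \<open>e\<close> cancel
    on p.\<close>
  also have "... = S oo Cup"
  proof -
    have "Np e oo Np e0 = I"
      unfolding Np_add using even by (simp add: Np_def add.commute)
    then show ?thesis by (simp add: idn_tens_idn)
  qed
  also have "G oo (?M oo (I || ?M)) oo ((S oo Cup) || Bot) = G oo ?M oo ((Mu || idn ?n) oo ((S oo Cup) || Bot))"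
    unfolding MM using ok B by (simp add: comp_assoc)
  also have "(Mu || idn ?n) oo ((S oo Cup) || Bot) = (Mr oo Cup) || Bot"
    using B by (simp add: tens_comp[symmetric] comp_assoc)
  also have "... = Zero ?b (Suc ?n)"
    unfolding Mr_Cup using B by (simp add: Zero_tens)
  finally show ?thesis using ok by (simp add: comp_Zero)
qed

text \<open>Corners and edges alternate around the cycle. The corner at \<open>u0\<close> serves as
  opening move, and the return to \<open>wl u0\<close> is the crossing of the edge to
  \<open>u0\<close>, a move across \<open>Bot\<close>, for which touching the fixed strand is
  allowed.\<close>

lemma cyclic_slide_vanishes:
  assumes p: "0 < p" "(\<pi> ^^ p) u0 = u0" "bij_betw (\<lambda>i. (\<pi> ^^ i) u0) {..<p} N"
    and start: "above G ws Mu (wl u0) Mr (wr (\<pi> u0)) (d u0)" and ne: "wr (\<pi> u0) \<noteq> wl u0"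
    and corner: "\<And>u. \<lbrakk>u \<in> N; u \<noteq> u0\<rbrakk> \<Longrightarrow> slides G Bot ws (wl u0) Mu (wl u) Mr (wr (\<pi> u)) (d u)"
    and edge: "\<And>u. u \<in> N \<Longrightarrow> below Bot ws Mr (wr u) Mu (wl u) (k u)"
    and even: "even ((\<Sum>u\<in>N. d u) + (\<Sum>u\<in>N. k u))"
    and B: "ok Bot" "tgt Bot = length ws"
  shows "G oo Bot = Zero (src Bot) (tgt G)"
proof -
  define f where "f i = (\<pi> ^^ i) u0" for i
  have f: "f 0 = u0" "f p = u0" "\<And>i. f (Suc i) = \<pi> (f i)" and bij: "bij_betw f {..<p} N"
    using p by (simp_all add: f_def[abs_def])
  obtain q where q: "p = Suc q" using p(1) gr0_implies_Suc by blast
  have fN: "f i \<in> N" if "i \<le> p" for i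
  proof (cases "i = p")
    case True
    then show ?thesis using f bij_betw_apply[OF bij, of 0] p(1) by simp
  next
    case False
    then show ?thesis using bij_betw_apply[OF bij, of i] that by simp
  qed
  have slide: "m < p \<Longrightarrow> slides G Bot ws (wl u0) Mr (wr (f 1)) Mu (wl (f (Suc m)))
      ((\<Sum>i<Suc m. k (f (Suc i))) + (\<Sum>i<m. d (f (Suc i))))" for m
  proof (induction m)
    case 0
    then show ?case using below_imp_slides[OF edge[OF fN[of 1]]] by simp
  next
    case (Suc m)
    have "f (Suc m) \<noteq> f 0"
      using inj_onD[OF bij_betw_imp_inj_on[OF bij], of "Suc m" 0] Suc.prems by auto
    then have c: "slides G Bot ws (wl u0) Mu (wl (f (Suc m))) Mr (wr (f (Suc (Suc m)))) (d (f (Suc m)))"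
      using corner[OF fN[of "Suc m"]] Suc.prems f by simp
    have e: "slides G Bot ws (wl u0) Mr (wr (f (Suc (Suc m)))) Mu (wl (f (Suc (Suc m)))) (k (f (Suc (Suc m))))"
      using below_imp_slides[OF edge[OF fN[of "Suc (Suc m)"]]] Suc.prems by simp
    have "m < p" using Suc.prems by simp
    from slides_trans[OF e slides_trans[OF c Suc.IH[OF this]]] show ?case by (simp add: add_ac)
  qed
  have sumd: "(\<Sum>u\<in>N. d u) = d u0 + (\<Sum>i<q. d (f (Suc i)))"
    unfolding sum.reindex_bij_betw[OF bij, symmetric] q sum.lessThan_Suc_shift f(1) by simp
  have "(\<Sum>u\<in>N. k u) = k u0 + (\<Sum>i<q. k (f (Suc i)))"
    unfolding sum.reindex_bij_betw[OF bij, symmetric] q sum.lessThan_Suc_shift f(1) by simp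
  \<comment> \<open>The edge to \<open>u0\<close> is crossed last, as \<open>f p\<close>, rather
    than first.\<close>
  then have sumk: "(\<Sum>u\<in>N. k u) = (\<Sum>i<Suc q. k (f (Suc i)))"
    using f(2) q by simp
  show ?thesis
  proof (rule loop_vanishes[OF start ne _ _ B])
    show "slides G Bot ws (wl u0) Mr (wr (\<pi> u0)) Mu (wl u0) ((\<Sum>i<Suc q. k (f (Suc i))) + (\<Sum>i<q. d (f (Suc i))))"
      using slide[of q] f(1,2) f(3)[of 0] q by simp
    show "even (d u0 + ((\<Sum>i<Suc q. k (f (Suc i))) + (\<Sum>i<q. d (f (Suc i)))))"
      using even unfolding sumd sumk by (simp add: add_ac)
  qed
qed


section \<open>Padding of connections, boundary insertions and edge copairings\<close>

lemma Perm_map: "inj_on f (set ws \<union> set vs) \<Longrightarrow> Perm (map f ws) (map f vs) = Perm ws vs"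
  by (simp add: Perm_def permute_map)

lemma equivariant_tens_idn:
  assumes "equivariant P xs ys"
  shows "equivariant (P || idn (length zs)) (xs @ zs) (ys @ zs)"
proof -
  have ok: "ok P" "src P = length xs" "tgt P = length ys" "set xs = set ys"
    and eq: "\<And>g w. binop g \<Longrightarrow> w \<in> set xs \<Longrightarrow> P oo Act g xs w = Act g ys w oo (I || P)"
    using assms by (auto simp: equivariant_def)
  have "(P || idn (length zs)) oo Act g (xs @ zs) w = Act g (ys @ zs) w oo (I || P || idn (length zs))"
    if g: "binop g" and w: "w \<in> set xs \<union> set zs" for g w
  proof (cases "w \<in> set xs")
    case True
    then show ?thesis
      using ok g eq[OF g True] by (simp add: Act_append_left comp_tens_idn[symmetric] tens_assoc[symmetric])
  next
    case False
    let ?A = "Act g zs w" and ?l = "length zs"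
    have w': "w \<in> set zs" "w \<notin> set ys" using False w ok by auto
    have sw: "Sw 1 (length ys) oo (I || P) = (P || I) oo Sw 1 (length xs)"
      using Sw_natural[of "I" P 1 1 "length xs" "length ys"] ok by simp
    have "(P || idn ?l) oo ((idn (length xs) || ?A) oo (Sw 1 (length xs) || idn ?l))
      = (idn (length ys) || ?A) oo (((P || I) oo Sw 1 (length xs)) || idn ?l)"
      using ok g w' exchange[of P ?A "length ys" "Suc ?l" "length xs" ?l]
      by (simp add: normalize flip: comp_assoc)
    also have "... = ((idn (length ys) || ?A) oo (Sw 1 (length ys) || idn ?l)) oo (I || P || idn ?l)"
      unfolding sw[symmetric] using ok g w' by (simp add: normalize)
    finally show ?thesis using ok False w' g by (simp add: Act_append_right)
  qed
  then show ?thesis using ok by (auto simp: equivariant_def)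
qed

lemma equivariant_idn_tens:
  assumes "equivariant P xs ys"
  shows "equivariant (idn (length zs) || P) (zs @ xs) (zs @ ys)"
proof -
  have ok: "ok P" "src P = length xs" "tgt P = length ys" "set xs = set ys"
    and eq: "\<And>g w. binop g \<Longrightarrow> w \<in> set xs \<Longrightarrow> P oo Act g xs w = Act g ys w oo (I || P)"
    using assms by (auto simp: equivariant_def)
  have "(idn (length zs) || P) oo Act g (zs @ xs) w = Act g (zs @ ys) w oo (I || idn (length zs) || P)"
    if g: "binop g" and w: "w \<in> set xs \<union> set zs" for g w
  proof (cases "w \<in> set zs")
    case True
    then show ?thesis
      using ok g exchange[of "Act g zs w" P "length zs" "length xs" "Suc (length zs)" "length ys"]
      by (simp add: Act_append_left idn_tens_idn_tens)
  next
    case False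
    let ?A = "Act g xs w" and ?B = "Act g ys w" and ?l = "length zs"
    have w': "w \<in> set xs" "w \<in> set ys" using False w ok by auto
    have "(idn ?l || P) oo ((idn ?l || ?A) oo (Sw 1 ?l || idn (length xs)))
      = (idn ?l || (P oo ?A)) oo (Sw 1 ?l || idn (length xs))"
      using ok g w' by (simp add: normalize)
    also have "... = (idn ?l || ?B) oo ((idn (?l + 1) || P) oo (Sw 1 ?l || idn (length xs)))"
      unfolding eq[OF g w'(1)] using ok g w' by (simp add: normalize)
    also have "(idn (?l + 1) || P) oo (Sw 1 ?l || idn (length xs)) = (Sw 1 ?l || idn (length ys)) oo (idn (1 + ?l) || P)"
      using ok by (intro exchange) simp_all
    finally show ?thesis using ok False w' g by (simp add: Act_append_right normalize)
  qed
  then show ?thesis using ok by (auto simp: equivariant_def)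
qed

text \<open>This is \<open>iota13\<close> after P of the given type, with the iterated coproduct
  kept in one piece.\<close>

definition kappa :: "boundary_type \<Rightarrow> 'm arrow" where
  "kappa \<delta> = Perm [0, 1, 2::nat] [2, 1, 0] oo Dl3 oo Projector \<delta>"

lemma kappa_typing [simp]: "ok (kappa \<delta>)" "src (kappa \<delta>) = 1" "tgt (kappa \<delta>) = 3"
proof -
  have "ok (Perm [0, 1, 2::nat] [2, 1, 0])" by (rule ok_Perm) simp
  then show "ok (kappa \<delta>)" by (simp add: kappa_def)
qed (simp_all add: kappa_def)

lemma mor_kappa: "mor (kappa \<delta>) = iota13 C F \<cdot> P_map C F \<delta>"
proof -
  have P: "mor (Projector \<delta>) = P_map C F \<delta>"
  proof (cases \<delta>)
    case type_NS
    have "Projector type_NS = Mu oo S oo (Nk || I) oo Dl" by (simp add: comp_assoc)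
    then show ?thesis using type_NS
      by (simp only: P_map.simps mor_simps) (simp add: Mu_def Dl_def Nk_def pow_1)
  next
    case type_R
    have "Projector type_R = Mu oo S oo Dl" by (simp add: comp_assoc)
    then show ?thesis using type_R
      by (simp only: P_map.simps mor_simps) (simp add: Mu_def Dl_def pow_1)
  qed
  have "ok (Perm [0, 1, 2::nat] [2, 1, 0])" by (rule ok_Perm) simp
  then have "kappa \<delta> = (Perm [0, 1, 2::nat] [2, 1, 0] oo (I || Dl) oo Dl) oo Projector \<delta>"
    by (simp add: kappa_def Dl3_def comp_assoc)
  then show ?thesis
    unfolding iota13_def P[symmetric] by (simp only: mor_simps) (simp add: Perm_def Dl_def pow_1)
qed

lemma kappa_eq_Perm:
  assumes "distinct [x, y, z]"
  shows "kappa \<delta> = Perm [z, y, x] [x, y, z] oo Dl3 oo Projector \<delta>"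
proof -
  let ?f = "(\<lambda>_. x)(1 := y, 0 := z) :: nat \<Rightarrow> 'a"
  have "Perm (map ?f [0, 1, 2]) (map ?f [2, 1, 0]) = Perm [0, 1, 2::nat] [2, 1, 0]"
    by (rule Perm_map) (use assms in \<open>auto simp: inj_on_def\<close>)
  then show ?thesis by (simp add: kappa_def)
qed

text \<open>Read from left to right, the outputs are the third, second and first leg of the iterated
  coproduct. Neighbouring legs cost one N; from the third leg to the first the centrality of the
  image of P is used, which depends on the type.\<close>

lemma below_kappa:
  assumes d: "distinct [x, y, z]"
  shows "below (kappa \<delta>) [x, y, z] Mr y Mu x 1"
    and "below (kappa \<delta>) [x, y, z] Mr z Mu y 1"
    and "below (kappa \<delta>) [x, y, z] Mr x Mu z (if \<delta> = type_R then 1 else 0)"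
proof -
  have d': "distinct [z, y, x]" using d by auto
  have e: "equivariant (Perm [z, y, x] [x, y, z]) [z, y, x] [x, y, z]"
    by (rule equivariant_Perm) simp
  note k = kappa_eq_Perm[OF d]
  show "below (kappa \<delta>) [x, y, z] Mr y Mu x 1"
    unfolding k by (rule below_equivariant[OF below_precomp[OF below_Dl3_second[OF d']] e]) simp_all
  show "below (kappa \<delta>) [x, y, z] Mr z Mu y 1"
    unfolding k by (rule below_equivariant[OF below_precomp[OF below_Dl3_first[OF d']] e]) simp_all
  show "below (kappa \<delta>) [x, y, z] Mr x Mu z (if \<delta> = type_R then 1 else 0)"
    unfolding k
    by (rule below_equivariant[OF below_Dl3_third[OF d' _ _ _ Projector_central] e]) simp_all
qed

definition Edge :: "int \<Rightarrow> 'm arrow" where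
  "Edge \<epsilon> = (if \<epsilon> = 1 then S oo Cup else Cup)"

lemma Edge_typing [simp]: "ok (Edge \<epsilon>)" "src (Edge \<epsilon>) = 0" "tgt (Edge \<epsilon>) = 2"
  by (simp_all add: Edge_def)

lemma mor_Edge: "mor (Edge \<epsilon>) = edge_form C F \<epsilon>"
  by (simp add: Edge_def edge_form_def comp_def Sw_def Dl_def Eta_def pow_1)

text \<open>Crossing a copairing is free in one direction and costs N in the other; the sign, which
  exchanges its legs, decides which direction is free.\<close>

lemma below_Edge:
  assumes "l \<noteq> r"
  shows "below (Edge \<epsilon>) [l, r] Mr l Mu r (if \<epsilon> = 1 then 0 else 1)"
    and "below (Edge \<epsilon>) [l, r] Mr r Mu l (if \<epsilon> = 1 then 1 else 0)"
  using below_S_Cup[OF assms] below_Cup_twisted[OF assms] below_sym[OF below_Cup[OF assms]]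
    below_equivariant[OF below_Cup_twisted[of r l] equivariant_S[OF assms]] assms
  by (auto simp: Edge_def)

lemma mor_Cap: "mor Cap = frob_pairing C F"
  by (simp add: frob_pairing_def comp_def Mu_def Ep_def)

lemma mor_Tri: "mor Tri = tri_form C F"
proof -
  have "Tri = Ep oo Mu oo (Mu || I)" by (simp add: Tri_def comp_assoc)
  then show ?thesis by (simp add: tri_form_def comp_def tens_def idn_def Mu_def Ep_def pow_1)
qed

lemma mor_Tens: "mor (Tens fs) = tensor_list C (map mor fs)"
  by (induction fs) (simp_all add: mor_simps)

end

lemma mset_interleave:
  "mset (concat (map (\<lambda>l. [Inl l, Inr (f l)]) ls)) = mset (map Inl ls @ map (\<lambda>l. Inr (f l)) ls)"
  by (induction ls) simp_all

lemma sum_list_const: "sum_list (map (\<lambda>x. k) xs) = k * length xs" for k :: nat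
  by (induction xs) auto

section \<open>The network of a marked surface\<close>

text \<open>Only the matching of labels is assumed, so that the diagram can be handled apart from
  the topology of the surface.\<close>

locale surface_network = frobenius_network C F
  for C :: "('o, 'm, 'x) monoidal_data_scheme" (structure)
    and F :: "('o, 'm, 'y) frobenius_data_scheme" +
  fixes T :: "('p, 'v, 'z) marked_surface_scheme"
    and s :: "'v set \<Rightarrow> int" and es ts :: "'v set list" and \<delta> :: "nat \<Rightarrow> boundary_type"
  assumes distinct_edge_wires: "distinct (edge_wires es)"
    and mset_wires: "mset (edge_wires es) = mset (boundary_wires T @ triangle_wires T ts)"
begin

abbreviation "bw \<equiv> boundary_wires T"
abbreviation "tw \<equiv> triangle_wires T ts"
abbreviation n where "n \<equiv> 3 * nbdry T"

text \<open>Cuts through the diagram at three heights. \<open>Inl l\<close> is the strand leaving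
  the boundary insertions in position \<open>l\<close>, and \<open>Inr w\<close> the leg
  \<open>w\<close> of an edge copairing; a strand keeps its label, so the three lists differ only in
  order.\<close>

definition "bottom_labels = map Inl [0..<n] @ map Inr (edge_wires es)"
definition "middle_labels = map Inl [0..<n] @ map Inr (bw @ tw)"
definition "boundary_labels = concat (map (\<lambda>l. [Inl l, Inr (bw ! l)]) [0..<n])"
definition "top_labels = boundary_labels @ map Inr (tw)"

text \<open>\<open>Bottom\<close> collects the pieces from which the strands come,
  \<open>Top\<close> those that absorb them. Unlike in \<open>T_in\<close>, the triangle forms are
  not followed by a further permutation.\<close>

definition "Bottom = Tens (map (\<lambda>i. kappa (\<delta> i)) [0..<nbdry T]) || Tens (map (\<lambda>e. Edge (s e)) es)"
definition "Top = Tens (map (\<lambda>_. Cap) [0..<n]) || Tens (map (\<lambda>_. Tri) ts)"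
definition "Connect =
  (Perm (map Inl [0..<n] @ map Inr (bw)) boundary_labels || idn (length (tw))) oo
  (idn n || Perm (edge_wires es) (bw @ tw))"

abbreviation "Net \<equiv> Top oo Connect"
abbreviation "below_net \<equiv> below Bottom bottom_labels"
abbreviation "above_net \<equiv> above Net bottom_labels"
abbreviation "slides_net \<equiv> slides Net Bottom bottom_labels"

lemma distinct_top_wires: "distinct (bw @ tw)"
  using distinct_edge_wires mset_eq_imp_distinct_iff[OF mset_wires] by simp

lemma length_wires: "2 * length es = n + 3 * length ts"
  using mset_eq_length[OF mset_wires]
  by (simp add: length_edge_wires length_boundary_wires length_triangle_wires)

lemma map_boundary_wires: "map (\<lambda>l. Inr (bw ! l)) [0..<n] = map Inr (bw)"
proof -
  have "map (\<lambda>l. bw ! l) [0..<n] = bw"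
    using map_nth[of "bw"] by (simp add: length_boundary_wires)
  then have "map Inr (map (\<lambda>l. bw ! l) [0..<n]) = map Inr (bw)"
    by simp
  then show ?thesis by (simp only: map_map o_def)
qed

lemma mset_boundary_labels: "mset (map Inl [0..<n] @ map Inr (bw)) = mset boundary_labels"
  unfolding boundary_labels_def mset_interleave map_boundary_wires ..

lemma length_boundary_labels: "length boundary_labels = 2 * n"
  using mset_eq_length[OF mset_boundary_labels] by (simp add: length_boundary_wires)

lemma mset_top_labels: "mset middle_labels = mset top_labels"
  using mset_boundary_labels by (simp add: middle_labels_def top_labels_def)

lemma mset_bottom_labels: "mset bottom_labels = mset middle_labels"
  using mset_wires by (simp add: bottom_labels_def middle_labels_def mset_map del: mset_append flip: mset_map)
    (simp add: mset_map)

lemma distinct_bottom_labels: "distinct bottom_labels"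
  using distinct_edge_wires by (auto simp: bottom_labels_def distinct_map)

lemma distinct_top_labels: "distinct top_labels"
  using mset_eq_imp_distinct_iff[OF mset_bottom_labels] mset_eq_imp_distinct_iff[OF mset_top_labels]
    distinct_bottom_labels by simp

lemma equivariant_Connect: "equivariant Connect bottom_labels top_labels"
proof -
  let ?R = "Inr :: 'v set \<times> side \<Rightarrow> nat + 'v set \<times> side"
  have "equivariant (Perm (map ?R (edge_wires es)) (map ?R (bw @ tw)))
    (map ?R (edge_wires es)) (map ?R (bw @ tw))"
    by (rule equivariant_Perm) (simp only: mset_map mset_wires)
  then have "equivariant (Perm (edge_wires es) (bw @ tw))
    (map ?R (edge_wires es)) (map ?R (bw @ tw))"
    by (subst (asm) Perm_map) (auto simp: inj_on_def)
  from equivariant_idn_tens[OF this, of "map Inl [0..<n]"]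
  have 1: "equivariant (idn n || Perm (edge_wires es) (bw @ tw))
    bottom_labels middle_labels"
    by (simp add: bottom_labels_def middle_labels_def)
  from equivariant_tens_idn[OF equivariant_Perm[OF mset_boundary_labels], of "map Inr (tw)"]
  have 2: "equivariant (Perm (map Inl [0..<n] @ map Inr (bw)) boundary_labels || idn (length (tw)))
    middle_labels top_labels"
    by (simp add: middle_labels_def top_labels_def)
  show ?thesis unfolding Connect_def by (rule equivariant_comp[OF 1 2])
qed

lemma Bottom_typing: "ok Bottom" "src Bottom = nbdry T" "tgt Bottom = length bottom_labels"
  unfolding Bottom_def bottom_labels_def
  by (auto intro!: ok_tens ok_Tens simp: sum_list_const length_edge_wires o_def)

lemma Top_typing: "ok Top" "src Top = length top_labels" "tgt Top = 0"
  unfolding Top_def top_labels_def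
  by (auto intro!: ok_tens ok_Tens simp: sum_list_const length_triangle_wires length_boundary_labels o_def)

lemma below_Bottom_edge:
  assumes "e \<in> set es"
  shows "below_net Mr (Inr (e, Left)) Mu (Inr (e, Right)) (if s e = 1 then 0 else 1)"
    and "below_net Mr (Inr (e, Right)) Mu (Inr (e, Left)) (if s e = 1 then 1 else 0)"
proof -
  let ?w = "\<lambda>e. [Inr (e, Left), Inr (e, Right)] :: (nat + 'v set \<times> side) list"
  have w: "map Inr (edge_wires es) = concat (map ?w es)"
    by (simp add: edge_wires_def map_concat o_def)
  have d: "distinct (concat (map ?w es))" "set (map Inl [0..<n]) \<inter> set (concat (map ?w es)) = {}"
    using distinct_bottom_labels unfolding bottom_labels_def w by auto
  have *: "below_net g v g' v' k" if "below (Edge (s e)) (?w e) g v g' v' k" for g v g' v' k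
    unfolding Bottom_def bottom_labels_def w
    by (rule below_tens_right[OF below_Tens[where f = "\<lambda>e. Edge (s e)", OF _ d(1) assms that]])
      (auto intro!: ok_Tens simp: sum_list_const o_def)
  show "below_net Mr (Inr (e, Left)) Mu (Inr (e, Right)) (if s e = 1 then 0 else 1)"
    "below_net Mr (Inr (e, Right)) Mu (Inr (e, Left)) (if s e = 1 then 1 else 0)"
    by (rule *, rule below_Edge, simp)+
qed

lemma below_Bottom_boundary:
  assumes "i < nbdry T"
  shows "below_net Mr (Inl (3 * i + 1)) Mu (Inl (3 * i)) 1"
    and "below_net Mr (Inl (3 * i + 2)) Mu (Inl (3 * i + 1)) 1"
    and "below_net Mr (Inl (3 * i)) Mu (Inl (3 * i + 2)) (if \<delta> i = type_R then 1 else 0)"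
proof -
  let ?w = "\<lambda>i. [Inl (3 * i), Inl (3 * i + 1), Inl (3 * i + 2)] :: (nat + 'v set \<times> side) list"
  have w: "map Inl [0..<n] = concat (map ?w [0..<nbdry T])"
    unfolding upt_triples[symmetric] by (simp add: map_concat o_def)
  have d: "distinct (concat (map ?w [0..<nbdry T]))"
    using distinct_bottom_labels unfolding bottom_labels_def w distinct_append by (elim conjE)
  have i: "i \<in> set [0..<nbdry T]" using assms by simp
  have *: "below_net g v g' v' k" if "below (kappa (\<delta> i)) (?w i) g v g' v' k" for g v g' v' k
    unfolding Bottom_def bottom_labels_def w
    by (rule below_tens_left[OF below_Tens[where f = "\<lambda>i. kappa (\<delta> i)", OF _ d i that]])
      (auto intro!: ok_Tens simp: sum_list_const length_edge_wires o_def)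
  show "below_net Mr (Inl (3 * i + 1)) Mu (Inl (3 * i)) 1"
    "below_net Mr (Inl (3 * i + 2)) Mu (Inl (3 * i + 1)) 1"
    "below_net Mr (Inl (3 * i)) Mu (Inl (3 * i + 2)) (if \<delta> i = type_R then 1 else 0)"
    by (rule *, rule below_kappa, simp)+
qed

lemma above_Top_boundary:
  assumes "l < n"
  shows "above_net Mr (Inl l) Mu (Inr (bw ! l)) 0"
    and "above_net Mr (Inr (bw ! l)) Mu (Inl l) 1"
proof -
  let ?w = "\<lambda>l. [Inl l, Inr (bw ! l)] :: (nat + 'v set \<times> side) list"
  have d: "distinct (concat (map ?w [0..<n]))"
    using distinct_top_labels by (simp add: top_labels_def boundary_labels_def)
  have l: "l \<in> set [0..<n]" using assms by simp
  have *: "above_net g v g' v' k" if "above Cap (?w l) g v g' v' k" for g v g' v' k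
  proof (rule above_equivariant[OF _ equivariant_Connect])
    show "above Top top_labels g v g' v' k"
      unfolding Top_def top_labels_def boundary_labels_def
      by (rule above_tens_left[OF above_Tens[where f = "\<lambda>_. Cap", OF _ d l that]])
        (auto intro!: ok_Tens simp: sum_list_const length_triangle_wires o_def)
  qed
  show "above_net Mr (Inl l) Mu (Inr (bw ! l)) 0"
    "above_net Mr (Inr (bw ! l)) Mu (Inl l) 1"
    by (rule *, rule above_Cap_first above_Cap_second, simp)+
qed

lemma above_Top_triangle:
  assumes "\<tau> \<in> set ts"
    and xyz: "triangle_labels T \<tau> = [x, y, z]"
  shows "above_net Mr (Inr x) Mu (Inr y) 0"
    and "above_net Mr (Inr y) Mu (Inr z) 0"
    and "above_net Mr (Inr z) Mu (Inr x) 1"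
proof -
  let ?w = "\<lambda>\<tau>. map Inr (triangle_labels T \<tau>) :: (nat + 'v set \<times> side) list"
  have w: "map Inr (tw) = concat (map ?w ts)"
    by (simp add: triangle_wires_def map_concat o_def)
  have d: "distinct (concat (map ?w ts))" "set boundary_labels \<inter> set (concat (map ?w ts)) = {}"
    using distinct_top_labels unfolding top_labels_def w by auto
  have len: "length (?w \<tau>) = 3" for \<tau> by (simp add: tri_edges_def split: prod.splits)
  have *: "above_net g v g' v' k" if "above Tri (?w \<tau>) g v g' v' k" for g v g' v' k
  proof (rule above_equivariant[OF _ equivariant_Connect])
    show "above Top top_labels g v g' v' k"
      unfolding Top_def top_labels_def w
      by (rule above_tens_right[OF above_Tens[where f = "\<lambda>_. Tri", OF _ d(1) assms(1) that] _ _ d(2)])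
        (use len in \<open>auto intro!: ok_Tens simp: sum_list_const length_boundary_labels o_def\<close>)
  qed
  have "distinct (?w \<tau>)"
    using d(1) assms(1) by (auto simp: distinct_concat_iff)
  then have "distinct [Inr x, Inr y, Inr z :: nat + ('v set \<times> side)]" unfolding xyz by simp
  note this[THEN above_Tri_first] this[THEN above_Tri_second] this[THEN above_Tri_third]
  then show "above_net Mr (Inr x) Mu (Inr y) 0"
    "above_net Mr (Inr y) Mu (Inr z) 0"
    "above_net Mr (Inr z) Mu (Inr x) 1"
    by (auto intro!: * simp: xyz)
qed

text \<open>Pieces acting on disjoint strands are interchanged until the triangle forms of
  \<open>T_out\<close> stand beside the pairings of \<open>T_in\<close>, and the boundary insertions
  beside the edge copairings.\<close>

lemma network_eq:
  "T_in C F T s es ts \<cdot> tensor_list C (map (\<lambda>i. iota13 C F \<cdot> P_map C F (\<delta> i)) [0..<nbdry T])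
    = mor (Net oo Bottom)"
proof -
  let ?Caps = "Tens (map (\<lambda>_. Cap) [0..<n])" and ?Tris = "Tens (map (\<lambda>_. Tri) ts)"
    and ?K = "Tens (map (\<lambda>i. kappa (\<delta> i)) [0..<nbdry T])" and ?E = "Tens (map (\<lambda>e. Edge (s e)) es)"
    and ?P = "Perm (edge_wires es) (bw @ tw)"
    and ?Q = "Perm (map Inl [0..<n] @ map Inr (bw)) boundary_labels"
    and ?t = "3 * length ts"
  have ok: "ok ?Caps" "ok ?Tris" "ok ?K" "ok ?E" "ok ?P" "ok ?Q"
    using mset_wires mset_boundary_labels by (auto intro!: ok_Tens ok_Perm)
  have dims: "src ?Caps = 2 * n" "tgt ?Caps = 0" "src ?Tris = ?t" "tgt ?Tris = 0" "src ?K = nbdry T" "tgt ?K = n"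
    "src ?E = 0" "tgt ?E = n + ?t" "src ?P = n + ?t" "tgt ?P = n + ?t" "src ?Q = 2 * n" "tgt ?Q = 2 * n"
    by (simp_all add: sum_list_const o_def length_wires length_edge_wires length_boundary_wires
        length_triangle_wires length_boundary_labels)
  \<comment> \<open>\<open>T_in\<close> labels the outputs of \<open>T_out\<close> by position; they
    are renamed to the wires they carry, which is injective as these are distinct.\<close>
  have Q: "?Q = Perm (map Inl [0..<n] @ map Inr [0..<n]) (concat (map (\<lambda>l. [Inl l, Inr l]) [0..<n]))"
  proof -
    let ?f = "case_sum Inl (\<lambda>l. Inr (bw ! l)) :: nat + nat \<Rightarrow> _"
    have 1: "map ?f (map Inl [0..<n] @ map Inr [0..<n]) = map Inl [0..<n] @ map Inr (bw)"
      unfolding map_boundary_wires[symmetric] by (simp add: o_def)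
    have 2: "map ?f (concat (map (\<lambda>l. [Inl l, Inr l]) [0..<n])) = boundary_labels"
      by (simp add: boundary_labels_def map_concat o_def)
    have "distinct (bw)" using distinct_top_wires by simp
    then have "inj_on ?f (Inl ` {0..<n} \<union> Inr ` {0..<n})"
      by (auto simp: inj_on_def nth_eq_iff_index_eq length_boundary_wires)
    then have "inj_on ?f (set (map Inl [0..<n] @ map Inr [0..<n]) \<union> set (concat (map (\<lambda>l. [Inl l, Inr l]) [0..<n])))"
      by (rule inj_on_subset) auto
    from Perm_map[OF this] show ?thesis unfolding 1 2 .
  qed
  have cap: "mor Ep \<cdot> mor Mu = frob_pairing C F"
    using mor_Cap by (simp add: mor_simps)
  define Out where "Out = (idn n || ?Tris) oo ?P oo ?E"
  have "T_in C F T s es ts \<cdot> tensor_list C (map (\<lambda>i. iota13 C F \<cdot> P_map C F (\<delta> i)) [0..<nbdry T])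
    = mor ((?Caps oo ?Q oo (idn n || Out)) oo ?K)"
    unfolding T_in_def T_out_def Out_def Let_def Q
    by (simp add: mor_simps mor_Tens mor_kappa mor_Edge mor_Cap mor_Tri o_def Perm_def map_replicate_const cap flip: mor_kappa)
  also have "(?Caps oo ?Q oo (idn n || Out)) oo ?K = ?Caps oo ?Q oo (idn (n + n) || ?Tris) oo (idn n || ?P) oo ((idn n || ?E) oo ?K)"
    unfolding Out_def using ok dims by (simp add: comp_assoc tens_idn_comp idn_tens_idn_tens)
  also have "(idn n || ?E) oo ?K = ?K || ?E"
    using tens_split_left[of ?K ?E n 0] ok dims by simp
  also have "?Caps oo ?Q oo (idn (n + n) || ?Tris) oo (idn n || ?P) oo (?K || ?E)
     = ?Caps oo (?Q oo (idn (2 * n) || ?Tris)) oo (idn n || ?P) oo (?K || ?E)"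
    using ok dims by (simp add: comp_assoc mult_2)
  also have "?Q oo (idn (2 * n) || ?Tris) = (idn (2 * n) || ?Tris) oo (?Q || idn ?t)"
    using exchange[of ?Q ?Tris "2 * n" ?t "2 * n" 0] ok dims by simp
  also have "?Caps oo ((idn (2 * n) || ?Tris) oo (?Q || idn ?t)) oo (idn n || ?P) oo (?K || ?E)
     = (?Caps oo (idn (2 * n) || ?Tris)) oo (?Q || idn ?t) oo (idn n || ?P) oo (?K || ?E)"
    using ok dims by (simp add: comp_assoc)
  also have "?Caps oo (idn (2 * n) || ?Tris) = ?Caps || ?Tris"
    using tens_split_right[of ?Caps ?Tris "2 * n" 0] ok dims by simp
  also have "(?Caps || ?Tris) oo (?Q || idn ?t) oo (idn n || ?P) oo (?K || ?E) = Net oo Bottom"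
    unfolding Top_def Connect_def Bottom_def
    using ok dims by (simp add: comp_assoc length_triangle_wires)
  finally show ?thesis .
qed

end

locale marked_network = frobenius_network C F + marked_triangulation T
  for C :: "('o, 'm, 'x) monoidal_data_scheme" (structure)
    and F :: "('o, 'm, 'y) frobenius_data_scheme"
    and T :: "('p, 'v, 'z) marked_surface_scheme" +
  fixes s :: "'v set \<Rightarrow> int" and es ts :: "'v set list" and \<delta> :: "nat \<Rightarrow> boundary_type"
  assumes es: "distinct es" "set es = edges T"
    and ts: "distinct ts" "set ts = triangles T"
    and signs: "\<forall>e\<in>edges T. s e \<in> {1, -1}"

sublocale marked_network \<subseteq> surface_network C F T s es ts \<delta>
  by unfold_locales (rule edge_wires_distinct[OF es(1)], rule edge_wires_mset[OF es ts])

context marked_network begin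

text \<open>The two legs of an edge at \<open>v\<close>: seen from \<open>v\<close> outwards,
  \<open>out_wire v u\<close> is the leg on the left and \<open>in_wire v u\<close> the one on the
  right.\<close>

abbreviation out_wire :: "'v \<Rightarrow> 'v \<Rightarrow> nat + 'v set \<times> side" where
  "out_wire v u \<equiv> Inr (wire v u)"

abbreviation in_wire :: "'v \<Rightarrow> 'v \<Rightarrow> nat + 'v set \<times> side" where
  "in_wire v u \<equiv> Inr (wire u v)"

lemma below_edge_at_vertex:
  assumes "u \<in> link v"
  shows "below_net Mr (in_wire v u) Mu (out_wire v u) (edge_twist s v u)"
proof -
  have e: "{v, u} \<in> edges T" "{u, v} = {v, u}" using assms by (auto simp: link_def)
  then have "u \<noteq> v" by (auto simp: edge_iff)
  have "{v, u} \<in> set es" using e es by simp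
  note r = below_Bottom_edge[OF this]
  show ?thesis
    using r eorient_cases[OF e(1)] \<open>u \<noteq> v\<close> unfolding wire_def edge_twist_def e(2) by auto
qed

text \<open>The legs of the triangle that meet at \<open>v\<close> belong to the edges to
  \<open>u\<close> and \<open>c\<close>. Counterclockwise motion around \<open>v\<close> traverses
  the triangle moves backwards, and the twisted one occurs if \<open>v\<close> is the first
  corner.\<close>

lemma above_corner:
  assumes q: "(v, u, c) \<in> Q"
  shows "above_net Mu (out_wire v u) Mr (in_wire v c) (corner_twist v u)"
proof -
  let ?t = "{v, u, c}"
  have t: "?t \<in> triangles T" by (rule orient_triangle[OF q])
  then have ts': "?t \<in> set ts" using ts by simp
  obtain x y z where xyz: "corners T ?t = (x, y, z)" "(x, y, z) \<in> Q" "{x, y, z} = ?t"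
    using corners_props[OF t] .
  note r = above_Top_triangle[OF ts' triangle_wires_eq[OF xyz]]
  have "(\<exists>c'. (v, u, c') \<in> Q \<and> corners T {v, u, c'} = (v, u, c')) \<longleftrightarrow> corners T ?t = (v, u, c)"
    using q orient_unique by blast
  then have tw: "corner_twist v u = (if corners T ?t = (v, u, c) then 1 else 0)"
    unfolding corner_twist_def by simp
  have d: "v \<noteq> u" "u \<noteq> c" "v \<noteq> c" using orientD(2-4)[OF q] .
  consider "(x, y, z) = (v, u, c)" | "(x, y, z) = (u, c, v)" | "(x, y, z) = (c, v, u)"
    using corners_rotation[OF q] unfolding xyz(1) by blast
  then show ?thesis
  proof cases
    case 1
    then show ?thesis using above_sym[OF r(3)] xyz(1) tw by simp
  next
    case 2
    then show ?thesis using above_sym[OF r(2)] xyz(1) tw d by simp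
  next
    case 3
    then show ?thesis using above_sym[OF r(1)] xyz(1) tw d by simp
  qed
qed

text \<open>The corner of the outer face takes three moves: through a pairing to the boundary
  insertion (twist 0), across that insertion (twist 1, but 0 for type NS between its first and third
  output), and out through another pairing (twist 1).\<close>

lemma slides_boundary_corner:
  assumes ik: "i < nbdry T" "k < 3"
  defines "v \<equiv> bmap T i k"
  assumes x: "x \<noteq> wire v (bmap T i (Suc k mod 3))" "x \<noteq> wire (bmap T i ((k + 2) mod 3)) v"
  shows "slides_net (Inr x)
    Mu (out_wire v (bmap T i (Suc k mod 3))) Mr (in_wire v (bmap T i ((k + 2) mod 3)))
    (if k = 0 \<and> \<delta> i = type_NS then 1 else 2)"
proof -
  let ?m = "(k + 2) mod 3"
  have m: "?m < 3" "Suc ?m mod 3 = k" using ik(2) by auto presburger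
  have w: "wire v (bmap T i (Suc k mod 3)) = bw ! (3 * i + k)"
    "wire (bmap T i ?m) v = bw ! (3 * i + ?m)"
    using boundary_edge(5)[OF ik] boundary_edge(5)[OF ik(1) m(1)] boundary_wires_nth[OF ik]
      boundary_wires_nth[OF ik(1) m(1)] m(2) unfolding v_def by auto
  have l: "3 * i + k < n" "3 * i + ?m < n" using ik m by auto
  have "below_net Mr (Inl (3 * i + k)) Mu (Inl (3 * i + ?m)) (if k = 0 \<and> \<delta> i = type_NS then 0 else 1)"
  proof -
    note r = below_Bottom_boundary[OF ik(1)]
    have "k = 0 \<or> k = 1 \<or> k = 2" using ik(2) by linarith
    then consider "k = 0" "?m = 2" | "k = 1" "?m = 0" | "k = 2" "?m = 1" by (elim disjE) simp_all
    then show ?thesis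
    proof cases
      case 1
      show ?thesis unfolding 1(2) using r(3) 1(1) by (cases "\<delta> i") simp_all
    next
      case 2
      show ?thesis unfolding 2(2) using r(1) 2(1) by simp
    next
      case 3
      show ?thesis unfolding 3(2) using r(2) 3(1) by simp
    qed
  qed
  note mid = below_imp_slides[OF this]
  have 1: "slides_net (Inr x) Mu (Inr (bw ! (3 * i + k))) Mr (Inl (3 * i + k)) 0"
    by (rule above_imp_slides[OF above_sym[OF above_Top_boundary(1)[OF l(1)]]]) (use x w in auto)
  have 2: "slides_net (Inr x) Mu (Inl (3 * i + ?m)) Mr (Inr (bw ! (3 * i + ?m))) 1"
    by (rule above_imp_slides[OF above_sym[OF above_Top_boundary(2)[OF l(2)]]]) (use x w in auto)
  have t: "0 + (if k = 0 \<and> \<delta> i = type_NS then 0 else 1) + 1 = (if k = 0 \<and> \<delta> i = type_NS then 1 else 2 :: nat)"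
    by simp
  show ?thesis
    unfolding w using slides_trans[OF 2 slides_trans[OF mid 1]] unfolding t .
qed

lemma in_wire_neq_out_wire:
  assumes "u \<in> link v" "c \<in> link v"
  shows "in_wire v c \<noteq> out_wire v u"
  using wire_inject[of c v v u] assms by (auto simp: link_def edge_iff insert_commute)

lemma out_wire_inject: "\<lbrakk>u \<in> link v; u' \<in> link v; out_wire v u = out_wire v u'\<rbrakk> \<Longrightarrow> u = u'"
  using wire_inject[of v u v u'] by (simp add: link_def)

lemma orient_link: "(v, u, c) \<in> Q \<Longrightarrow> u \<in> link v \<and> c \<in> link v"
  using orient_edge(1)[of v u c] orient_edge(2)[OF orientD(6)[of v u c]] by (simp add: link_def)

section \<open>Vanishing at a vertex that violates the sign condition\<close>

text \<open>If no triangle lay to the left of an edge directed away from \<open>v\<close>, it would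
  be a boundary edge. So the link closes up through triangles alone, and every corner is a single
  move.\<close>

lemma inner_vertex_vanishes:
  assumes v: "v \<in> inner_vertices T"
    and viol: "(\<Prod>e | e \<in> edges T \<and> v \<in> e. s e) \<noteq> (-1) ^ (D_count T v + K_count T v + 1)"
  shows "Net oo Bottom = Zero (nbdry T) 0"
proof -
  have vK: "{v} \<in> K" and nb: "v \<notin> \<Union> (boundary_edges T)"
    using v by (auto simp: inner_vertices_def vertices_def)
  obtain u0 where "u0 \<noteq> v" "{v, u0} \<in> K" using vertex_in_edge[OF complex(1,3) vK] .
  then have u0: "u0 \<in> link v" by (auto simp: link_def edge_iff)
  have tri: "\<exists>c. (v, u, c) \<in> Q" if u: "u \<in> link v" for u
  proof (rule ccontr)
    assume "\<nexists>c. (v, u, c) \<in> Q"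
    then have no: "\<And>c. (v, u, c) \<notin> Q" by blast
    have ed: "{v, u} \<in> edges T" using u by (simp add: link_def)
    obtain i k where "i < nbdry T" "k < 3" "v = bmap T i k" "u = bmap T i (Suc k mod 3)"
      by (rule no_triangle_boundary[OF ed no])
    then have "v \<in> bedge T i k" "bedge T i k \<in> boundary_edges T"
      using boundary_edge(1,2) by auto
    then show False using nb by blast
  qed
  \<comment> \<open>The link of an inner vertex has no ends, so \<open>v\<close> is a mere filler
    for the closing vertex.\<close>
  obtain p where p: "0 < p" "(next_in_link v v ^^ p) u0 = u0"
    "bij_betw (\<lambda>i. (next_in_link v v ^^ i) u0) {..<p} (link v)"
    by (rule link_cycle[OF vK u0, of v v]) (use tri in blast)+
  have step: "above_net Mu (out_wire v u) Mr (in_wire v (next_in_link v v u)) (corner_twist v u)"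
    "next_in_link v v u \<in> link v" if "u \<in> link v" for u
    using tri[OF that] above_corner next_in_link_triangle orient_link by metis+
  have "Net oo Bottom = Zero (src Bottom) (tgt Net)"
  proof (rule cyclic_slide_vanishes[OF p, where wl = "out_wire v" and wr = "in_wire v"
        and d = "corner_twist v" and k = "edge_twist s v"])
    show "above_net Mu (out_wire v u0) Mr (in_wire v (next_in_link v v u0)) (corner_twist v u0)"
      by (rule step(1)[OF u0])
    show "in_wire v (next_in_link v v u0) \<noteq> out_wire v u0"
      by (rule in_wire_neq_out_wire[OF u0 step(2)[OF u0]])
    fix u assume u: "u \<in> link v"
    show "below_net Mr (in_wire v u) Mu (out_wire v u) (edge_twist s v u)"
      by (rule below_edge_at_vertex[OF u])
    assume "u \<noteq> u0"
    then show "slides_net (out_wire v u0) Mu (out_wire v u)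
        Mr (in_wire v (next_in_link v v u)) (corner_twist v u)"
      using out_wire_inject[OF u u0] in_wire_neq_out_wire[OF u0 step(2)[OF u]]
      by (intro above_imp_slides[OF step(1)[OF u]]) auto
  next
    show "even ((\<Sum>u\<in>link v. corner_twist v u) + (\<Sum>u\<in>link v. edge_twist s v u))"
      unfolding sum_corner_twist[OF vK] by (rule even_twist[OF signs viol])
  qed (use Bottom_typing in simp_all)
  then show ?thesis using Bottom_typing Top_typing by simp
qed

text \<open>The link of \<open>v\<close> is a path from \<open>b\<close> to \<open>a\<close>, closed
  by the corner of the outer face. Starting at \<open>b\<close> makes the opening move a corner of a
  triangle, while the composite slide at \<open>a\<close> is passed later.\<close>

lemma boundary_vertex_vanishes:
  assumes ik: "i < nbdry T" "k < 3"
  defines "v \<equiv> bmap T i k"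
  assumes viol: "(\<Prod>e | e \<in> edges T \<and> v \<in> e. s e) \<noteq> (-1) ^ (D'_count T i (\<delta> i) v + K_count T v + 1)"
  shows "Net oo Bottom = Zero (nbdry T) 0"
proof -
  let ?m = "(k + 2) mod 3"
  define a where "a = bmap T i (Suc k mod 3)"
  define b where "b = bmap T i ?m"
  have m: "?m < 3" "Suc ?m mod 3 = k" using ik(2) by auto presburger
  have a: "a \<in> link v" "\<And>c. (v, a, c) \<notin> Q"
    using boundary_edge(3,6)[OF ik] by (simp_all add: link_def a_def v_def)
  have b: "b \<in> link v" "\<And>c. (b, v, c) \<notin> Q"
    using boundary_edge(3,6)[OF ik(1) m(1)] m(2) by (simp_all add: link_def b_def v_def insert_commute)
  have vK: "{v} \<in> K" using a(1) vertex_of_simplex[of "{v, a}" v] by (simp add: link_def edge_iff)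
  obtain c0 where c0: "(v, b, c0) \<in> Q" using bmap_orient[OF ik(1) m(1)] m(2) by (auto simp: b_def v_def)
  have pred: "(v, x, b) \<notin> Q" for x using b(2)[of x] orientD(6)[of v x b] by blast
  have ends: "u = a \<and> b \<in> link v \<and> (\<forall>x. (v, x, b) \<notin> Q)" if u: "u \<in> link v" "\<And>c. (v, u, c) \<notin> Q" for u
  proof -
    have ed: "{v, u} \<in> edges T" using u(1) by (simp add: link_def)
    obtain j l where jl: "j < nbdry T" "l < 3" "v = bmap T j l" "u = bmap T j (Suc l mod 3)"
      by (rule no_triangle_boundary[OF ed u(2)])
    have "(i, k) = (j, l)"
      using inj_onD[OF bmap_inj, of "(i, k)" "(j, l)"] ik jl by (auto simp: v_def)
    then show ?thesis using jl b(1) pred by (simp add: a_def)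
  qed
  let ?\<pi> = "next_in_link b v"
  obtain p where p: "0 < p" "(?\<pi> ^^ p) b = b" "bij_betw (\<lambda>i. (?\<pi> ^^ i) b) {..<p} (link v)"
    by (rule link_cycle[OF vK b(1), of a b]) (use ends in blast)+
  \<comment> \<open>The twist of the outer corner, with the parity of D' - D: only vertex 0 of a
    component of type NS gives an odd value.\<close>
  define e where "e = (if k = 0 \<and> \<delta> i = type_NS then 1 else 2 :: nat)"
  define d where "d u = (if u = a then e else corner_twist v u)" for u
  have "b \<noteq> a" using c0 a(2) by blast
  have \<pi>a: "?\<pi> a = b" by (rule next_in_link_end[OF a(2)])
  have step: "above_net Mu (out_wire v u) Mr (in_wire v (?\<pi> u)) (d u)" "?\<pi> u \<in> link v"
    if u: "u \<in> link v" "u \<noteq> a" for u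
  proof -
    obtain c where c: "(v, u, c) \<in> Q" using ends[OF u(1)] u(2) by blast
    show "above_net Mu (out_wire v u) Mr (in_wire v (?\<pi> u)) (d u)" "?\<pi> u \<in> link v"
      using above_corner[OF c] next_in_link_triangle[OF c, of b] orient_link[OF c] u(2) by (simp_all add: d_def)
  qed
  have "Net oo Bottom = Zero (src Bottom) (tgt Net)"
  proof (rule cyclic_slide_vanishes[OF p, where wl = "out_wire v" and wr = "in_wire v"
        and d = d and k = "edge_twist s v"])
    show "above_net Mu (out_wire v b) Mr (in_wire v (?\<pi> b)) (d b)"
      by (rule step(1)[OF b(1) \<open>b \<noteq> a\<close>])
    show "in_wire v (?\<pi> b) \<noteq> out_wire v b"
      by (rule in_wire_neq_out_wire[OF b(1) step(2)[OF b(1) \<open>b \<noteq> a\<close>]])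
    fix u assume u: "u \<in> link v"
    show "below_net Mr (in_wire v u) Mu (out_wire v u) (edge_twist s v u)"
      by (rule below_edge_at_vertex[OF u])
    assume ub: "u \<noteq> b"
    show "slides_net (out_wire v b) Mu (out_wire v u) Mr (in_wire v (?\<pi> u)) (d u)"
    proof (cases "u = a")
      case True
      have "wire v b \<noteq> wire v a" "wire v b \<noteq> wire b v"
        using out_wire_inject[OF b(1) a(1)] in_wire_neq_out_wire[OF b(1) b(1)] \<open>b \<noteq> a\<close> by auto
      then show ?thesis
        using slides_boundary_corner[OF ik, of "wire v b"] True \<pi>a
        by (simp add: d_def e_def a_def b_def v_def)
    next
      case False
      then show ?thesis
        using out_wire_inject[OF u b(1)] ub in_wire_neq_out_wire[OF b(1) step(2)[OF u False]]
        by (intro above_imp_slides[OF step(1)[OF u False]]) auto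
    qed
  next
    \<comment> \<open>No triangle lies to the left of the edge from \<open>v\<close> to
      \<open>a\<close>, so putting \<open>e\<close> in place of its corner twist adds
      \<open>e\<close> to the sum.\<close>
    have "corner_twist v a = 0" using a(2) by (simp add: corner_twist_def)
    then have "(\<Sum>u\<in>link v. d u) = e + (\<Sum>u\<in>link v. corner_twist v u)"
      unfolding d_def using finite_link[of v] a(1)
      by (simp add: sum.remove[of "link v" a] cong: sum.cong_simp)
    also have "... = e + D_count T v" by (simp add: sum_corner_twist[OF vK])
    finally have sd: "(\<Sum>u\<in>link v. d u) = e + D_count T v" .
    have "bparam T i 1 = homeo T (vertex_point v) \<longleftrightarrow> k = 0"
    proof -
      have "{bmap T i 0} \<in> K"
        using boundary_edge(3)[OF ik(1), of 0] vertex_of_simplex[of "{bmap T i 0, bmap T i (Suc 0 mod 3)}" "bmap T i 0"]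
        by (simp add: edge_iff)
      then have "bparam T i 1 = homeo T (vertex_point v) \<longleftrightarrow> bmap T i 0 = v"
        using bparam_1[OF ik(1)] homeo_vertex_iff vK by simp
      also have "... \<longleftrightarrow> k = 0"
        using inj_onD[OF bmap_inj, of "(i, 0)" "(i, k)"] ik by (auto simp: v_def)
      finally show ?thesis .
    qed
    then have D': "D'_count T i (\<delta> i) v = (if k = 0 \<and> \<delta> i = type_NS then D_count T v + 1 else D_count T v)"
      by (auto simp: D'_count_def)
    show "even ((\<Sum>u\<in>link v. d u) + (\<Sum>u\<in>link v. edge_twist s v u))"
      using even_twist[OF signs viol] unfolding sd D' e_def by (auto split: if_splits)
  qed (use Bottom_typing in simp_all)
  then show ?thesis using Bottom_typing Top_typing by simp
qed

text \<open>Admissibility asks for some type on each boundary component. Its failure there gives a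
  violated vertex for every type, in particular for the type \<open>\<delta> i\<close> of the
  inserted P.\<close>

lemma not_admissible_vanishes:
  assumes "\<not> admissible T s"
  shows "Net oo Bottom = Zero (nbdry T) 0"
proof -
  consider v where "v \<in> inner_vertices T"
      "(\<Prod>e | e \<in> edges T \<and> v \<in> e. s e) \<noteq> (-1) ^ (D_count T v + K_count T v + 1)"
    | i where "i < nbdry T" "\<forall>\<delta>. \<exists>k<3. let v = bmap T i k in
        (\<Prod>e | e \<in> edges T \<and> v \<in> e. s e) \<noteq> (-1) ^ (D'_count T i \<delta> v + K_count T v + 1)"
    using assms unfolding admissible_def Let_def by blast
  then show ?thesis
  proof cases
    case 1
    then show ?thesis by (rule inner_vertex_vanishes)
  next
    case 2
    then obtain k where "k < 3" "(\<Prod>e | e \<in> edges T \<and> bmap T i k \<in> e. s e)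
        \<noteq> (-1) ^ (D'_count T i (\<delta> i) (bmap T i k) + K_count T (bmap T i k) + 1)"
      unfolding Let_def by blast
    then show ?thesis using boundary_vertex_vanishes[OF \<open>i < nbdry T\<close>] by blast
  qed
qed

end

theorem proposition4p28:
  fixes C :: "('o, 'm, 'x) monoidal_data_scheme"
    and A :: "('o, 'm, 'y) frobenius_data_scheme"
    and \<Lambda> :: "('p, 'v, 'z) marked_surface_scheme"
    and s :: "'v set \<Rightarrow> int"
    and \<delta> :: "nat \<Rightarrow> boundary_type"
    and es ts :: "'v set list"
  assumes "additive_symmetric_strict_monoidal_category C"
    and "frobenius_algebra C A"
    and "delta_separable C A"
    and "nakayama C A \<cdot>\<^bsub>C\<^esub> nakayama C A = ident C (carr A)"
    and "convolution C A (nakayama C A) (ident C (carr A)) = hzero C (carr A) (carr A)"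
    and "marked_triangulated_surface \<Lambda>"
    and "distinct es" and "set es = edges \<Lambda>"
    and "distinct ts" and "set ts = triangles \<Lambda>"
    and "\<forall>e\<in>edges \<Lambda>. s e \<in> {1, -1}"
    and "\<not> admissible \<Lambda> s"
  shows "T_in C A \<Lambda> s es ts \<cdot>\<^bsub>C\<^esub>
      tensor_list C (map (\<lambda>i. iota13 C A \<cdot>\<^bsub>C\<^esub> P_map C A (\<delta> i)) [0..<nbdry \<Lambda>])
    = hzero C (tpow C (carr A) (nbdry \<Lambda>)) (uobj C)"
proof -
  interpret marked_network C A \<Lambda> s es ts \<delta>
    using assms by (intro marked_network.intro frobenius_network.intro frobenius_network_axioms.intro
        marked_triangulation.intro marked_network_axioms.intro)
  show ?thesis
    unfolding network_eq not_admissible_vanishes[OF assms(12)] by (simp add: mor_simps)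
qed

end
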